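(* Let $q=e^{2\pi i\tau}$ with $\Im\tau>0$, let $\eta(\tau)=q^{1/24}\prod_{j\ge1}(1-q^j)$ and $P(q)=1-24\sum_{j\ge1}\frac{jq^j}{1-q^j}$. Define $$z=\tfrac14\bigl(6P(q^{12})-3P(q^6)+2P(q^4)-P(q^2)\bigr)+2\eta(2\tau)\eta(4\tau)\eta(6\tau)\eta(12\tau),\qquad x=\frac{\eta(2\tau)\eta(4\tau)\eta(6\tau)\eta(12\tau)}{z}.$$ For $n\ge0$ let $$t(n)=\sum_{k=0}^{\lfloor n/2\rfloor}\binom{n}{2k}\binom{2k}{k}^2\binom{2n-4k}{n-2k}.$$ Then in a neighborhood of $x=0$ (i.e. for $q$ in a neighborhood of $0$), $$z=\sum_{n=0}^\infty t(n)x^n.$$ *)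

theory Defs
  imports "HOL-Analysis.Analysis"
begin

definition qpar :: "complex \<Rightarrow> complex" where
  "qpar \<tau> = exp (2 * of_real pi * \<i> * \<tau>)"

text \<open>The fractional power \<open>q\<^sup>1\<^sup>/\<^sup>2\<^sup>4\<close> means \<open>exp (2 \<pi> \<i> \<tau> / 24)\<close>, not a principal branch
  applied to \<open>q\<close>.\<close>

definition dedekind_eta :: "complex \<Rightarrow> complex" where
  "dedekind_eta \<tau> = exp (2 * of_real pi * \<i> * \<tau> / 24) * (\<Prod>j. 1 - qpar \<tau> ^ Suc j)"

definition ramanujan_P :: "complex \<Rightarrow> complex" where
  "ramanujan_P q = 1 - 24 * (\<Sum>j. of_nat (Suc j) * q ^ Suc j / (1 - q ^ Suc j))"

definition eta_product :: "complex \<Rightarrow> complex" where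
  "eta_product \<tau> =
     dedekind_eta (2 * \<tau>) * dedekind_eta (4 * \<tau>) * dedekind_eta (6 * \<tau>) * dedekind_eta (12 * \<tau>)"

definition z_fun :: "complex \<Rightarrow> complex" where
  "z_fun \<tau> = (let q = qpar \<tau> in
     1 / 4 * (6 * ramanujan_P (q ^ 12) - 3 * ramanujan_P (q ^ 6)
              + 2 * ramanujan_P (q ^ 4) - ramanujan_P (q ^ 2))
     + 2 * eta_product \<tau>)"

definition x_fun :: "complex \<Rightarrow> complex" where
  "x_fun \<tau> = eta_product \<tau> / z_fun \<tau>"

definition t_coeff :: "nat \<Rightarrow> nat" where
  "t_coeff n = (\<Sum>k=0..n div 2.
     (n choose (2 * k)) * ((2 * k) choose k)\<^sup>2 * ((2 * n - 4 * k) choose (n - 2 * k)))"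

end

theory Submission imports Defs "HOL-Complex_Analysis.Complex_Analysis" begin

text \<open>
  Write \<open>Q = q\<^sup>2\<close>, \<open>D = Q d/dQ\<close>. Since \<open>t(n) = \<Sum>\<^sub>j (n choose 2j) 2\<^sup>n\<^sup>-\<^sup>2\<^sup>j b(j)\<close> with
  \<open>b(j) = (2j choose j) \<Sum>\<^sub>k (j choose k)\<^sup>2 (2k choose k)\<close>, the claim reduces to \<open>Z = \<Sum> b(n) Y\<^sup>n\<close>, where
  \<open>Z = z - 2 \<eta>\<eta>\<eta>\<eta>\<close> and \<open>Y = (\<eta>\<eta>\<eta>\<eta> / Z)\<^sup>2\<close> are functions of \<open>Q\<close> of level 6. Let \<open>\<psi>\<close> be Ramanujan's theta function,
  \<open>w = Q \<psi>(Q\<^sup>3)\<^sup>4 / \<psi>(Q)\<^sup>4\<close> and \<open>N = \<psi>(Q)\<^sup>6 / \<psi>(Q\<^sup>3)\<^sup>2\<close>. With \<open>v\<^sup>2 = w(Q\<^sup>2)\<close> one has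
  \<open>w(Q) = v (1 - v) / (1 + 3v)\<close> and \<open>N(Q) = (1 + 3v)\<^sup>2 N(Q\<^sup>2)\<close>; these follow algebraically from the duplication
  formulas for theta functions once Legendre's cubic modular equation is known.

  Everything else is obtained from one principle: a function that is continuous at 0 and invariant under
  \<open>Q \<mapsto> Q\<^sup>2\<close> is constant. It is applied to \<open>Z / (N (1 - 9w\<^sup>2))\<close>, where \<open>Z\<close> is the logarithmic
  derivative \<open>D u / u\<close> of the eta quotient \<open>u = w / ((1 - w)(1 - 9w))\<close>, and to \<open>T(w(Q)) / N(Q)\<close>, where
  \<open>T(w) = B(y) / (1 - 9w\<^sup>2)\<close>, \<open>B\<close> is the generating function of \<open>b\<close> and \<open>y = w (1 - w)(1 - 9w) / (1 - 9w\<^sup>2)\<^sup>2\<close>.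
  The functional equation \<open>T(v (1 - v) / (1 + 3v)) = (1 + 3v)\<^sup>2 T(v\<^sup>2)\<close> holds because both sides are squares of
  solutions of the same second-order differential equation.
\<close>

section \<open>The coefficients\<close>

text \<open>Let S = X + 1/X + Y + 1/Y + U + 1/U. Then \<open>b_coeff j\<close> can be read as the
  constant term of S^(2j), the number of closed walks of length 2j on the cubic lattice, and t(n) as
  the constant term of (2 + S)^n. Expanding 1/(1 - 2x - xS) shows why adding twice the eta product
  to Z corresponds to replacing x by x/(1 - 2x). The squaring principle takes the place of a
  dimension count for modular forms, but it only serves quotients with a nonzero limit at 0. In
  Legendre's equation the defect itself must be shown to vanish, so that case is settled by a
  contraction under squaring. The factor 1 - 9w^2 has two sources that happen to agree. It is the
  numerator in D u / u = (D w / w) (1 - 9w^2) / ((1 - w)(1 - 9w)). It is also the d for which d^2 -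
  4p and d^2 - 36p are both squares, where p = w(1 - w)(1 - 9w). Hence y = p/d^2 makes the square
  root of (1 - 4y)(1 - 36y), the leading coefficient in the equation of B, rational in w.\<close>

definition a_coeff :: "nat \<Rightarrow> nat" where
  "a_coeff n = (\<Sum>k\<le>n. (n choose k)\<^sup>2 * ((2 * k) choose k))"

definition b_coeff :: "nat \<Rightarrow> nat" where
  "b_coeff n = ((2 * n) choose n) * a_coeff n"

section \<open>Recurrences and growth of the coefficients\<close>

lemma central_binomial_Suc:
  "Suc k * ((2 * Suc k) choose Suc k) = 2 * (2 * k + 1) * ((2 * k) choose k)"
proof -
  have 1: "Suc k * (Suc (2 * k + 1) choose Suc k) = Suc (2 * k + 1) * ((2 * k + 1) choose k)"
    by (rule Suc_times_binomial_eq[of "2*k+1" k, simplified mult.commute[of "_ choose _"], symmetric, THEN trans])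
       simp
  have 2: "Suc k * ((2 * k + 1) choose k) = (2 * k + 1) * ((2 * k) choose k)"
  proof -
    have "((2 * k + 1) choose k) = ((2 * k + 1) choose Suc k)"
      using binomial_symmetric[of k "2 * k + 1"] by simp
    thus ?thesis
      using Suc_times_binomial_eq[of "2 * k" k] by (simp add: mult.commute)
  qed
  have "Suc k * (Suc k * (Suc (2 * k + 1) choose Suc k)) = Suc k * (2 * (2 * k + 1) * ((2 * k) choose k))"
    using 1 2 by (simp add: algebra_simps)
  thus ?thesis by (simp del: mult_Suc)
qed

text \<open>\<open>G\<close> is the certificate found by Zeilberger's algorithm for the recurrence \<open>a_coeff_rec\<close>.\<close>

lemma a_coeff_telescoping_term:
  fixes n k :: nat
  assumes n: "n = Suc m"
  defines "G \<equiv> (\<lambda>k. real k * (3 * real k - 4 - 4 * real n) * real ((n choose (k - 1))\<^sup>2 * ((2 * k) choose k)))"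
  shows "(real n + 1)\<^sup>2 * real ((Suc n choose k)\<^sup>2 * ((2 * k) choose k))
       - (10 * (real n)\<^sup>2 + 10 * real n + 3) * real ((n choose k)\<^sup>2 * ((2 * k) choose k))
       + 9 * (real n)\<^sup>2 * real ((m choose k)\<^sup>2 * ((2 * k) choose k)) = G (Suc k) - G k"
proof (cases k)
  case 0
  thus ?thesis by (simp add: G_def power2_eq_square algebra_simps)
next
  case (Suc j)
  define X where "X = real (n choose j)"
  define Y where "Y = real (n choose Suc j)"
  define V where "V = real (m choose Suc j)"
  define c where "c = real ((2 * k) choose k)"
  \<comment> \<open>Absorption makes the neighbouring binomials multiples of \<open>X\<close>, so
    that after removing the common factor \<open>c\<close> a rational identity in n and k remains.
    The division by k is the reason why k = 0 is a separate case.\<close>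
  have XY: "real k * Y = (real n + 1 - real k) * X"
  proof -
    have "real (Suc j * (n choose Suc j)) = real ((n - j) * (n choose j))"
      by (metis binomial_absorb_comp binomial_absorption mult.commute n diff_Suc_1 of_nat_eq_iff)
    thus ?thesis unfolding X_def Y_def Suc
      by (cases "j \<le> n") (simp_all add: of_nat_diff algebra_simps)
  qed
  have V: "real n * V = (real n - real k) * Y"
  proof -
    have "n * (m choose Suc j) = (n - Suc j) * (n choose Suc j)"
      using binomial_absorb_comp[of n "Suc j"] n by simp
    hence "real (n * (m choose Suc j)) = real ((n - Suc j) * (n choose Suc j))" by simp
    thus ?thesis unfolding V_def Y_def Suc
      by (cases "Suc j \<le> n") (auto simp: of_nat_diff binomial_eq_0)
  qed
  have c': "(real k + 1) * real ((2 * Suc k) choose Suc k) = 2 * (2 * real k + 1) * c"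
    using arg_cong[OF central_binomial_Suc[of k], of real] unfolding c_def
    by (simp only: of_nat_mult of_nat_Suc of_nat_add of_nat_numeral of_nat_1 add.commute)
  have kp: "real k > 0" using Suc by simp
  have Yeq: "Y = (real n + 1 - real k) * X / real k" using XY kp by (simp add: field_simps)
  have main: "(real n + 1)\<^sup>2 * (X + Y)\<^sup>2 - (10 * (real n)\<^sup>2 + 10 * real n + 3) * Y\<^sup>2 + 9 * (real n * V)\<^sup>2
     = 2 * (2 * real k + 1) * (3 * real k - 1 - 4 * real n) * Y\<^sup>2 - real k * (3 * real k - 4 - 4 * real n) * X\<^sup>2"
    unfolding V unfolding Yeq using kp by (simp add: field_simps) algebra
  have G1: "G (Suc k) = (3 * real k - 1 - 4 * real n) * Y\<^sup>2 * ((real k + 1) * real ((2 * Suc k) choose Suc k))"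
    unfolding G_def Y_def Suc by (simp add: algebra_simps)
  have G0: "G k = real k * (3 * real k - 4 - 4 * real n) * X\<^sup>2 * c"
    unfolding G_def X_def c_def Suc by simp
  have "(real n + 1)\<^sup>2 * ((X + Y)\<^sup>2 * c)
       - (10 * (real n)\<^sup>2 + 10 * real n + 3) * (Y\<^sup>2 * c)
       + 9 * (real n)\<^sup>2 * (V\<^sup>2 * c) = c * ((real n + 1)\<^sup>2 * (X + Y)\<^sup>2 - (10 * (real n)\<^sup>2 + 10 * real n + 3) * Y\<^sup>2 + 9 * (real n * V)\<^sup>2)"
    by (simp add: power_mult_distrib algebra_simps)
  also have "\<dots> = G (Suc k) - G k" unfolding main G1 c' G0 by (simp add: algebra_simps)
  finally show ?thesis unfolding X_def Y_def V_def c_def Suc by simp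
qed

text \<open>A common range of summation for three consecutive values, so that the certificate can be
  summed termwise.\<close>

lemma a_coeff_extend:
  assumes "n \<le> N"
  shows "a_coeff n = (\<Sum>k\<le>N. (n choose k)\<^sup>2 * ((2 * k) choose k))"
  unfolding a_coeff_def using assms by (intro sum.mono_neutral_left) (auto simp: binomial_eq_0)

lemma a_coeff_rec:
  "(real m + 2)\<^sup>2 * real (a_coeff (m + 2)) =
     (10 * (real m + 1)\<^sup>2 + 10 * (real m + 1) + 3) * real (a_coeff (m + 1)) - 9 * (real m + 1)\<^sup>2 * real (a_coeff m)"
proof -
  let ?G = "\<lambda>k. real k * (3 * real k - 4 - 4 * real (Suc m)) * real ((Suc m choose (k - 1))\<^sup>2 * ((2 * k) choose k))"
  have "(real (Suc m) + 1)\<^sup>2 * real (a_coeff (Suc (Suc m)))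
       - (10 * (real (Suc m))\<^sup>2 + 10 * real (Suc m) + 3) * real (a_coeff (Suc m))
       + 9 * (real (Suc m))\<^sup>2 * real (a_coeff m)
      = (\<Sum>k\<le>Suc (Suc m). ?G (Suc k) - ?G k)"
    unfolding a_coeff_extend[of "Suc (Suc m)" "Suc (Suc m)", OF order_refl]
      a_coeff_extend[of "Suc m" "Suc (Suc m)", OF le_SucI[OF order_refl]]
      a_coeff_extend[of m "Suc (Suc m)", OF le_SucI[OF le_SucI[OF order_refl]]]
      of_nat_sum sum_distrib_left sum_subtractf[symmetric] sum.distrib[symmetric]
    by (intro sum.cong refl a_coeff_telescoping_term[OF refl])
  also have "\<dots> = (\<Sum>k<Suc (Suc (Suc m)). ?G (Suc k) - ?G k)" by (simp only: lessThan_Suc_atMost)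
  also have "\<dots> = ?G (Suc (Suc (Suc m))) - ?G 0" by (rule sum_lessThan_telescope)
  \<comment> \<open>At the lower end the factor k vanishes; at the upper end the binomial has lower
    index m + 2 above its upper index m + 1.\<close>
  also have "\<dots> = 0" by (simp add: binomial_eq_0 del: binomial_Suc_Suc)
  finally show ?thesis by (simp add: algebra_simps)
qed

text \<open>The recurrence of a is multiplied by central binomials, whose successive ratio is 2(2m +
  1)/(m + 1). This raises the degree of the coefficients in m from 2 to 3, whence the third-order
  differential equation below.\<close>

lemma b_coeff_rec:
  "(real m + 2) ^ 3 * real (b_coeff (m + 2)) =
     2 * (2 * real m + 3) * (10 * (real m + 1)\<^sup>2 + 10 * (real m + 1) + 3) * real (b_coeff (m + 1))
     - 36 * (real m + 1) * (2 * real m + 1) * (2 * real m + 3) * real (b_coeff m)"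
proof -
  define c0 where "c0 = real ((2 * m) choose m)"
  define c1 where "c1 = real ((2 * (m + 1)) choose (m + 1))"
  define c2 where "c2 = real ((2 * (m + 2)) choose (m + 2))"
  have 1: "(real m + 1) * c1 = 2 * (2 * real m + 1) * c0"
    using arg_cong[OF central_binomial_Suc[of m], of real] unfolding c0_def c1_def
    by (simp only: of_nat_mult of_nat_Suc of_nat_add of_nat_numeral of_nat_1 add.commute Suc_eq_plus1)
  have 2: "(real m + 2) * c2 = 2 * (2 * real m + 3) * c1"
    using arg_cong[OF central_binomial_Suc[of "m+1"], of real] unfolding c1_def c2_def
    by (simp add: algebra_simps)
  have "(real m + 2) ^ 3 * real (b_coeff (m + 2)) = ((real m + 2) * c2) * ((real m + 2)\<^sup>2 * real (a_coeff (m + 2)))"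
    by (simp add: b_coeff_def c2_def power2_eq_square power3_eq_cube algebra_simps)
  also have "\<dots> = 2 * (2 * real m + 3) * c1 * ((10 * (real m + 1)\<^sup>2 + 10 * (real m + 1) + 3) * real (a_coeff (m + 1))) 
      - 18 * (2 * real m + 3) * (real m + 1) * real (a_coeff m) * ((real m + 1) * c1)"
    unfolding 2 a_coeff_rec by (simp add: power2_eq_square algebra_simps)
  also have "\<dots> = 2 * (2 * real m + 3) * (10 * (real m + 1)\<^sup>2 + 10 * (real m + 1) + 3) * (c1 * real (a_coeff (m + 1)))
     - 36 * (real m + 1) * (2 * real m + 1) * (2 * real m + 3) * (c0 * real (a_coeff m))"
    unfolding 1 by (simp add: algebra_simps)
  finally show ?thesis by (simp add: b_coeff_def c0_def c1_def)
qed

lemma b_coeff_0 [simp]: "b_coeff 0 = 1" and b_coeff_1: "b_coeff 1 = 6"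
  by (simp_all add: b_coeff_def a_coeff_def numeral_2_eq_2)

lemma central_binomial_le: "((2 * n) choose n) \<le> 4 ^ n"
  using binomial_le_pow2[of "2 * n" n] by (simp add: power_mult)

text \<open>The squares of the binomials sum to a central binomial, so a(n) is at most 16^n. The
  resulting constant 64 = 4 * 16 fixes the radius 1/64 for B and the radius 1/10 for the series of
  t.\<close>

lemma b_coeff_le: "b_coeff n \<le> 64 ^ n"
proof -
  have "a_coeff n \<le> (\<Sum>k\<le>n. (n choose k)\<^sup>2 * 4 ^ n)" unfolding a_coeff_def
  proof (intro sum_mono mult_left_mono)
    fix k assume "k \<in> {..n}"
    thus "((2 * k) choose k) \<le> 4 ^ n"
      using central_binomial_le[of k] power_increasing[of k n "4::nat"] by (auto intro: le_trans)
  qed simp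
  also have "\<dots> = ((2 * n) choose n) * 4 ^ n"
    by (simp add: sum_distrib_right[symmetric] choose_square_sum)
  also have "\<dots> \<le> 4 ^ n * 4 ^ n" using central_binomial_le[of n] by simp
  finally have "b_coeff n \<le> 4 ^ n * (4 ^ n * 4 ^ n)" unfolding b_coeff_def
    using central_binomial_le[of n] by (intro mult_mono) auto
  also have "\<dots> = 64 ^ n" by (simp add: power_mult_distrib[symmetric])
  finally show ?thesis .
qed

text \<open>Both summands equal (2j)! (2k)! / (k!^4 (j - k)!^2). In terms of walks, 2k of the 2j
  steps lie in a plane and the others on a line.\<close>

lemma b_coeff_double_sum:
  "b_coeff j = (\<Sum>k\<le>j. ((2 * j) choose (2 * k)) * ((2 * k) choose k)\<^sup>2 * ((2 * (j - k)) choose (j - k)))"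
proof -
  have "((2 * j) choose j) * ((j choose k)\<^sup>2 * ((2 * k) choose k))
      = ((2 * j) choose (2 * k)) * ((2 * k) choose k)\<^sup>2 * ((2 * (j - k)) choose (j - k))" if "k \<le> j" for k
  proof -
    obtain i where i: "j = k + i" using \<open>k \<le> j\<close> le_Suc_ex by blast
    have f: "real (n choose r) = fact n / (fact r * fact (n - r))" if "r \<le> n" for n r
      by (rule binomial_fact[OF that])
    have "real (((2 * j) choose j) * (j choose k)\<^sup>2)
        = real (((2 * j) choose (2 * k)) * ((2 * k) choose k) * ((2 * (j - k)) choose (j - k)))"
      unfolding of_nat_mult of_nat_power using i
      by (simp add: f divide_simps power2_eq_square algebra_simps)
    hence "((2 * j) choose j) * (j choose k)\<^sup>2 = ((2 * j) choose (2 * k)) * ((2 * k) choose k) * ((2 * (j - k)) choose (j - k))"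
      using of_nat_eq_iff by blast
    thus ?thesis by (simp add: power2_eq_square algebra_simps)
  qed
  thus ?thesis unfolding b_coeff_def a_coeff_def sum_distrib_left by (intro sum.cong) auto
qed

section \<open>From b to t by binomial expansion\<close>

lemma coeff_one_plus_monom_power:
  "coeff ((1 + monom 1 d :: nat poly) ^ j) n = (\<Sum>i\<le>j. if d * i = n then j choose i else 0)"
proof -
  have "(1 + monom 1 d :: nat poly) ^ j = (\<Sum>i\<le>j. of_nat (j choose i) * monom 1 d ^ i)"
    by (subst add.commute, subst binomial_ring) simp
  also have "\<dots> = (\<Sum>i\<le>j. monom (j choose i) (d * i))"
    by (intro sum.cong refl) (simp add: monom_power of_nat_poly smult_monom mult.commute)
  finally show ?thesis by (simp add: coeff_sum coeff_monom)
qed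

text \<open>Both sides are the coefficient of \<open>X\<^sup>m\<close> in \<open>(1 + X)\<^sup>2\<^sup>m = ((1 + X\<^sup>2) + 2X)\<^sup>m\<close>.\<close>

lemma central_binomial_expand:
  "((2 * m) choose m) = (\<Sum>i\<le>m div 2. (m choose (2 * i)) * ((2 * i) choose i) * 2 ^ (m - 2 * i))"
proof -
  let ?c = "\<lambda>j. coeff ((1 + monom 1 2 :: nat poly) ^ j) j"
  have "(1 + monom 1 1 :: nat poly) ^ (2 * m) = ((1 + monom 1 2) + monom 2 1) ^ m"
  proof -
    have "(1 + monom 1 1 :: nat poly)\<^sup>2 = (1 + monom 1 2) + monom 2 1"
    proof -
      have "monom 2 1 = monom 1 1 + (monom 1 1 :: nat poly)" by (simp only: add_monom one_add_one)
      thus ?thesis by (simp add: power2_eq_square algebra_simps mult_monom numeral_2_eq_2)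
    qed
    thus ?thesis by (simp add: power_mult)
  qed
  also have "\<dots> = (\<Sum>j\<le>m. of_nat (m choose j) * (1 + monom 1 2) ^ j * monom 2 1 ^ (m - j))"
    by (rule binomial_ring)
  finally have "coeff ((1 + monom 1 1 :: nat poly) ^ (2 * m)) m
       = (\<Sum>j\<le>m. coeff (of_nat (m choose j) * (1 + monom 1 2) ^ j * monom 2 1 ^ (m - j)) m)"
    by (simp add: coeff_sum)
  also have "\<dots> = (\<Sum>j\<le>m. (m choose j) * 2 ^ (m - j) * ?c j)"
  proof (intro sum.cong refl)
    fix j assume "j \<in> {..m}"
    have "of_nat (m choose j) * (1 + monom 1 2 :: nat poly) ^ j * monom 2 1 ^ (m - j)
        = monom ((m choose j) * 2 ^ (m - j)) (m - j) * (1 + monom 1 2) ^ j"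
      by (simp add: monom_power of_nat_poly smult_monom mult_ac flip: smult_monom)
    thus "coeff (of_nat (m choose j) * (1 + monom 1 2 :: nat poly) ^ j * monom 2 1 ^ (m - j)) m
        = (m choose j) * 2 ^ (m - j) * ?c j"
      using \<open>j \<in> {..m}\<close> by (simp add: coeff_monom_mult del: mult_monom)
  qed
  also have "\<dots> = (\<Sum>j | j \<le> m \<and> even j. (m choose j) * 2 ^ (m - j) * ?c j)"
  proof (intro sum.mono_neutral_right ballI)
    fix j assume "j \<in> {..m} - {j. j \<le> m \<and> even j}"
    hence "odd j" by auto
    hence "?c j = 0" unfolding coeff_one_plus_monom_power by (intro sum.neutral) auto
    thus "(m choose j) * 2 ^ (m - j) * ?c j = 0" by simp
  qed auto
  also have "\<dots> = (\<Sum>i\<le>m div 2. (m choose (2 * i)) * 2 ^ (m - 2 * i) * ?c (2 * i))"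
    by (intro sum.reindex_bij_witness[of _ "\<lambda>i. 2 * i" "\<lambda>j. j div 2"]) auto
  also have "\<dots> = (\<Sum>i\<le>m div 2. (m choose (2 * i)) * ((2 * i) choose i) * 2 ^ (m - 2 * i))"
  proof (intro sum.cong refl)
    fix i
    have "?c (2 * i) = (2 * i) choose i" unfolding coeff_one_plus_monom_power by simp
    thus "(m choose (2 * i)) * 2 ^ (m - 2 * i) * ?c (2 * i) = (m choose (2 * i)) * ((2 * i) choose i) * 2 ^ (m - 2 * i)"
      by (simp only: mult_ac)
  qed
  also have "coeff ((1 + monom 1 1 :: nat poly) ^ (2 * m)) m = (2 * m) choose m"
    unfolding coeff_one_plus_monom_power by simp
  finally show ?thesis .
qed

text \<open>The last binomial of t(n) is expanded into a sum over i. Collecting the terms with k + i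
  = j and exchanging products of binomials by (n choose 2k)(n - 2k choose 2i) = (n choose 2j)(2j
  choose 2k) leaves the double-sum form of b(j).\<close>

lemma t_coeff_eq_b_coeff_sum:
  "t_coeff n = (\<Sum>j\<le>n div 2. (n choose (2 * j)) * 2 ^ (n - 2 * j) * b_coeff j)"
proof -
  define h where "h = (\<lambda>k i. (n choose (2 * (k + i))) * 2 ^ (n - 2 * (k + i)) *
     (((2 * (k + i)) choose (2 * k)) * ((2 * k) choose k)\<^sup>2 * ((2 * i) choose i)))"
  have "t_coeff n = (\<Sum>k\<le>n div 2. \<Sum>i\<le>n div 2 - k. h k i)"
    unfolding t_coeff_def atLeast0AtMost
  proof (intro sum.cong refl)
    fix k assume "k \<in> {..n div 2}"
    hence k: "2 * k \<le> n" by auto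
    have e: "2 * n - 4 * k = 2 * (n - 2 * k)" "(n - 2 * k) div 2 = n div 2 - k" using k by auto
    have "(n choose (2 * k)) * ((2 * k) choose k)\<^sup>2 * ((2 * n - 4 * k) choose (n - 2 * k))
      = (\<Sum>i\<le>n div 2 - k. (n choose (2 * k)) * ((2 * k) choose k)\<^sup>2 *
           (((n - 2 * k) choose (2 * i)) * ((2 * i) choose i) * 2 ^ (n - 2 * k - 2 * i)))"
      unfolding e(1) central_binomial_expand[of "n - 2 * k"] e(2) sum_distrib_left ..
    also have "\<dots> = (\<Sum>i\<le>n div 2 - k. h k i)"
    proof (intro sum.cong refl)
      fix i assume "i \<in> {..n div 2 - k}"
      hence i: "2 * (k + i) \<le> n" using k by auto
      have "(n choose (2 * (k + i))) * ((2 * (k + i)) choose (2 * k)) = (n choose (2 * k)) * ((n - 2 * k) choose (2 * i))"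
        using choose_mult[of "2 * k" "2 * (k + i)" n] i by simp
      thus "(n choose (2 * k)) * ((2 * k) choose k)\<^sup>2 *
           (((n - 2 * k) choose (2 * i)) * ((2 * i) choose i) * 2 ^ (n - 2 * k - 2 * i)) = h k i"
        unfolding h_def by (simp add: algebra_simps)
    qed
    finally show "(n choose (2 * k)) * ((2 * k) choose k)\<^sup>2 * ((2 * n - 4 * k) choose (n - 2 * k)) = (\<Sum>i\<le>n div 2 - k. h k i)" .
  qed
  also have "\<dots> = (\<Sum>j\<le>n div 2. \<Sum>k\<le>j. h k (j - k))"
    by (subst sum.Sigma, simp, simp, subst sum.Sigma, simp, simp)
       (rule sum.reindex_bij_witness[of _ "\<lambda>(j,k). (k, j - k)" "\<lambda>(k,i). (k + i, k)"], auto)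
  also have "\<dots> = (\<Sum>j\<le>n div 2. (n choose (2 * j)) * 2 ^ (n - 2 * j) * b_coeff j)"
    unfolding b_coeff_double_sum sum_distrib_left
  proof (intro sum.cong refl)
    fix j k :: nat assume "k \<in> {..j}"
    hence e: "k + (j - k) = j" by simp
    show "h k (j - k) = (n choose (2 * j)) * 2 ^ (n - 2 * j) *
      (((2 * j) choose (2 * k)) * ((2 * k) choose k)\<^sup>2 * ((2 * (j - k)) choose (j - k)))"
      unfolding h_def e ..
  qed
  finally show ?thesis .
qed

section \<open>Absolutely convergent rearrangement of the series of t\<close>

lemma negative_binomial_sums:
  fixes z :: complex
  assumes "norm z < 1"
  shows "(\<lambda>m. of_nat ((m + k) choose k) * z ^ m) sums (1 / (1 - z) ^ Suc k)"
  using assms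
proof (induction k arbitrary: z)
  case 0
  thus ?case using geometric_sums[of z] by simp
next
  case (Suc k)
  \<comment> \<open>The induction hypothesis at the real point |z| supplies absolute convergence at
    z, which the Cauchy product requires.\<close>
  have "(\<lambda>m. of_nat ((m + k) choose k) * complex_of_real (norm z) ^ m) sums
          (1 / (1 - complex_of_real (norm z)) ^ Suc k)"
    by (rule Suc.IH) (use Suc.prems in simp)
  hence "summable (\<lambda>m. complex_of_real (real ((m + k) choose k) * norm z ^ m))"
    by (simp add: sums_iff)
  hence 1: "summable (\<lambda>m. norm (of_nat ((m + k) choose k) * z ^ m))"
    unfolding summable_of_real_iff by (simp add: norm_mult norm_power)
  have 2: "summable (\<lambda>m. norm (z ^ m))"
    using Suc.prems by (simp add: norm_power summable_geometric)
  have "(\<lambda>m. \<Sum>i\<le>m. (of_nat ((i + k) choose k) * z ^ i) * z ^ (m - i)) sums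
          ((\<Sum>m. of_nat ((m + k) choose k) * z ^ m) * (\<Sum>m. z ^ m))"
    by (rule Cauchy_product_sums[OF 1 2])
  also have "(\<Sum>m. of_nat ((m + k) choose k) * z ^ m) * (\<Sum>m. z ^ m) = 1 / (1 - z) ^ Suc (Suc k)"
    using Suc.IH[OF Suc.prems] suminf_geometric[OF Suc.prems] by (simp add: sums_iff)
  also have "(\<lambda>m. \<Sum>i\<le>m. (of_nat ((i + k) choose k) * z ^ i) * z ^ (m - i))
           = (\<lambda>m. of_nat ((m + Suc k) choose Suc k) * z ^ m)"
  proof
    fix m
    have "(\<Sum>i\<le>m. (of_nat ((i + k) choose k) * z ^ i) * z ^ (m - i)) = (\<Sum>i\<le>m. of_nat ((k + i) choose k) * z ^ m)"
      by (intro sum.cong refl) (simp add: mult.assoc add.commute flip: power_add)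
    also have "\<dots> = of_nat (\<Sum>i\<le>m. (k + i) choose k) * z ^ m"
      by (simp add: sum_distrib_right)
    also have "(\<Sum>i\<le>m. (k + i) choose k) = (m + Suc k) choose Suc k"
      by (subst choose_rising_sum(1)) (simp add: add_ac)
    finally show "(\<Sum>i\<le>m. (of_nat ((i + k) choose k) * z ^ i) * z ^ (m - i)) = of_nat ((m + Suc k) choose Suc k) * z ^ m" .
  qed
  finally show ?case .
qed

text \<open>One double series is summed in two orders: over m with j fixed the negative binomial
  series gives \<open>g j\<close>, and along n = m + 2j it gives t(n) x^n. The radius 1/10 comes
  from 8|x| < 1 - 2|x|, which is the condition for the majorant with ratio 64|x|^2 / (1 - 2|x|)^2 to
  converge.\<close>

lemma t_coeff_sums:
  fixes x :: complex
  assumes x: "norm x < 1 / 10"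
  shows "(\<lambda>n. of_nat (t_coeff n) * x ^ n) sums
           (1 / (1 - 2 * x) * (\<Sum>j. of_nat (b_coeff j) * ((x / (1 - 2 * x))\<^sup>2) ^ j))"
proof -
  define f :: "nat \<Rightarrow> nat \<Rightarrow> complex" where
    "f = (\<lambda>j m. of_nat (b_coeff j) * x ^ (2 * j) * (of_nat ((m + 2 * j) choose (2 * j)) * (2 * x) ^ m))"
  define g :: "nat \<Rightarrow> complex" where
    "g = (\<lambda>j. of_nat (b_coeff j) * x ^ (2 * j) * (1 / (1 - 2 * x) ^ Suc (2 * j)))"
  define X where "X = norm x"
  have X: "0 \<le> X" "X < 1 / 10" using x by (auto simp: X_def)
  have fg: "(f j has_sum g j) UNIV" and nf: "(\<Sum>m. norm (f j m)) = real (b_coeff j) * X ^ (2 * j) * (1 / (1 - 2 * X) ^ Suc (2 * j))"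
     and nfs: "summable (\<lambda>m. norm (f j m))" for j
  proof -
    have "(\<lambda>m. of_nat ((m + 2 * j) choose (2 * j)) * (complex_of_real (2 * X)) ^ m) sums
            (1 / (1 - complex_of_real (2 * X)) ^ Suc (2 * j))"
      by (rule negative_binomial_sums) (use X in simp)
    hence "(\<lambda>m. complex_of_real (real ((m + 2 * j) choose (2 * j)) * (2 * X) ^ m)) sums
            complex_of_real (1 / (1 - 2 * X) ^ Suc (2 * j))" by simp
    hence "(\<lambda>m. real ((m + 2 * j) choose (2 * j)) * (2 * X) ^ m) sums (1 / (1 - 2 * X) ^ Suc (2 * j))"
      by (simp only: sums_of_real_iff)
    from sums_mult[OF this, of "real (b_coeff j) * X ^ (2 * j)"]
    have s: "(\<lambda>m. norm (f j m)) sums (real (b_coeff j) * X ^ (2 * j) * (1 / (1 - 2 * X) ^ Suc (2 * j)))"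
      by (simp add: f_def X_def norm_mult norm_power)
    thus "(\<Sum>m. norm (f j m)) = real (b_coeff j) * X ^ (2 * j) * (1 / (1 - 2 * X) ^ Suc (2 * j))"
      and nfs: "summable (\<lambda>m. norm (f j m))" by (simp_all only: sums_iff)
    have "f j sums g j" unfolding f_def g_def
      by (intro sums_mult negative_binomial_sums) (use X in \<open>simp add: X_def norm_mult\<close>)
    thus "(f j has_sum g j) UNIV" by (rule norm_summable_imp_has_sum[OF nfs])
  qed
  have bnd: "norm (real (b_coeff j) * X ^ (2 * j) * (1 / (1 - 2 * X) ^ Suc (2 * j))) \<le> 2 * ((64 * X\<^sup>2) / (1 - 2 * X)\<^sup>2) ^ j" for j
  proof -
    have "real (b_coeff j) \<le> 64 ^ j" using b_coeff_le[of j] by (metis of_nat_le_iff of_nat_numeral of_nat_power)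
    have "1 / (1 - 2 * X) \<le> 2" using X by (simp add: field_simps)
    have "norm (real (b_coeff j) * X ^ (2 * j) * (1 / (1 - 2 * X) ^ Suc (2 * j)))
        = real (b_coeff j) * (X ^ (2 * j) * (1 / (1 - 2 * X) ^ (2 * j)) * (1 / (1 - 2 * X)))"
      using X by (simp add: abs_mult)
    also have "\<dots> \<le> 64 ^ j * (X ^ (2 * j) * (1 / (1 - 2 * X) ^ (2 * j)) * 2)"
      using X \<open>1 / (1 - 2 * X) \<le> 2\<close> \<open>real (b_coeff j) \<le> 64 ^ j\<close>
      by (intro mult_mono order_refl) auto
    also have "\<dots> = 2 * ((64 * X\<^sup>2) / (1 - 2 * X)\<^sup>2) ^ j"
      by (simp add: power_mult power_divide power_mult_distrib)
    finally show ?thesis .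
  qed
  have lt1: "(64 * X\<^sup>2) / (1 - 2 * X)\<^sup>2 < 1"
  proof -
    have "(8 * X)\<^sup>2 < (1 - 2 * X)\<^sup>2" using X by (intro power_strict_mono) auto
    thus ?thesis using X by (simp add: power_mult_distrib)
  qed
  have ns: "summable (\<lambda>j. real (b_coeff j) * X ^ (2 * j) * (1 / (1 - 2 * X) ^ Suc (2 * j)))"
    by (rule summable_comparison_test'[OF _ bnd], intro summable_mult summable_geometric)
       (use lt1 in simp)
  have "(\<lambda>p. norm (case p of (j, m) \<Rightarrow> f j m)) summable_on (UNIV \<times> UNIV)"
    unfolding Infinite_Sum.abs_summable_on_Sigma_iff
  proof (intro conjI ballI)
    fix j show "(\<lambda>m. norm (case (j, m) of (j, m) \<Rightarrow> f j m)) summable_on UNIV"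
      using nfs[of j] by (simp add: summable_nonneg_imp_summable_on)
  next
    have "(\<Sum>\<^sub>\<infinity>m. norm (f j m)) = real (b_coeff j) * X ^ (2 * j) * (1 / (1 - 2 * X) ^ Suc (2 * j))" for j
    proof -
      have "((\<lambda>m. norm (f j m)) has_sum (\<Sum>m. norm (f j m))) UNIV"
        by (intro norm_summable_imp_has_sum summable_sums) (use nfs[of j] in simp_all)
      thus ?thesis unfolding nf by (rule infsumI)
    qed
    thus "(\<lambda>j. norm (\<Sum>\<^sub>\<infinity>m. norm (case (j, m) of (j, m) \<Rightarrow> f j m))) summable_on UNIV"
      using ns X by (auto intro!: summable_nonneg_imp_summable_on simp: abs_mult)
  qed
  hence su: "(\<lambda>(j, m). f j m) summable_on (UNIV \<times> UNIV)" by (rule abs_summable_summable)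
  have sg: "summable (\<lambda>j. norm (g j))"
  proof (rule summable_comparison_test'[OF ns, of 0])
    fix j
    have "1 - 2 * X \<le> norm (1 - 2 * x)" using norm_triangle_ineq2[of 1 "2 * x"] by (simp add: X_def norm_mult)
    hence "(1 - 2 * X) ^ Suc (2 * j) \<le> norm (1 - 2 * x) ^ Suc (2 * j)" using X by (intro power_mono) auto
    hence "1 / norm (1 - 2 * x) ^ Suc (2 * j) \<le> 1 / (1 - 2 * X) ^ Suc (2 * j)"
      using X \<open>1 - 2 * X \<le> norm (1 - 2 * x)\<close> by (intro divide_left_mono mult_pos_pos zero_less_power) linarith+
    hence "real (b_coeff j) * X ^ (2 * j) * (1 / norm (1 - 2 * x) ^ Suc (2 * j))
         \<le> real (b_coeff j) * X ^ (2 * j) * (1 / (1 - 2 * X) ^ Suc (2 * j))"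
      using X by (intro mult_left_mono) auto
    moreover have "norm (norm (g j)) = real (b_coeff j) * X ^ (2 * j) * (1 / norm (1 - 2 * x) ^ Suc (2 * j))"
      by (simp add: g_def X_def norm_mult norm_divide norm_power)
    ultimately show "norm (norm (g j)) \<le> real (b_coeff j) * X ^ (2 * j) * (1 / (1 - 2 * X) ^ Suc (2 * j))" by simp
  qed
  have gs: "(g has_sum suminf g) UNIV"
    by (rule norm_summable_imp_has_sum[OF sg summable_sums[OF summable_norm_cancel[OF sg]]])
  have "((\<lambda>(j, m). f j m) has_sum suminf g) (UNIV \<times> UNIV)"
    by (rule has_sum_SigmaI[OF _ gs su]) (use fg in simp)
  hence S: "((\<lambda>(n, j). f j (n - 2 * j)) has_sum suminf g) (SIGMA n:UNIV. {..n div 2})"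
    by (subst has_sum_reindex_bij_witness[of _ "\<lambda>(j,m). (m + 2 * j, j)" "\<lambda>(n,j). (j, n - 2 * j)" "UNIV \<times> UNIV" "\<lambda>(j, m). f j m"])
       auto
  have inner: "((\<lambda>j. f j (n - 2 * j)) has_sum (of_nat (t_coeff n) * x ^ n)) {..n div 2}" for n
  proof -
    have "(\<Sum>j\<le>n div 2. f j (n - 2 * j)) = (\<Sum>j\<le>n div 2. of_nat ((n choose (2 * j)) * 2 ^ (n - 2 * j) * b_coeff j) * x ^ n)"
    proof (intro sum.cong refl)
      fix j assume "j \<in> {..n div 2}"
      hence j: "2 * j \<le> n" by auto
      have "x ^ n = x ^ (2 * j) * x ^ (n - 2 * j)" using j by (simp flip: power_add)
      thus "f j (n - 2 * j) = of_nat ((n choose (2 * j)) * 2 ^ (n - 2 * j) * b_coeff j) * x ^ n"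
        unfolding f_def using j by (simp add: power_mult_distrib mult_ac)
    qed
    also have "\<dots> = of_nat (t_coeff n) * x ^ n"
      unfolding t_coeff_eq_b_coeff_sum by (simp add: sum_distrib_right)
    finally show ?thesis by (metis finite_atMost has_sum_finite)
  qed
  have "((\<lambda>n. of_nat (t_coeff n) * x ^ n) has_sum suminf g) UNIV"
    by (rule has_sum_SigmaD[OF S]) (use inner in simp)
  hence "(\<lambda>n. of_nat (t_coeff n) * x ^ n) sums suminf g" by (rule has_sum_imp_sums)
  also have "g = (\<lambda>j. 1 / (1 - 2 * x) * (of_nat (b_coeff j) * ((x / (1 - 2 * x))\<^sup>2) ^ j))"
    by (simp add: g_def fun_eq_iff power_divide flip: power_mult)
  also have "suminf \<dots> = 1 / (1 - 2 * x) * (\<Sum>j. of_nat (b_coeff j) * ((x / (1 - 2 * x))\<^sup>2) ^ j)"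
  proof (rule suminf_mult)
    have "1 - 2 * x \<noteq> 0"
    proof
      assume "1 - 2 * x = 0"
      hence "norm (2 * x) = 1" by simp
      thus False using X by (simp add: X_def norm_mult)
    qed
    hence "(\<lambda>j. of_nat (b_coeff j) * ((x / (1 - 2 * x))\<^sup>2) ^ j) = (\<lambda>j. (1 - 2 * x) * g j)"
      by (simp add: g_def fun_eq_iff power_divide flip: power_mult)
    thus "summable (\<lambda>j. of_nat (b_coeff j) * ((x / (1 - 2 * x))\<^sup>2) ^ j)"
      using summable_mult[OF summable_norm_cancel[OF sg], of "1 - 2 * x"] by simp
  qed
  finally show ?thesis .
qed

section \<open>The generating function\<close>

text \<open>The operator of interest is y d/dy: it multiplies the n-th coefficient by n, and so
  turns a recurrence polynomial in n into a differential equation.\<close>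

lemma theta_powser:
  fixes c :: "nat \<Rightarrow> complex"
  assumes sm: "\<And>y. norm y < r \<Longrightarrow> summable (\<lambda>n. c n * y ^ n)" and y: "norm y < r"
  shows "summable (\<lambda>n. of_nat n * c n * y ^ n)"
    and "((\<lambda>y. \<Sum>n. c n * y ^ n) has_field_derivative (\<Sum>n. diffs c n * y ^ n)) (at y)"
    and "y * (\<Sum>n. diffs c n * y ^ n) = (\<Sum>n. of_nat n * c n * y ^ n)"
proof -
  have sd: "summable (\<lambda>n. diffs c n * y ^ n)" by (rule termdiff_converges[OF y sm])
  have e: "(\<lambda>n. y * (diffs c n * y ^ n)) = (\<lambda>n. of_nat (Suc n) * c (Suc n) * y ^ Suc n)"
    by (simp add: diffs_def fun_eq_iff mult_ac)
  have "(\<lambda>n. of_nat (Suc n) * c (Suc n) * y ^ Suc n) sums (y * (\<Sum>n. diffs c n * y ^ n))"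
    using sums_mult[OF summable_sums[OF sd], of y] unfolding e .
  hence "(\<lambda>n. of_nat n * c n * y ^ n) sums (y * (\<Sum>n. diffs c n * y ^ n))"
    by (subst (asm) sums_Suc_iff) simp
  thus "summable (\<lambda>n. of_nat n * c n * y ^ n)"
    and "y * (\<Sum>n. diffs c n * y ^ n) = (\<Sum>n. of_nat n * c n * y ^ n)" by (simp_all add: sums_iff)
  show "((\<lambda>y. \<Sum>n. c n * y ^ n) has_field_derivative (\<Sum>n. diffs c n * y ^ n)) (at y)"
    by (rule termdiffs_strong'[OF sm y])
qed

text \<open>\<open>B_theta k\<close> is \<open>(y d/dy)\<^sup>k\<close> applied to the generating function of \<open>b_coeff\<close>.\<close>

definition B_theta :: "nat \<Rightarrow> complex \<Rightarrow> complex" where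
  "B_theta k y = (\<Sum>n. (of_nat n ^ k * of_nat (b_coeff n)) * y ^ n)"

lemma B_theta_0 [simp]: "B_theta k 0 = (if k = 0 then 1 else 0)"
  unfolding B_theta_def by (subst powser_zero) auto

lemma summable_B_theta:
  fixes y :: complex
  assumes "norm y < 1 / 64"
  shows "summable (\<lambda>n. (of_nat n ^ k * of_nat (b_coeff n)) * y ^ n)"
  using assms
proof (induction k arbitrary: y)
  case 0
  show ?case
  proof (rule summable_comparison_test'[of "\<lambda>n. (64 * norm y) ^ n" 0])
    show "summable (\<lambda>n. (64 * norm y) ^ n)" using 0 by (intro summable_geometric) simp
    fix n
    have "real (b_coeff n) \<le> 64 ^ n" using b_coeff_le[of n] by (metis of_nat_le_iff of_nat_numeral of_nat_power)
    thus "norm ((of_nat n ^ 0 * of_nat (b_coeff n)) * y ^ n) \<le> (64 * norm y) ^ n"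
      by (simp add: norm_mult norm_power power_mult_distrib mult_right_mono)
  qed
next
  case (Suc k)
  from theta_powser(1)[OF Suc.IH Suc.prems] show ?case by (simp add: mult_ac)
qed

lemma B_theta_deriv:
  assumes "norm y < 1 / 64"
  obtains D where "(B_theta k has_field_derivative D) (at y)" "y * D = B_theta (Suc k) y"
proof
  let ?c = "\<lambda>n. of_nat n ^ k * of_nat (b_coeff n) :: complex"
  show "(B_theta k has_field_derivative (\<Sum>n. diffs ?c n * y ^ n)) (at y)"
    using theta_powser(2)[of "1 / 64" ?c y, OF summable_B_theta assms] unfolding B_theta_def .
  show "y * (\<Sum>n. diffs ?c n * y ^ n) = B_theta (Suc k) y"
    using theta_powser(3)[of "1 / 64" ?c y, OF summable_B_theta assms] unfolding B_theta_def by (simp add: mult_ac)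
qed

text \<open>The recurrence of b read with n as y d/dy. The two polynomials are 2(2n + 1)(10n^2 + 10n
  + 3) and 36(n + 1)(2n + 1)(2n + 3) in expanded form.\<close>

lemma B_theta_ode:
  assumes y: "norm y < 1 / 64"
  shows "B_theta 3 y - y * (40 * B_theta 3 y + 60 * B_theta 2 y + 32 * B_theta 1 y + 6 * B_theta 0 y)
     + y\<^sup>2 * (144 * B_theta 3 y + 432 * B_theta 2 y + 396 * B_theta 1 y + 108 * B_theta 0 y) = 0"
proof -
  define b where "b = (\<lambda>n. of_nat (b_coeff n) :: complex)"
  define p1 :: "nat \<Rightarrow> complex" where "p1 = (\<lambda>n. 40 * of_nat n ^ 3 + 60 * of_nat n ^ 2 + 32 * of_nat n + 6)"
  define p2 :: "nat \<Rightarrow> complex" where "p2 = (\<lambda>n. 144 * of_nat n ^ 3 + 432 * of_nat n ^ 2 + 396 * of_nat n + 108)"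
  have S: "(\<lambda>n. (of_nat n ^ k * b n) * y ^ n) sums B_theta k y" for k
    unfolding b_def B_theta_def by (rule summable_sums[OF summable_B_theta[OF y]])
  have s1: "(\<lambda>n. (p1 n * b n) * y ^ n) sums (40 * B_theta 3 y + 60 * B_theta 2 y + 32 * B_theta 1 y + 6 * B_theta 0 y)"
    using sums_add[OF sums_add[OF sums_add[OF sums_mult[OF S[of 3], of 40] sums_mult[OF S[of 2], of 60]] 
        sums_mult[OF S[of 1], of 32]] sums_mult[OF S[of 0], of 6]]
    by (simp add: p1_def algebra_simps)
  have s2: "(\<lambda>n. (p2 n * b n) * y ^ n) sums (144 * B_theta 3 y + 432 * B_theta 2 y + 396 * B_theta 1 y + 108 * B_theta 0 y)"
    using sums_add[OF sums_add[OF sums_add[OF sums_mult[OF S[of 3], of 144] sums_mult[OF S[of 2], of 432]] 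
        sums_mult[OF S[of 1], of 396]] sums_mult[OF S[of 0], of 108]]
    by (simp add: p2_def algebra_simps)
  have "(\<lambda>n. (p1 (Suc n) * b (Suc n)) * y ^ Suc n) sums 
      (40 * B_theta 3 y + 60 * B_theta 2 y + 32 * B_theta 1 y + 6 * B_theta 0 y - 6)"
    by (subst sums_Suc_iff) (use s1 in \<open>simp add: p1_def b_def\<close>)
  from sums_mult[OF this, of y]
  have t1: "(\<lambda>n. (p1 (Suc n) * b (Suc n)) * y ^ (n + 2)) sums 
      (y * (40 * B_theta 3 y + 60 * B_theta 2 y + 32 * B_theta 1 y + 6 * B_theta 0 y) - 6 * y)"
    by (simp add: algebra_simps)
  from sums_mult[OF s2, of "y\<^sup>2"]
  have t2: "(\<lambda>n. (p2 n * b n) * y ^ (n + 2)) sums 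
      (y\<^sup>2 * (144 * B_theta 3 y + 432 * B_theta 2 y + 396 * B_theta 1 y + 108 * B_theta 0 y))"
    by (simp add: algebra_simps power2_eq_square)
  \<comment> \<open>The recurrence accounts for the powers from y^2 on. The terms in y alone cancel
    because b(1) = 6 equals \<open>p1 0\<close> times b(0).\<close>
  have t3: "(\<lambda>n. (of_nat (n + 2) ^ 3 * b (n + 2)) * y ^ (n + 2)) sums (B_theta 3 y - 6 * y)"
    using S[of 3] sums_iff_shift[of "\<lambda>n. (of_nat n ^ 3 * b n) * y ^ n" 2 "B_theta 3 y - 6 * y"]
    by (simp add: b_def numeral_2_eq_2 b_coeff_1[unfolded One_nat_def])
  have "of_nat (n + 2) ^ 3 * b (n + 2) - p1 (Suc n) * b (Suc n) + p2 n * b n = 0" for n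
  proof -
    have "complex_of_real ((real n + 2) ^ 3 * real (b_coeff (n + 2))) = complex_of_real
     (2 * (2 * real n + 3) * (10 * (real n + 1)\<^sup>2 + 10 * (real n + 1) + 3) * real (b_coeff (n + 1))
     - 36 * (real n + 1) * (2 * real n + 1) * (2 * real n + 3) * real (b_coeff n))"
      by (simp only: b_coeff_rec)
    hence "of_nat (n + 2) ^ 3 * b (n + 2) =
     2 * (2 * of_nat n + 3) * (10 * (of_nat n + 1)\<^sup>2 + 10 * (of_nat n + 1) + 3) * b (Suc n)
     - 36 * (of_nat n + 1) * (2 * of_nat n + 1) * (2 * of_nat n + 3) * b n"
      unfolding b_def of_real_mult of_real_diff of_real_add of_real_power of_real_of_nat_eq of_real_numeral of_real_1
        of_nat_add of_nat_numeral Suc_eq_plus1 .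
    thus ?thesis by (simp add: p1_def p2_def power2_eq_square power3_eq_cube algebra_simps)
  qed
  hence "(\<lambda>n. (of_nat (n + 2) ^ 3 * b (n + 2)) * y ^ (n + 2) - (p1 (Suc n) * b (Suc n)) * y ^ (n + 2)
     + (p2 n * b n) * y ^ (n + 2)) = (\<lambda>n. 0)"
    by (simp add: fun_eq_iff flip: left_diff_distrib distrib_right)
  with sums_add[OF sums_diff[OF t3 t1] t2] have "(\<lambda>n. 0) sums
      (B_theta 3 y - 6 * y - (y * (40 * B_theta 3 y + 60 * B_theta 2 y + 32 * B_theta 1 y + 6 * B_theta 0 y) - 6 * y)
      + y\<^sup>2 * (144 * B_theta 3 y + 432 * B_theta 2 y + 396 * B_theta 1 y + 108 * B_theta 0 y))" by simp
  from sums_unique2[OF this sums_zero] show ?thesis by (simp add: algebra_simps)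
qed

text \<open>Differential relations come here with a factor that vanishes at the origin, so they
  determine the derivative only elsewhere. Continuity of the derivative of a holomorphic function
  covers the origin.\<close>

lemma constant_if_punctured_deriv_zero:
  fixes f :: "complex \<Rightarrow> complex"
  assumes df: "\<And>z. z \<in> ball 0 r \<Longrightarrow> \<exists>D. (f has_field_derivative D) (at z) \<and> (z \<noteq> 0 \<longrightarrow> D = 0)"
    and z: "z \<in> ball 0 r"
  shows "f z = f 0"
proof -
  have r: "r > 0" using z by (auto intro: le_less_trans[OF norm_ge_zero])
  have h: "f holomorphic_on ball 0 r" using df by (meson holomorphic_onI has_field_derivative_at_within field_differentiable_def)
  have d0: "deriv f u = 0" if "u \<in> ball 0 r - {0}" for u
    using df[of u] that DERIV_imp_deriv by blast
  have "continuous_on (ball 0 r) (deriv f)"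
    by (intro holomorphic_on_imp_continuous_on holomorphic_deriv h) auto
  hence "deriv f \<midarrow>0\<rightarrow> deriv f 0" using r continuous_on_eq_continuous_at[OF open_ball] isCont_def by (metis centre_in_ball)
  moreover have "deriv f \<midarrow>0\<rightarrow> 0"
    by (rule tendsto_eventually) (use r d0 in \<open>auto simp: eventually_at intro!: exI[of _ r]\<close>)
  ultimately have "deriv f 0 = 0" using LIM_unique by blast
  hence "(f has_field_derivative 0) (at u within ball 0 r)" if "u \<in> ball 0 r" for u
    using holomorphic_derivI[OF h open_ball that, of "ball 0 r"] d0[of u] that by (cases "u = 0") auto
  thus ?thesis using has_field_derivative_zero_constant[of "ball 0 r" f] z r by (metis convex_ball centre_in_ball)
qed

text \<open>A first integral of the third-order equation: it holds because that equation is the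
  symmetric square of a second-order one.\<close>

lemma B_theta_first_integral:
  assumes y: "norm y < 1 / 64"
  shows "2 * (1 - 40 * y + 144 * y\<^sup>2) * B_theta 0 y * B_theta 2 y + (288 * y\<^sup>2 - 40 * y) * B_theta 0 y * B_theta 1 y
    - (1 - 40 * y + 144 * y\<^sup>2) * (B_theta 1 y)\<^sup>2 - 4 * (3 * y - 27 * y\<^sup>2) * (B_theta 0 y)\<^sup>2 = 0"
proof -
  define b0 b1 b2 b3 where b_defs: "b0 = B_theta 0" "b1 = B_theta 1" "b2 = B_theta 2" "b3 = B_theta 3"
  define J where "J = (\<lambda>y. 2 * (1 - 40 * y + 144 * y\<^sup>2) * b0 y * b2 y + (288 * y\<^sup>2 - 40 * y) * b0 y * b1 y
    - (1 - 40 * y + 144 * y\<^sup>2) * (b1 y)\<^sup>2 - 4 * (3 * y - 27 * y\<^sup>2) * (b0 y)\<^sup>2)"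
  have "J y = J 0"
  proof (rule constant_if_punctured_deriv_zero[of "1 / 64"])
    fix z :: complex assume "z \<in> ball 0 (1 / 64)"
    hence z: "norm z < 1 / 64" by simp
    obtain D0 where D0: "(b0 has_field_derivative D0) (at z)" "z * D0 = b1 z"
      using B_theta_deriv[OF z, of 0] unfolding b_defs by auto
    obtain D1 where D1: "(b1 has_field_derivative D1) (at z)" "z * D1 = b2 z"
      using B_theta_deriv[OF z, of 1] unfolding b_defs by (auto simp: numeral_2_eq_2)
    obtain D2 where D2: "(b2 has_field_derivative D2) (at z)" "z * D2 = b3 z"
      using B_theta_deriv[OF z, of 2] unfolding b_defs by (auto simp: numeral_2_eq_2 numeral_3_eq_3)
    note ode = B_theta_ode[OF z, folded b_defs]
    note D0(1)[derivative_intros] D1(1)[derivative_intros] D2(1)[derivative_intros]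
    define J' where "J' = 2 * (288 * z - 40) * b0 z * b2 z + 2 * (1 - 40 * z + 144 * z\<^sup>2) * D0 * b2 z
      + 2 * (1 - 40 * z + 144 * z\<^sup>2) * b0 z * D2 + (576 * z - 40) * b0 z * b1 z
      + (288 * z\<^sup>2 - 40 * z) * D0 * b1 z + (288 * z\<^sup>2 - 40 * z) * b0 z * D1
      - (288 * z - 40) * (b1 z)\<^sup>2 - (1 - 40 * z + 144 * z\<^sup>2) * 2 * b1 z * D1
      - 4 * (3 - 54 * z) * (b0 z)\<^sup>2 - 4 * (3 * z - 27 * z\<^sup>2) * 2 * b0 z * D0"
    have "(J has_field_derivative J') (at z)"
      unfolding J_def J'_def by (auto intro!: derivative_eq_intros simp: algebra_simps power2_eq_square)
    \<comment> \<open>With s = 1 - 40y + 144y^2, the coefficient 288y^2 - 40y is y ds/dy. This makes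
      the derivative of \<open>J\<close> equal to 2B times the left side of the third-order
      equation.\<close>
    moreover have "z * J' = 2 * b0 z * (b3 z - z * (40 * b3 z + 60 * b2 z + 32 * b1 z + 6 * b0 z)
        + z\<^sup>2 * (144 * b3 z + 432 * b2 z + 396 * b1 z + 108 * b0 z))"
      unfolding J'_def D0(2)[symmetric] D1(2)[symmetric] D2(2)[symmetric] by algebra
    ultimately show "\<exists>D. (J has_field_derivative D) (at z) \<and> (z \<noteq> 0 \<longrightarrow> D = 0)" unfolding ode by auto
  qed (use y in simp)
  also have "J 0 = 0" by (simp add: J_def b_defs)
  finally show ?thesis unfolding J_def b_defs .
qed

section \<open>A symmetric square and its quadratic transformation\<close>

definition p_cubic :: "complex \<Rightarrow> complex" where "p_cubic w = w * (1 - w) * (1 - 9 * w)"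

text \<open>With d = 1 - 9w^2 and p the cubic, d^2 - 4p = (1 - 2w + 9w^2)^2 and d^2 - 36p = (1 - 18w
  + 9w^2)^2.\<close>

definition y_of :: "complex \<Rightarrow> complex" where "y_of w = p_cubic w / (1 - 9 * w\<^sup>2)\<^sup>2"

text \<open>In the new variable w the equation for the square root of B acquires a first-order term;
  division of B by 1 - 9w^2 removes it.\<close>

definition T_fun :: "complex \<Rightarrow> complex" where "T_fun w = B_theta 0 (y_of w) / (1 - 9 * w\<^sup>2)"

text \<open>\<open>sym_square P \<rho> r T\<close> says that \<open>T\<close> is the square of a solution \<open>g\<close> of
  \<open>(P d/dz)\<^sup>2 g = \<rho> g\<close>, without choosing a branch of \<open>g\<close>.\<close>

definition sym_square :: "(complex \<Rightarrow> complex) \<Rightarrow> (complex \<Rightarrow> complex) \<Rightarrow> real \<Rightarrow> (complex \<Rightarrow> complex) \<Rightarrow> bool" where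
  "sym_square P \<rho> r T \<longleftrightarrow> (\<exists>T' T1 T1' T2. \<forall>z. norm z < r \<longrightarrow>
     (T has_field_derivative T' z) (at z) \<and> P z * T' z = T1 z \<and>
     (T1 has_field_derivative T1' z) (at z) \<and> P z * T1' z = T2 z \<and>
     2 * T z * T2 z - (T1 z)\<^sup>2 - 4 * \<rho> z * (T z)\<^sup>2 = 0)"

text \<open>If T = g^2 and U = h^2, then \<open>W\<close> is 2gh times the Wronskian of g and h, and
  \<open>V\<close> is four times its square, hence constant. Both T and U are regular at the
  singular point P(0) = 0, which forces \<open>T1\<close> and \<open>U1\<close> to vanish there. So
  the Wronskian is 0, and a single initial value determines the solution.\<close>

lemma sym_square_unique:
  assumes T: "sym_square P \<rho> r T" and U: "sym_square P \<rho> r U"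
    and P0: "P 0 = 0" and P: "\<And>z. norm z < r \<Longrightarrow> z \<noteq> 0 \<Longrightarrow> P z \<noteq> 0"
    and nz: "\<And>z. norm z < r \<Longrightarrow> T z \<noteq> 0" "\<And>z. norm z < r \<Longrightarrow> U z \<noteq> 0"
    and eq: "T 0 = U 0" and z: "norm z < r"
  shows "T z = U z"
proof -
  obtain T' T1 T1' T2 where T: "\<And>z. norm z < r \<Longrightarrow> (T has_field_derivative T' z) (at z)"
     "\<And>z. norm z < r \<Longrightarrow> P z * T' z = T1 z" "\<And>z. norm z < r \<Longrightarrow> (T1 has_field_derivative T1' z) (at z)"
     "\<And>z. norm z < r \<Longrightarrow> P z * T1' z = T2 z"
     "\<And>z. norm z < r \<Longrightarrow> 2 * T z * T2 z - (T1 z)\<^sup>2 - 4 * \<rho> z * (T z)\<^sup>2 = 0"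
    using T unfolding sym_square_def by blast
  obtain U' U1 U1' U2 where U: "\<And>z. norm z < r \<Longrightarrow> (U has_field_derivative U' z) (at z)"
     "\<And>z. norm z < r \<Longrightarrow> P z * U' z = U1 z" "\<And>z. norm z < r \<Longrightarrow> (U1 has_field_derivative U1' z) (at z)"
     "\<And>z. norm z < r \<Longrightarrow> P z * U1' z = U2 z"
     "\<And>z. norm z < r \<Longrightarrow> 2 * U z * U2 z - (U1 z)\<^sup>2 - 4 * \<rho> z * (U z)\<^sup>2 = 0"
    using U unfolding sym_square_def by blast
  have r: "r > 0" using z by (auto intro: le_less_trans[OF norm_ge_zero])
  define W where "W = (\<lambda>z. T z * U1 z - U z * T1 z)"
  define V where "V = (\<lambda>z. (W z)\<^sup>2 / (T z * U z))"
  have V0: "V z = V 0" if z: "norm z < r" for z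
  proof (rule constant_if_punctured_deriv_zero[of r])
    fix z :: complex assume "z \<in> ball 0 r"
    hence z: "norm z < r" by simp
    note T(1)[OF z, derivative_intros] T(3)[OF z, derivative_intros] U(1)[OF z, derivative_intros] U(3)[OF z, derivative_intros]
    define W' where "W' = T' z * U1 z + T z * U1' z - U' z * T1 z - U z * T1' z"
    define V' where "V' = (2 * W z * W' * (T z * U z) - (W z)\<^sup>2 * (T' z * U z + T z * U' z)) / (T z * U z)\<^sup>2"
    have dW [derivative_intros]: "(W has_field_derivative W') (at z)"
      unfolding W_def W'_def by (auto intro!: derivative_eq_intros)
    have "(V has_field_derivative V') (at z)"
      unfolding V_def V'_def using nz[OF z]
      by (auto intro!: derivative_eq_intros simp: power2_eq_square algebra_simps)
    moreover have "P z * V' = 0"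
    proof -
      have PW: "P z * W' = T z * U2 z - U z * T2 z"
        unfolding W'_def T(2)[OF z, symmetric] U(2)[OF z, symmetric] T(4)[OF z, symmetric] U(4)[OF z, symmetric] by algebra
      have "2 * T z * U z * (T z * U2 z - U z * T2 z) = W z * (T z * U1 z + U z * T1 z)"
        using T(5)[OF z] U(5)[OF z] unfolding W_def by algebra
      hence "P z * (2 * W z * W' * (T z * U z) - (W z)\<^sup>2 * (T' z * U z + T z * U' z)) = 0"
        using PW T(2)[OF z] U(2)[OF z] by algebra
      thus ?thesis unfolding V'_def by simp
    qed
    ultimately show "\<exists>D. (V has_field_derivative D) (at z) \<and> (z \<noteq> 0 \<longrightarrow> D = 0)"
      using P[OF z] by auto
  qed (use z in simp)
  have "T1 0 = 0" "U1 0 = 0" using T(2)[of 0] U(2)[of 0] r P0 by auto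
  hence W0: "W z = 0" if "norm z < r" for z
    using V0[OF that] nz[OF that] unfolding V_def W_def by simp
  have "T z / U z = T 0 / U 0"
  proof (rule constant_if_punctured_deriv_zero[of r])
    fix z :: complex assume "z \<in> ball 0 r"
    hence z: "norm z < r" by simp
    note T(1)[OF z, derivative_intros] U(1)[OF z, derivative_intros]
    have "((\<lambda>z. T z / U z) has_field_derivative (T' z * U z - T z * U' z) / (U z * U z)) (at z)"
      using nz[OF z] by (auto intro!: derivative_eq_intros)
    moreover have "P z * (T' z * U z - T z * U' z) = - W z"
      unfolding W_def T(2)[OF z, symmetric] U(2)[OF z, symmetric] by algebra
    ultimately show "\<exists>D. ((\<lambda>z. T z / U z) has_field_derivative D) (at z) \<and> (z \<noteq> 0 \<longrightarrow> D = 0)"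
      using P[OF z] W0[OF z] by auto
  qed (use z in simp)
  thus ?thesis using nz[OF z] nz[of 0] r eq by auto
qed

section \<open>Estimates near w = 0 and the change of variable from y to w\<close>

lemma one_minus_9_sq_nonzero:
  fixes w :: complex
  assumes "norm w < 1 / 100" shows "1 - 9 * w\<^sup>2 \<noteq> 0"
proof
  assume "1 - 9 * w\<^sup>2 = 0"
  hence "(3 * w)\<^sup>2 = 1" by (simp add: power_mult_distrib)
  hence "norm (3 * w) ^ 2 = 1" by (metis norm_one norm_power)
  moreover have "norm (3 * w) ^ 2 < 1 ^ 2" using assms by (intro power_strict_mono) (auto simp: norm_mult)
  ultimately show False by simp
qed

lemma norm_y_of:
  assumes w: "norm w < 1 / 100" shows "norm (y_of w) < 1 / 64"
proof -
  have a: "norm (1 - w) \<le> 101 / 100" using norm_triangle_ineq4[of 1 w] w by simp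
  have b: "norm (1 - 9 * w) \<le> 109 / 100" using norm_triangle_ineq4[of 1 "9 * w"] w by (simp add: norm_mult)
  have "norm (9 * w\<^sup>2) \<le> 9 * (1 / 100)\<^sup>2"
    using w power_mono[of "norm w" "1 / 100" 2] by (simp add: norm_mult norm_power)
  hence c: "norm (1 - 9 * w\<^sup>2) \<ge> 99 / 100" using norm_triangle_ineq2[of 1 "9 * w\<^sup>2"] by (simp add: power2_eq_square)
  have "norm (p_cubic w) \<le> (1 / 100) * (101 / 100) * (109 / 100)"
    unfolding p_cubic_def norm_mult using w a b by (intro mult_mono) auto
  hence "norm (y_of w) \<le> ((1 / 100) * (101 / 100) * (109 / 100)) / (99 / 100)\<^sup>2"
    unfolding y_of_def norm_divide norm_power using c by (intro frac_le power_mono) auto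
  also have "\<dots> < 1 / 64" by (simp add: power2_eq_square)
  finally show ?thesis .
qed

lemma sym_square_T_fun: "sym_square p_cubic (\<lambda>w. p_cubic w * (3 - 9 * w)) (1 / 100) T_fun"
proof -
  define d where "d = (\<lambda>w::complex. 1 - 9 * w\<^sup>2)"
  \<comment> \<open>\<open>l\<close> is the factor in p dy/dw = y l, so p d/dw acts on functions of
    y as l times y d/dy. \<open>T1\<close> below is p dT/dw computed by this rule.\<close>
  define l where "l = (\<lambda>w. (1 - 2 * w + 9 * w\<^sup>2) * (1 - 18 * w + 9 * w\<^sup>2) / d w)"
  define b0 b1 b2 where b_defs: "b0 = B_theta 0" "b1 = B_theta 1" "b2 = B_theta 2"
  define T1 where "T1 = (\<lambda>w. l w * b1 (y_of w) / d w + 18 * w * p_cubic w * b0 (y_of w) / (d w)\<^sup>2)"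
  have "\<exists>D D'. (T_fun has_field_derivative D) (at w) \<and> p_cubic w * D = T1 w \<and>
     (T1 has_field_derivative D') (at w) \<and>
     2 * T_fun w * (p_cubic w * D') - (T1 w)\<^sup>2 - 4 * (p_cubic w * (3 - 9 * w)) * (T_fun w)\<^sup>2 = 0"
    if w: "norm w < 1 / 100" for w
  proof -
    note y = norm_y_of[OF w]
    have d0: "d w \<noteq> 0" using one_minus_9_sq_nonzero[OF w] by (simp add: d_def)
    obtain D0 where D0: "(b0 has_field_derivative D0) (at (y_of w))" "y_of w * D0 = b1 (y_of w)"
      using B_theta_deriv[OF y, of 0] unfolding b_defs by auto
    obtain D1 where D1: "(b1 has_field_derivative D1) (at (y_of w))" "y_of w * D1 = b2 (y_of w)"
      using B_theta_deriv[OF y, of 1] unfolding b_defs by (auto simp: numeral_2_eq_2)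
    define p' where "p' = 1 - 20 * w + 27 * w\<^sup>2"
    define y' where "y' = (p' * d w + 36 * w * p_cubic w) / (d w) ^ 3"
    define l' where "l' = ((-20 + 108 * w - 540 * w\<^sup>2 + 324 * w ^ 3) * d w + 18 * w * ((1 - 2 * w + 9 * w\<^sup>2) * (1 - 18 * w + 9 * w\<^sup>2))) / (d w)\<^sup>2"
    have dp: "(p_cubic has_field_derivative p') (at w)"
      unfolding p_cubic_def p'_def by (auto intro!: derivative_eq_intros simp: algebra_simps power2_eq_square)
    have dd: "(d has_field_derivative - 18 * w) (at w)"
      unfolding d_def by (auto intro!: derivative_eq_intros)
    have y_alt: "y_of = (\<lambda>w. p_cubic w / (d w)\<^sup>2)" by (simp add: fun_eq_iff y_of_def d_def)
    have dy: "(y_of has_field_derivative y') (at w)"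
    proof -
      show ?thesis unfolding y'_def y_alt using d0
        by (auto intro!: derivative_eq_intros dp dd simp: field_simps power2_eq_square power3_eq_cube)
    qed
    have dl: "(l has_field_derivative l') (at w)"
      unfolding l_def l'_def using d0
      by (auto intro!: derivative_eq_intros dd simp: field_simps power2_eq_square power3_eq_cube)
    have db0: "((\<lambda>w. b0 (y_of w)) has_field_derivative (D0 * y')) (at w)"
      by (rule DERIV_chain2[OF D0(1) dy])
    have db1: "((\<lambda>w. b1 (y_of w)) has_field_derivative (D1 * y')) (at w)"
      by (rule DERIV_chain2[OF D1(1) dy])
    have py: "p_cubic w * y' = y_of w * l w"
    proof -
      have "p' * d w + 36 * w * p_cubic w = (1 - 2 * w + 9 * w\<^sup>2) * (1 - 18 * w + 9 * w\<^sup>2)"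
        unfolding p'_def d_def p_cubic_def by algebra
      thus ?thesis unfolding y'_def y_alt l_def using d0
        by (simp add: power2_eq_square power3_eq_cube)
    qed
    have pb0: "p_cubic w * (D0 * y') = l w * b1 (y_of w)" using py D0(2) by algebra
    have pb1: "p_cubic w * (D1 * y') = l w * b2 (y_of w)" using py D1(2) by algebra
    have T_alt: "T_fun = (\<lambda>w. b0 (y_of w) / d w)" by (simp add: fun_eq_iff T_fun_def d_def b_defs)
    define D where "D = (D0 * y') / d w + 18 * w * b0 (y_of w) / (d w)\<^sup>2"
    have dT: "(T_fun has_field_derivative D) (at w)"
      unfolding T_alt D_def using d0 
      by (auto intro!: derivative_eq_intros db0 dd simp: field_simps power2_eq_square)
    have pD: "p_cubic w * D = T1 w"
    proof -
      have "p_cubic w * D = (p_cubic w * (D0 * y')) / d w + 18 * w * p_cubic w * b0 (y_of w) / (d w)\<^sup>2"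
        unfolding D_def by (simp add: algebra_simps)
      thus ?thesis unfolding pb0 T1_def .
    qed
    define D' where "D' = l' * b1 (y_of w) / d w + l w * (D1 * y') / d w + 18 * w * l w * b1 (y_of w) / (d w)\<^sup>2
       + 18 * (p_cubic w + w * p') * b0 (y_of w) / (d w)\<^sup>2 + 18 * w * p_cubic w * (D0 * y') / (d w)\<^sup>2
       + 648 * w\<^sup>2 * p_cubic w * b0 (y_of w) / (d w) ^ 3"
    have dT1: "(T1 has_field_derivative D') (at w)"
      unfolding T1_def D'_def using d0
      by (auto intro!: derivative_eq_intros db0 db1 dd dl dp simp: field_simps power2_eq_square power3_eq_cube)
    show ?thesis
    proof (intro exI conjI)
      show "(T_fun has_field_derivative D) (at w)" "p_cubic w * D = T1 w" "(T1 has_field_derivative D') (at w)" by fact+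
      define e0 e1 e2 where e: "e0 = b0 (y_of w)" "e1 = b1 (y_of w)" "e2 = b2 (y_of w)"
      define y where "y = y_of w"
      define s where "s = 1 - 40 * y + 144 * y\<^sup>2"
      have J: "2 * s * e0 * e2 + (288 * y\<^sup>2 - 40 * y) * e0 * e1 - s * e1\<^sup>2 - 4 * (3 * y - 27 * y\<^sup>2) * e0\<^sup>2 = 0"
        using B_theta_first_integral[OF norm_y_of[OF w]] unfolding s_def e b_defs y_def .
      have pD': "p_cubic w * D' = p_cubic w * l' * e1 / d w + (l w)\<^sup>2 * e2 / d w + 36 * w * p_cubic w * l w * e1 / (d w)\<^sup>2
         + 18 * p_cubic w * (p_cubic w + w * p') * e0 / (d w)\<^sup>2 + 648 * w\<^sup>2 * (p_cubic w)\<^sup>2 * e0 / (d w) ^ 3"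
      proof -
        have "p_cubic w * D' = p_cubic w * l' * e1 / d w + l w * (p_cubic w * (D1 * y')) / d w + 18 * w * p_cubic w * l w * e1 / (d w)\<^sup>2
         + 18 * p_cubic w * (p_cubic w + w * p') * e0 / (d w)\<^sup>2 + 18 * w * p_cubic w * (p_cubic w * (D0 * y')) / (d w)\<^sup>2
         + 648 * w\<^sup>2 * (p_cubic w)\<^sup>2 * e0 / (d w) ^ 3"
          unfolding D'_def e by (simp add: algebra_simps power2_eq_square)
        thus ?thesis unfolding pb0 pb1 e[symmetric] by (simp add: algebra_simps power2_eq_square)
      qed
      have yd: "y * (d w)\<^sup>2 = p_cubic w" unfolding y_def y_alt using d0 by simp
      have ld: "l w * d w = (1 - 2 * w + 9 * w\<^sup>2) * (1 - 18 * w + 9 * w\<^sup>2)" unfolding l_def using d0 by simp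
      \<comment> \<open>\<open>i1\<close>, \<open>i2\<close> and \<open>i3\<close> compare the
        coefficients of 2 e0 e2 - e1^2, of e0 e1 and of e0^2 with those of the first integral
        \<open>J\<close>, up to the common factor d^2.\<close>
      have i1: "(l w)\<^sup>2 = s * (d w)\<^sup>2"
      proof -
        have "((1 - 2 * w + 9 * w\<^sup>2) * (1 - 18 * w + 9 * w\<^sup>2))\<^sup>2 = (d w)^4 - 40 * p_cubic w * (d w)\<^sup>2 + 144 * (p_cubic w)\<^sup>2"
          unfolding d_def p_cubic_def by algebra
        hence "(l w * d w)\<^sup>2 = s * (d w)\<^sup>2 * (d w)\<^sup>2" unfolding ld yd[symmetric] s_def by algebra
        thus ?thesis using d0 by (simp add: power_mult_distrib)
      qed
      have i2: "2 * p_cubic w * l' + 36 * w * p_cubic w * l w / d w = (d w)\<^sup>2 * (288 * y\<^sup>2 - 40 * y)"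
      proof -
        have "p_cubic w * (2 * ((-20 + 108 * w - 540 * w\<^sup>2 + 324 * w ^ 3) * d w + 18 * w * ((1 - 2 * w + 9 * w\<^sup>2) * (1 - 18 * w + 9 * w\<^sup>2)))
           + 36 * w * ((1 - 2 * w + 9 * w\<^sup>2) * (1 - 18 * w + 9 * w\<^sup>2))) = 288 * (p_cubic w)\<^sup>2 - 40 * p_cubic w * (d w)\<^sup>2"
          unfolding d_def p_cubic_def by algebra
        moreover have "(2 * p_cubic w * l' + 36 * w * p_cubic w * l w / d w) * (d w)\<^sup>2
            = p_cubic w * (2 * (l' * (d w)\<^sup>2) + 36 * w * (l w * d w))"
          using d0 by (simp add: field_simps power2_eq_square)
        moreover have "l' * (d w)\<^sup>2 = (-20 + 108 * w - 540 * w\<^sup>2 + 324 * w ^ 3) * d w + 18 * w * ((1 - 2 * w + 9 * w\<^sup>2) * (1 - 18 * w + 9 * w\<^sup>2))"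
          unfolding l'_def using d0 by simp
        ultimately have "(2 * p_cubic w * l' + 36 * w * p_cubic w * l w / d w) * (d w)\<^sup>2 = 288 * (p_cubic w)\<^sup>2 - 40 * p_cubic w * (d w)\<^sup>2"
          using ld by simp
        also have "\<dots> = (d w)\<^sup>2 * (288 * y\<^sup>2 - 40 * y) * (d w)\<^sup>2" unfolding yd[symmetric] by algebra
        finally show ?thesis using d0 by simp
      qed
      have i3: "36 * p_cubic w * (p_cubic w + w * p') / d w + 972 * w\<^sup>2 * (p_cubic w)\<^sup>2 / (d w)\<^sup>2 - 4 * (p_cubic w * (3 - 9 * w))
         = - 4 * (3 * y - 27 * y\<^sup>2) * (d w)\<^sup>2"
      proof -
        have "36 * p_cubic w * (p_cubic w + w * p') * d w + 972 * w\<^sup>2 * (p_cubic w)\<^sup>2 - 4 * (p_cubic w * (3 - 9 * w)) * (d w)\<^sup>2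
          = - 12 * p_cubic w * (d w)\<^sup>2 + 108 * (p_cubic w)\<^sup>2"
          unfolding d_def p_cubic_def p'_def by algebra
        hence "(36 * p_cubic w * (p_cubic w + w * p') / d w + 972 * w\<^sup>2 * (p_cubic w)\<^sup>2 / (d w)\<^sup>2 - 4 * (p_cubic w * (3 - 9 * w))) * (d w)\<^sup>2
          = - 4 * (3 * y - 27 * y\<^sup>2) * (d w)\<^sup>2 * (d w)\<^sup>2"
          unfolding yd[symmetric] using d0 by (simp add: field_simps power2_eq_square)
        thus ?thesis using d0 by simp
      qed
      have "(2 * T_fun w * (p_cubic w * D') - (T1 w)\<^sup>2 - 4 * (p_cubic w * (3 - 9 * w)) * (T_fun w)\<^sup>2) * (d w)\<^sup>2
        = (l w)\<^sup>2 * (2 * e0 * e2 - e1\<^sup>2) + e0 * e1 * (2 * p_cubic w * l' + 36 * w * p_cubic w * l w / d w)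
        + e0\<^sup>2 * (36 * p_cubic w * (p_cubic w + w * p') / d w + 972 * w\<^sup>2 * (p_cubic w)\<^sup>2 / (d w)\<^sup>2 - 4 * (p_cubic w * (3 - 9 * w)))"
        unfolding pD' T_alt T1_def e[symmetric] using d0
        by (simp add: field_simps power2_eq_square power3_eq_cube)
      also have "\<dots> = (d w)\<^sup>2 * (2 * s * e0 * e2 + (288 * y\<^sup>2 - 40 * y) * e0 * e1 - s * e1\<^sup>2 - 4 * (3 * y - 27 * y\<^sup>2) * e0\<^sup>2)"
        unfolding i1 i2 i3 by (simp add: algebra_simps)
      also have "\<dots> = 0" unfolding J by simp
      finally show "2 * T_fun w * (p_cubic w * D') - (T1 w)\<^sup>2 - 4 * (p_cubic w * (3 - 9 * w)) * (T_fun w)\<^sup>2 = 0"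
        using d0 by simp
    qed
  qed
  then obtain D D' where "\<forall>w. norm w < 1 / 100 \<longrightarrow> (T_fun has_field_derivative D w) (at w) \<and> p_cubic w * D w = T1 w \<and>
     (T1 has_field_derivative D' w) (at w) \<and>
     2 * T_fun w * (p_cubic w * D' w) - (T1 w)\<^sup>2 - 4 * (p_cubic w * (3 - 9 * w)) * (T_fun w)\<^sup>2 = 0"
    by metis
  thus ?thesis unfolding sym_square_def
    by (intro exI[of _ D] exI[of _ T1] exI[of _ D'] exI[of _ "\<lambda>w. p_cubic w * D' w"]) simp
qed

section \<open>The quadratic transformation\<close>

definition R_map :: "complex \<Rightarrow> complex" where "R_map v = v * (1 - v) / (1 + 3 * v)"

lemma T_fun_0 [simp]: "T_fun 0 = 1"
  by (simp add: T_fun_def y_of_def p_cubic_def)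

lemma sym_square_imp_tendsto:
  assumes "sym_square P \<rho> r T" "r > 0" shows "(T \<longlongrightarrow> T 0) (nhds 0)"
proof -
  obtain D where "(T has_field_derivative D) (at 0)"
    using assms unfolding sym_square_def by (metis norm_zero)
  thus ?thesis using DERIV_isCont[of T] by (simp only: isCont_def tendsto_at_iff_tendsto_nhds)
qed

text \<open>Both are pullbacks of the equation of T, one along R and one along v \<mapsto> v^2,
  brought to the same P. The first uses P R' = p(R). For the second, p(v^2)/(2v) = (1 + 3v)^2
  P(v)/2; multiplying T(v^2) by (1 + 3v)^2 compensates for this rescaling of the derivation, as
  division by 1 - 9w^2 did before.\<close>

lemma sym_square_T_fun_R_map:
  "sym_square (\<lambda>v. v * (1 - v\<^sup>2) * (1 - 3 * v) / (1 + 3 * v)) (\<lambda>v. p_cubic (R_map v) * (3 - 9 * R_map v)) (1 / 1000) (\<lambda>v. T_fun (R_map v))"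
  and sym_square_T_fun_square:
  "sym_square (\<lambda>v. v * (1 - v\<^sup>2) * (1 - 3 * v) / (1 + 3 * v)) (\<lambda>v. p_cubic (R_map v) * (3 - 9 * R_map v)) (1 / 1000) (\<lambda>v. (1 + 3 * v)\<^sup>2 * T_fun (v\<^sup>2))"
proof -
  obtain T' T1 T1' T2 where T: "\<And>z. norm z < 1 / 100 \<Longrightarrow> (T_fun has_field_derivative T' z) (at z)"
     "\<And>z. norm z < 1 / 100 \<Longrightarrow> p_cubic z * T' z = T1 z" "\<And>z. norm z < 1 / 100 \<Longrightarrow> (T1 has_field_derivative T1' z) (at z)"
     "\<And>z. norm z < 1 / 100 \<Longrightarrow> p_cubic z * T1' z = T2 z"
     "\<And>z. norm z < 1 / 100 \<Longrightarrow> 2 * T_fun z * T2 z - (T1 z)\<^sup>2 - 4 * (p_cubic z * (3 - 9 * z)) * (T_fun z)\<^sup>2 = 0"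
    using sym_square_T_fun unfolding sym_square_def by blast
  define P where "P = (\<lambda>v::complex. v * (1 - v\<^sup>2) * (1 - 3 * v) / (1 + 3 * v))"
  define R' where "R' = (\<lambda>v::complex. (1 - 3 * v) * (1 + v) / (1 + 3 * v)\<^sup>2)"
  have c0: "1 + 3 * v \<noteq> 0" if "norm v < 1 / 1000" for v :: complex
  proof
    assume "1 + 3 * v = 0"
    hence "3 * v = - 1" by (simp add: add_eq_0_iff)
    hence "norm (3 * v) = 1" by simp
    thus False using that by (simp add: norm_mult)
  qed
  have nR: "norm (R_map v) < 1 / 100" if v: "norm v < 1 / 1000" for v
  proof -
    have "norm (1 - v) \<le> 2" using norm_triangle_ineq4[of 1 v] v by simp
    moreover have "norm (1 + 3 * v) \<ge> 1 / 2" using norm_triangle_ineq2[of 1 "- 3 * v"] v by (simp add: norm_mult)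
    ultimately have "norm (R_map v) \<le> ((1 / 1000) * 2) / (1 / 2)"
      unfolding R_map_def norm_divide norm_mult using v by (intro frac_le mult_mono) auto
    thus ?thesis by simp
  qed
  have n2: "norm (v\<^sup>2) < 1 / 100" if v: "norm v < 1 / 1000" for v :: complex
    using power_strict_mono[of "norm v" "1 / 10" 2] v by (simp add: norm_power norm_mult power2_eq_square)
  have dR: "(R_map has_field_derivative R' v) (at v)" if "norm v < 1 / 1000" for v
    unfolding R_map_def R'_def using c0[OF that]
    by (auto intro!: derivative_eq_intros simp: field_simps power2_eq_square)
  have PR: "P v * R' v = p_cubic (R_map v)" if "norm v < 1 / 1000" for v
  proof -
    have c: "1 + 3 * v \<noteq> 0" by (rule c0[OF that])
    have "1 - R_map v = (1 + v)\<^sup>2 / (1 + 3 * v)" "1 - 9 * R_map v = (1 - 3 * v)\<^sup>2 / (1 + 3 * v)"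
      unfolding R_map_def using c by (simp_all add: field_simps power2_eq_square)
    thus ?thesis unfolding P_def R'_def p_cubic_def R_map_def[of v] using c
      by (simp add: field_simps power2_eq_square)
  qed
  have "sym_square P (\<lambda>v. p_cubic (R_map v) * (3 - 9 * R_map v)) (1 / 1000) (\<lambda>v. T_fun (R_map v))"
    unfolding sym_square_def
  proof (rule exI[of _ "\<lambda>v. T' (R_map v) * R' v"], rule exI[of _ "\<lambda>v. T1 (R_map v)"],
         rule exI[of _ "\<lambda>v. T1' (R_map v) * R' v"], rule exI[of _ "\<lambda>v. T2 (R_map v)"], intro allI impI conjI)
    fix v :: complex assume v: "norm v < 1 / 1000"
    note n = nR[OF v]
    show "((\<lambda>v. T_fun (R_map v)) has_field_derivative T' (R_map v) * R' v) (at v)"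
      by (rule DERIV_chain2[OF T(1)[OF n] dR[OF v]])
    show "((\<lambda>v. T1 (R_map v)) has_field_derivative T1' (R_map v) * R' v) (at v)"
      by (rule DERIV_chain2[OF T(3)[OF n] dR[OF v]])
    show "P v * (T' (R_map v) * R' v) = T1 (R_map v)" unfolding T(2)[OF n, symmetric] PR[OF v, symmetric] by (simp add: mult_ac)
    show "P v * (T1' (R_map v) * R' v) = T2 (R_map v)" unfolding T(4)[OF n, symmetric] PR[OF v, symmetric] by (simp add: mult_ac)
    show "2 * T_fun (R_map v) * T2 (R_map v) - (T1 (R_map v))\<^sup>2 - 4 * (p_cubic (R_map v) * (3 - 9 * R_map v)) * (T_fun (R_map v))\<^sup>2 = 0"
      by (rule T(5)[OF n])
  qed
  thus "sym_square (\<lambda>v. v * (1 - v\<^sup>2) * (1 - 3 * v) / (1 + 3 * v)) (\<lambda>v. p_cubic (R_map v) * (3 - 9 * R_map v)) (1 / 1000) (\<lambda>v. T_fun (R_map v))"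
    unfolding P_def .

  define K where "K = (\<lambda>v::complex. v * (1 - v\<^sup>2) * (1 - 3 * v))"
  define K' where "K' = (\<lambda>v::complex. 1 - 6 * v - 3 * v\<^sup>2 + 12 * v ^ 3)"
  have dK: "(K has_field_derivative K' v) (at v)" for v
    unfolding K_def K'_def by (auto intro!: derivative_eq_intros simp: algebra_simps power2_eq_square power3_eq_cube)
  have dsq: "((\<lambda>v::complex. v\<^sup>2) has_field_derivative 2 * v) (at v)" for v
    by (auto intro!: derivative_eq_intros)
  have "sym_square P (\<lambda>v. p_cubic (R_map v) * (3 - 9 * R_map v)) (1 / 1000) (\<lambda>v. (1 + 3 * v)\<^sup>2 * T_fun (v\<^sup>2))"
    unfolding sym_square_def
  proof (rule exI[of _ "\<lambda>v. 6 * (1 + 3 * v) * T_fun (v\<^sup>2) + (1 + 3 * v)\<^sup>2 * (T' (v\<^sup>2) * (2 * v))"], 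
         rule exI[of _ "\<lambda>v. 6 * K v * T_fun (v\<^sup>2) + 2 * T1 (v\<^sup>2)"],
         rule exI[of _ "\<lambda>v. 6 * K' v * T_fun (v\<^sup>2) + 6 * K v * (T' (v\<^sup>2) * (2 * v)) + 2 * (T1' (v\<^sup>2) * (2 * v))"], 
         rule exI[of _ "\<lambda>v. 6 * P v * K' v * T_fun (v\<^sup>2) + 12 * P v / (1 + 3 * v) * T1 (v\<^sup>2) + 4 / (1 + 3 * v)\<^sup>2 * T2 (v\<^sup>2)"], 
         intro allI impI conjI)
    fix v :: complex assume v: "norm v < 1 / 1000"
    note n = n2[OF v]
    have c: "1 + 3 * v \<noteq> 0" by (rule c0[OF v])
    have PK: "(1 + 3 * v) * P v = K v" unfolding P_def K_def using c by simp
    have pK: "p_cubic (v\<^sup>2) = v * (1 + 3 * v) * K v" unfolding p_cubic_def K_def by algebra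
    have e0: "(1 + 3 * v)\<^sup>2 * (P v * (T' (v\<^sup>2) * (2 * v))) = 2 * T1 (v\<^sup>2)"
      unfolding T(2)[OF n, symmetric] pK PK[symmetric] by (simp add: power2_eq_square algebra_simps)
    have e1: "(1 + 3 * v)\<^sup>2 * (P v * (T1' (v\<^sup>2) * (2 * v))) = 2 * T2 (v\<^sup>2)"
      unfolding T(4)[OF n, symmetric] pK PK[symmetric] by (simp add: power2_eq_square algebra_simps)
    have dT: "((\<lambda>v. T_fun (v\<^sup>2)) has_field_derivative T' (v\<^sup>2) * (2 * v)) (at v)"
      by (rule DERIV_chain2[OF T(1)[OF n] dsq])
    have dT1: "((\<lambda>v. T1 (v\<^sup>2)) has_field_derivative T1' (v\<^sup>2) * (2 * v)) (at v)"
      by (rule DERIV_chain2[OF T(3)[OF n] dsq])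
    show "((\<lambda>v. (1 + 3 * v)\<^sup>2 * T_fun (v\<^sup>2)) has_field_derivative 
        6 * (1 + 3 * v) * T_fun (v\<^sup>2) + (1 + 3 * v)\<^sup>2 * (T' (v\<^sup>2) * (2 * v))) (at v)"
      by (auto intro!: derivative_eq_intros dT simp: algebra_simps)
    show "P v * (6 * (1 + 3 * v) * T_fun (v\<^sup>2) + (1 + 3 * v)\<^sup>2 * (T' (v\<^sup>2) * (2 * v))) = 6 * K v * T_fun (v\<^sup>2) + 2 * T1 (v\<^sup>2)"
      using e0 PK by algebra
    show "((\<lambda>v. 6 * K v * T_fun (v\<^sup>2) + 2 * T1 (v\<^sup>2)) has_field_derivative 
        6 * K' v * T_fun (v\<^sup>2) + 6 * K v * (T' (v\<^sup>2) * (2 * v)) + 2 * (T1' (v\<^sup>2) * (2 * v))) (at v)"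
      by (auto intro!: derivative_eq_intros dT dT1 dK simp: algebra_simps)
    define t0 t1 t2 where t: "t0 = T_fun (v\<^sup>2)" "t1 = T1 (v\<^sup>2)" "t2 = T2 (v\<^sup>2)"
    have f0: "P v * (T' (v\<^sup>2) * (2 * v)) = 2 * t1 / (1 + 3 * v)\<^sup>2" 
     and f1: "P v * (T1' (v\<^sup>2) * (2 * v)) = 2 * t2 / (1 + 3 * v)\<^sup>2" 
      using e0 e1 c unfolding t by (simp_all add: field_simps)
    have "P v * (6 * K' v * T_fun (v\<^sup>2) + 6 * K v * (T' (v\<^sup>2) * (2 * v)) + 2 * (T1' (v\<^sup>2) * (2 * v)))
      = 6 * P v * K' v * t0 + 6 * K v * (P v * (T' (v\<^sup>2) * (2 * v))) + 2 * (P v * (T1' (v\<^sup>2) * (2 * v)))"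
      unfolding t by (simp add: algebra_simps)
    also have "\<dots> = 6 * P v * K' v * t0 + 12 * P v / (1 + 3 * v) * t1 + 4 / (1 + 3 * v)\<^sup>2 * t2"
      unfolding f0 f1 PK[symmetric] using c by (simp add: power2_eq_square)
    finally show "P v * (6 * K' v * T_fun (v\<^sup>2) + 6 * K v * (T' (v\<^sup>2) * (2 * v)) + 2 * (T1' (v\<^sup>2) * (2 * v)))
      = 6 * P v * K' v * T_fun (v\<^sup>2) + 12 * P v / (1 + 3 * v) * T1 (v\<^sup>2) + 4 / (1 + 3 * v)\<^sup>2 * T2 (v\<^sup>2)" unfolding t .
    \<comment> \<open>Once the equation of T at v^2 is used, only a multiple of t0^2 survives. This
      identity says that its coefficient is the potential pulled back along R.\<close>
    have id: "16 * (p_cubic (v\<^sup>2) * (3 - 9 * v\<^sup>2)) + 12 * (1 + 3 * v) * K v * K' v - 36 * (K v)\<^sup>2 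
        = 4 * (p_cubic (R_map v) * (3 - 9 * R_map v)) * (1 + 3 * v) ^ 4"
    proof -
      have a: "1 - R_map v = (1 + v)\<^sup>2 / (1 + 3 * v)" "1 - 9 * R_map v = (1 - 3 * v)\<^sup>2 / (1 + 3 * v)"
         "3 - 9 * R_map v = 3 * (1 + 3 * v\<^sup>2) / (1 + 3 * v)"
        unfolding R_map_def using c by (simp_all add: field_simps power2_eq_square)
      have "(p_cubic (R_map v) * (3 - 9 * R_map v)) * (1 + 3 * v) ^ 4 = 
         v * (1 - v) * (1 + v)\<^sup>2 * (1 - 3 * v)\<^sup>2 * (3 * (1 + 3 * v\<^sup>2))"
        unfolding p_cubic_def a unfolding R_map_def using c by (simp add: eval_nat_numeral)
      moreover have "16 * (p_cubic (v\<^sup>2) * (3 - 9 * v\<^sup>2)) + 12 * (1 + 3 * v) * K v * K' v - 36 * (K v)\<^sup>2 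
        = 4 * (v * (1 - v) * (1 + v)\<^sup>2 * (1 - 3 * v)\<^sup>2 * (3 * (1 + 3 * v\<^sup>2)))"
        unfolding p_cubic_def K_def K'_def by algebra
      ultimately show ?thesis by (simp only: mult.assoc)
    qed
    have ex: "2 * ((1 + 3 * v)\<^sup>2 * t0) * (6 * P v * K' v * t0 + 12 * P v / (1 + 3 * v) * t1 + 4 / (1 + 3 * v)\<^sup>2 * t2)
       = 12 * (1 + 3 * v) * K v * K' v * t0\<^sup>2 + 24 * K v * t0 * t1 + 8 * t0 * t2"
    proof -
      have "2 * (c\<^sup>2 * t0) * (6 * p * k * t0 + 12 * p / c * t1 + 4 / c\<^sup>2 * t2)
         = 12 * c * (c * p) * k * t0\<^sup>2 + 24 * (c * p) * t0 * t1 + 8 * t0 * t2" if "c \<noteq> 0" for c p k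
        using that by (simp add: field_simps power2_eq_square)
      from this[OF c, of "P v" "K' v"] show ?thesis unfolding PK .
    qed
    have T5: "2 * t0 * t2 - t1\<^sup>2 - 4 * (p_cubic (v\<^sup>2) * (3 - 9 * v\<^sup>2)) * t0\<^sup>2 = 0"
      using T(5)[OF n] unfolding t .
    have "2 * ((1 + 3 * v)\<^sup>2 * t0) * (6 * P v * K' v * t0 + 12 * P v / (1 + 3 * v) * t1 + 4 / (1 + 3 * v)\<^sup>2 * t2)
       - (6 * K v * t0 + 2 * t1)\<^sup>2 - 4 * (p_cubic (R_map v) * (3 - 9 * R_map v)) * ((1 + 3 * v)\<^sup>2 * t0)\<^sup>2 = 0"
      unfolding ex using id T5 by algebra
    thus "2 * ((1 + 3 * v)\<^sup>2 * T_fun (v\<^sup>2)) * (6 * P v * K' v * T_fun (v\<^sup>2) + 12 * P v / (1 + 3 * v) * T1 (v\<^sup>2) + 4 / (1 + 3 * v)\<^sup>2 * T2 (v\<^sup>2))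
       - (6 * K v * T_fun (v\<^sup>2) + 2 * T1 (v\<^sup>2))\<^sup>2 - 4 * (p_cubic (R_map v) * (3 - 9 * R_map v)) * ((1 + 3 * v)\<^sup>2 * T_fun (v\<^sup>2))\<^sup>2 = 0"
      unfolding t .
  qed
  thus "sym_square (\<lambda>v. v * (1 - v\<^sup>2) * (1 - 3 * v) / (1 + 3 * v)) (\<lambda>v. p_cubic (R_map v) * (3 - 9 * R_map v)) (1 / 1000) (\<lambda>v. (1 + 3 * v)\<^sup>2 * T_fun (v\<^sup>2))"
    unfolding P_def .
qed

lemma sym_square_mono: "sym_square P \<rho> r T \<Longrightarrow> s \<le> r \<Longrightarrow> sym_square P \<rho> s T"
  unfolding sym_square_def by (meson less_le_trans)

text \<open>Uniqueness applies because both sides are 1 at v = 0. The radius is shrunk so that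
  neither side vanishes and P vanishes only at 0.\<close>

lemma T_fun_functional_equation:
  "\<exists>r>0. \<forall>v. norm v < r \<longrightarrow> T_fun (R_map v) = (1 + 3 * v)\<^sup>2 * T_fun (v\<^sup>2)"
proof -
  let ?f = "\<lambda>v. T_fun (R_map v)" and ?g = "\<lambda>v::complex. (1 + 3 * v)\<^sup>2 * T_fun (v\<^sup>2)"
  have "(?f \<longlongrightarrow> ?f 0) (nhds 0)" by (rule sym_square_imp_tendsto[OF sym_square_T_fun_R_map]) simp
  moreover have "(?g \<longlongrightarrow> ?g 0) (nhds 0)" by (rule sym_square_imp_tendsto[OF sym_square_T_fun_square]) simp
  ultimately have "(?f \<longlongrightarrow> 1) (nhds 0)" "(?g \<longlongrightarrow> 1) (nhds 0)" by (simp_all add: R_map_def)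
  hence "eventually (\<lambda>v. ?f v \<noteq> 0 \<and> ?g v \<noteq> 0) (nhds 0)"
    by (intro eventually_conj tendsto_imp_eventually_ne) auto
  then obtain e where e: "e > 0" "\<And>v. dist v 0 < e \<Longrightarrow> ?f v \<noteq> 0 \<and> ?g v \<noteq> 0"
    unfolding eventually_nhds_metric by blast
  define r where "r = min e (1 / 1000)"
  have r: "r > 0" "r \<le> 1 / 1000" using e by (auto simp: r_def)
  have nz: "1 + c * v \<noteq> 0" if "norm v < r" "norm c \<le> 3" for v c :: complex
  proof
    assume "1 + c * v = 0"
    hence "c * v = - 1" by (simp add: add_eq_0_iff)
    hence "norm c * norm v = 1" by (metis norm_minus_cancel norm_mult norm_one)
    moreover have "norm c * norm v \<le> 3 * (1 / 1000)" using that r by (intro mult_mono) auto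
    ultimately show False by simp
  qed
  show ?thesis
  proof (intro exI conjI allI impI)
    fix v :: complex assume v: "norm v < r"
    show "?f v = ?g v"
    proof (rule sym_square_unique[OF sym_square_mono[OF sym_square_T_fun_R_map r(2)] sym_square_mono[OF sym_square_T_fun_square r(2)] _ _ _ _ _ v])
      fix z :: complex assume z: "norm z < r"
      show "?f z \<noteq> 0" "?g z \<noteq> 0" using e(2)[of z] z by (auto simp: r_def)
      assume "z \<noteq> 0"
      moreover have "1 - z\<^sup>2 = (1 + 1 * z) * (1 + (-1) * z)" by (simp add: algebra_simps power2_eq_square)
      ultimately show "z * (1 - z\<^sup>2) * (1 - 3 * z) / (1 + 3 * z) \<noteq> 0"
        using nz[OF z, of 1] nz[OF z, of "-1"] nz[OF z, of 3] nz[OF z, of "-3"] by simp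
    qed (simp_all add: R_map_def)
  qed (use r in simp)
qed

section \<open>The Euler product and Jacobi's triple product\<close>

definition euler_prod :: "complex \<Rightarrow> complex" where "euler_prod q = (\<Prod>j. 1 - q ^ Suc j)"

lemma one_minus_power_nonzero:
  fixes q :: complex assumes "norm q < 1" "n > 0" shows "1 - q ^ n \<noteq> 0"
proof
  assume "1 - q ^ n = 0"
  hence "norm q ^ n = 1" by (metis eq_iff_diff_eq_0 norm_one norm_power)
  moreover have "norm q ^ n < 1" using assms by (simp add: power_less_one_iff)
  ultimately show False by simp
qed

lemma convergent_euler_prod: "convergent_prod (\<lambda>j. 1 - q ^ Suc j)" if "norm (q::complex) < 1"
proof -
  have "convergent_prod (\<lambda>j. 1 + (- (q ^ Suc j)))"
  proof (rule summable_imp_convergent_prod_complex)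
    show "summable (\<lambda>k. norm (- (q ^ Suc k)))"
      using that by (simp add: norm_power norm_mult summable_geometric)
    show "- (q ^ Suc k) \<noteq> - 1" for k using one_minus_power_nonzero[OF that, of "Suc k"] by auto
  qed
  thus ?thesis by simp
qed

lemma euler_prod_nonzero: "euler_prod q \<noteq> 0" if "norm q < 1"
  unfolding euler_prod_def
  by (rule prodinf_nonzero[OF convergent_euler_prod[OF that]]) (use one_minus_power_nonzero[OF that, of "Suc i" for i] in blast)

lemma euler_prod_LIMSEQ: "(\<lambda>n. \<Prod>j<n. 1 - q ^ Suc j) \<longlonglongrightarrow> euler_prod q" if "norm q < 1"
proof -
  have "(\<lambda>n. \<Prod>j<Suc n. 1 - q ^ Suc j) \<longlonglongrightarrow> euler_prod q"
    unfolding euler_prod_def lessThan_Suc_atMost by (rule convergent_prod_LIMSEQ[OF convergent_euler_prod[OF that]])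
  thus ?thesis by (rule LIMSEQ_imp_Suc)
qed

lemma euler_prod_0 [simp]: "euler_prod 0 = 1"
  by (simp add: euler_prod_def)

text \<open>Uniformity on closed discs yields holomorphy of the product and also permits logarithmic
  differentiation factor by factor.\<close>

lemma euler_prod_uniform_limit:
  assumes "r < 1"
  shows "uniform_limit (cball 0 r) (\<lambda>n q. \<Prod>j<n. 1 - q ^ Suc j) euler_prod sequentially"
proof (cases "r \<ge> 0")
  case True
  have "uniformly_convergent_on (cball 0 r) (\<lambda>N q. \<Sum>n<N. norm (- ((q::complex) ^ Suc n)))"
  proof (rule Weierstrass_m_test')
    show "norm (norm (- (q ^ Suc n))) \<le> r ^ Suc n" if "q \<in> cball 0 r" for n and q :: complex
    proof -
      have "norm q ^ Suc n \<le> r ^ Suc n" using that by (intro power_mono) auto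
      thus ?thesis by (simp add: norm_power norm_mult)
    qed
    show "summable (\<lambda>n. r ^ Suc n)" using True assms by (simp add: summable_geometric)
  qed
  hence "uniformly_convergent_on (cball 0 r) (\<lambda>N q. \<Prod>n<N. 1 + - ((q::complex) ^ Suc n))"
    by (intro uniformly_convergent_on_prod) (auto intro!: continuous_intros)
  then obtain l where l: "uniform_limit (cball 0 r) (\<lambda>n q. \<Prod>j<n. 1 - (q::complex) ^ Suc j) l sequentially"
    by (auto simp: uniformly_convergent_on_def)
  have "l q = euler_prod q" if "q \<in> cball 0 r" for q
    using tendsto_uniform_limitI[OF l that] euler_prod_LIMSEQ[of q] that assms LIMSEQ_unique by fastforce
  thus ?thesis using l by (subst uniform_limit_cong'[where g = "\<lambda>n q. \<Prod>j<n. 1 - q ^ Suc j" and i = l]) auto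
qed simp

lemma euler_prod_holomorphic: "euler_prod holomorphic_on ball 0 1"
proof (rule holomorphic_uniform_sequence[OF open_ball])
  show "(\<lambda>q. \<Prod>j<n. 1 - q ^ Suc j) holomorphic_on ball 0 1" for n by (intro holomorphic_intros)
  fix x :: complex assume x: "x \<in> ball 0 1"
  define d where "d = (1 - norm x) / 2"
  have sub: "cball x d \<subseteq> cball 0 ((1 + norm x) / 2)"
    by (auto simp: d_def subset_iff dist_norm) (smt (verit) norm_minus_commute norm_triangle_ineq2 field_sum_of_halves)
  show "\<exists>d>0. cball x d \<subseteq> ball 0 1 \<and> uniform_limit (cball x d) (\<lambda>n q. \<Prod>j<n. 1 - q ^ Suc j) euler_prod sequentially"
  proof (intro exI conjI)
    show "d > 0" using x by (simp add: d_def)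
    have "cball 0 ((1 + norm x) / 2) \<subseteq> ball (0::complex) 1" using x by auto
    thus "cball x d \<subseteq> ball 0 1" using sub by blast
    show "uniform_limit (cball x d) (\<lambda>n q. \<Prod>j<n. 1 - q ^ Suc j) euler_prod sequentially"
      by (rule uniform_limit_on_subset[OF euler_prod_uniform_limit sub]) (use x in simp)
  qed
qed

text \<open>The bridge between the Lambert series in Ramanujan's P and the Euler product.\<close>

lemma euler_prod_logderiv:
  assumes q: "norm q < 1"
  shows "(\<lambda>j. of_nat (Suc j) * q ^ Suc j / (1 - q ^ Suc j)) sums (- (q * deriv euler_prod q / euler_prod q))"
proof -
  define r where "r = (1 + norm q) / 2"
  have r: "r < 1" "q \<in> ball 0 r" using q by (auto simp: r_def)
  have ul: "uniform_limit (ball 0 r) (\<lambda>n q. \<Prod>j<n. 1 - q ^ Suc j) euler_prod sequentially"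
    by (rule uniform_limit_on_subset[OF euler_prod_uniform_limit[OF r(1)] ball_subset_cball])
  have "(\<lambda>k. deriv (\<lambda>q. 1 - q ^ Suc k) q / (1 - q ^ Suc k)) sums (deriv euler_prod q / euler_prod q)"
    by (rule logderiv_prodinf_complex_uniform_limit[OF ul _ euler_prod_nonzero[OF q] open_ball r(2)])
       (intro holomorphic_intros)
  moreover have "deriv (\<lambda>q. 1 - q ^ Suc k) q = - (of_nat (Suc k) * q ^ k)" for k
  proof (rule DERIV_imp_deriv)
    have "((\<lambda>q. 1 - q ^ Suc k) has_field_derivative (0 - of_nat (Suc k) * q ^ k)) (at q)"
      using DERIV_power[OF DERIV_ident, of "Suc k" q] by (intro DERIV_diff DERIV_const) (simp del: of_nat_Suc)
    thus "((\<lambda>q. 1 - q ^ Suc k) has_field_derivative - (of_nat (Suc k) * q ^ k)) (at q)" by simp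
  qed
  ultimately have "(\<lambda>k. - (of_nat (Suc k) * q ^ k) / (1 - q ^ Suc k)) sums (deriv euler_prod q / euler_prod q)" by simp
  from sums_minus[OF sums_mult[OF this, of q]]
  show ?thesis by (simp add: mult_ac)
qed

section \<open>Gaussian binomials and the triple product\<close>

definition qpoch :: "complex \<Rightarrow> nat \<Rightarrow> complex" where "qpoch p n = (\<Prod>i<n. 1 - p ^ Suc i)"

lemma qpoch_nonzero: "qpoch p n \<noteq> 0" if "norm p < 1"
  unfolding qpoch_def using one_minus_power_nonzero[OF that] by (simp del: power_Suc)

text \<open>The value 0 for j > n allows sums to run past the top index, so that the finite triple
  product can later be written as an infinite series.\<close>

definition qbinom :: "complex \<Rightarrow> nat \<Rightarrow> nat \<Rightarrow> complex" where
  "qbinom p n j = (if j \<le> n then qpoch p n / (qpoch p j * qpoch p (n - j)) else 0)"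

lemma qbinom_Suc:
  assumes p: "norm p < 1" and j: "j \<le> n"
  shows "qbinom p (Suc n) (Suc j) = qbinom p n (Suc j) + p ^ (n - j) * qbinom p n j"
proof (cases "j = n")
  case True
  thus ?thesis using qpoch_nonzero[OF p] by (simp add: qbinom_def qpoch_def[of p 0])
next
  case False
  then obtain m where m: "n = Suc (j + m)" using j by (metis le_neq_implies_less less_natE)
  have S: "qpoch p (Suc k) = qpoch p k * (1 - p ^ Suc k)" for k by (simp add: qpoch_def)
  have nz: "1 - p ^ Suc k \<noteq> 0" for k using one_minus_power_nonzero[OF p, of "Suc k"] by simp
  have e: "1 - p ^ Suc n = (1 - p ^ Suc m) + p ^ Suc m * (1 - p ^ Suc j)"
    unfolding m by (simp add: algebra_simps power_add)
  have "qbinom p (Suc n) (Suc j) = qpoch p n * (1 - p ^ Suc n) / (qpoch p j * (1 - p ^ Suc j) * (qpoch p m * (1 - p ^ Suc m)))"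
    using m by (simp add: qbinom_def S Suc_diff_le del: power_Suc)
  also have "\<dots> = qpoch p n / (qpoch p j * (1 - p ^ Suc j) * qpoch p m) + p ^ Suc m * (qpoch p n / (qpoch p j * (qpoch p m * (1 - p ^ Suc m))))"
    unfolding e using qpoch_nonzero[OF p] nz[of j] nz[of m] by (simp add: divide_simps del: power_Suc) (simp add: algebra_simps del: power_Suc)
  also have "\<dots> = qbinom p n (Suc j) + p ^ (n - j) * qbinom p n j"
    using m by (simp add: qbinom_def S Suc_diff_le del: power_Suc)
  finally show ?thesis .
qed

lemma q_binomial_theorem:
  assumes p: "norm p < 1"
  shows "(\<Prod>k<n. 1 + x * p ^ k) = (\<Sum>j\<le>n. qbinom p n j * p ^ (j choose 2) * x ^ j)"
proof (induction n)
  case 0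
  show ?case by (simp add: qbinom_def qpoch_def binomial_eq_0)
next
  case (Suc n)
  let ?a = "\<lambda>n j. qbinom p n j * p ^ (j choose 2) * x ^ j"
  have "(\<Prod>k<Suc n. 1 + x * p ^ k) = (\<Sum>j\<le>n. ?a n j) + (\<Sum>j\<le>n. x * p ^ n * ?a n j)"
    unfolding prod.lessThan_Suc Suc.IH sum_distrib_left[symmetric] by algebra
  also have "(\<Sum>j\<le>n. ?a n j) = (\<Sum>j\<le>Suc n. ?a n j)" by (simp add: qbinom_def)
  also have "\<dots> = ?a n 0 + (\<Sum>j\<le>n. ?a n (Suc j))" by (rule sum.atMost_Suc_shift)
  also have "?a n 0 = ?a (Suc n) 0" using qpoch_nonzero[OF p] by (simp add: qbinom_def qpoch_def[of p 0])
  also have "?a (Suc n) 0 + (\<Sum>j\<le>n. ?a n (Suc j)) + (\<Sum>j\<le>n. x * p ^ n * ?a n j)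
     = ?a (Suc n) 0 + (\<Sum>j\<le>n. ?a n (Suc j) + x * p ^ n * ?a n j)"
    by (simp add: sum.distrib)
  also have "(\<Sum>j\<le>n. ?a n (Suc j) + x * p ^ n * ?a n j) = (\<Sum>j\<le>n. ?a (Suc n) (Suc j))"
  proof (intro sum.cong refl)
    fix j assume "j \<in> {..n}"
    hence j: "j \<le> n" by simp
    have "Suc j choose 2 = j + (j choose 2)" by (simp add: numeral_2_eq_2)
    moreover have "p ^ n = p ^ (n - j) * p ^ j" using j by (simp flip: power_add)
    ultimately show "?a n (Suc j) + x * p ^ n * ?a n j = ?a (Suc n) (Suc j)"
      unfolding qbinom_Suc[OF p j] by (simp add: power_add algebra_simps)
  qed
  also have "?a (Suc n) 0 + (\<Sum>j\<le>n. ?a (Suc n) (Suc j)) = (\<Sum>j\<le>Suc n. ?a (Suc n) j)"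
    by (rule sum.atMost_Suc_shift[symmetric])
  finally show ?case .
qed

text \<open>The q-binomial theorem with 2n factors, base q^2 and x = z q^(1 - 2n): the first n
  factors produce the powers of 1/z, the last n those of z, and the sum is symmetric about j =
  n.\<close>

lemma finite_triple_product:
  fixes q z :: complex
  assumes q: "norm q < 1" "q \<noteq> 0" and z: "z \<noteq> 0"
  shows "(\<Prod>k<n. (1 + z * q ^ (2 * k + 1)) * (1 + q ^ (2 * k + 1) / z)) =
    qbinom (q\<^sup>2) (2 * n) n +
    (\<Sum>i<n. qbinom (q\<^sup>2) (2 * n) (n + Suc i) * (q ^ (Suc i)\<^sup>2 * (z ^ Suc i + inverse z ^ Suc i)))"
proof -
  define p where "p = q\<^sup>2"
  have p: "norm p < 1" using q by (simp add: p_def norm_power power_less_one_iff)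
  define x where "x = z * q / q ^ (2 * n)"
  define g where "g = (\<lambda>j. qbinom p (2 * n) j * p ^ (j choose 2) * x ^ j)"
  have ch: "2 * (j choose 2) + j = j\<^sup>2" for j :: nat
    by (induction j) (auto simp: numeral_2_eq_2 power2_eq_square)
  \<comment> \<open>The total exponent n^2 + j^2 - 2nj of q is a square, so only the distance m of j
    from the centre n matters.\<close>
  have pw: "q ^ n\<^sup>2 * (p ^ (j choose 2) * x ^ j) = z ^ j * q ^ m\<^sup>2" if "j = n + m \<or> n = j + m" for j m
  proof -
    have "n\<^sup>2 + j\<^sup>2 = 2 * n * j + m\<^sup>2" using that by (auto simp: power2_eq_square algebra_simps)
    hence e: "q ^ n\<^sup>2 * q ^ j\<^sup>2 = q ^ (2 * n * j) * q ^ m\<^sup>2" by (simp flip: power_add)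
    have "p ^ (j choose 2) * q ^ j = q ^ j\<^sup>2" unfolding p_def by (simp add: ch flip: power_mult power_add)
    hence "q ^ n\<^sup>2 * (p ^ (j choose 2) * x ^ j) = q ^ n\<^sup>2 * q ^ j\<^sup>2 * z ^ j / q ^ (2 * n * j)"
      unfolding x_def by (simp add: power_mult_distrib power_divide power_mult)
    also have "\<dots> = z ^ j * q ^ m\<^sup>2" unfolding e using q by simp
    finally show ?thesis .
  qed
  have lhs: "q ^ n\<^sup>2 * (\<Prod>k<2 * n. 1 + x * p ^ k) = z ^ n * (\<Prod>k<n. (1 + z * q ^ (2 * k + 1)) * (1 + q ^ (2 * k + 1) / z))"
  proof -
    have "(\<Prod>k<2 * n. 1 + x * p ^ k) = (\<Prod>k<n. 1 + x * p ^ k) * (\<Prod>k<n. 1 + x * p ^ (n + k))"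
    proof -
      have u: "{..<2 * n} = {..<n} \<union> {n..<n + n}" by auto
      have "(\<Prod>k<2 * n. 1 + x * p ^ k) = (\<Prod>k<n. 1 + x * p ^ k) * (\<Prod>k\<in>{n..<n + n}. 1 + x * p ^ k)"
        unfolding u by (rule prod.union_disjoint) auto
      also have "(\<Prod>k\<in>{n..<n + n}. 1 + x * p ^ k) = (\<Prod>k<n. 1 + x * p ^ (n + k))"
        by (rule prod.reindex_bij_witness[of _ "\<lambda>k. n + k" "\<lambda>k. k - n"]) auto
      finally show ?thesis .
    qed
    also have "(\<Prod>k<n. 1 + x * p ^ k) = (\<Prod>k<n. 1 + x * p ^ (n - Suc k))"
      by (rule prod.nat_diff_reindex[symmetric])
    also have "(\<Prod>k<n. 1 + x * p ^ (n - Suc k)) = (\<Prod>k<n. (z / q ^ (2 * k + 1)) * (1 + q ^ (2 * k + 1) / z))"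
    proof (intro prod.cong refl)
      fix k assume "k \<in> {..<n}"
      hence "2 * n = 2 * (n - Suc k) + (2 * k + 1) + 1" by simp
      hence "q ^ (2 * n) = q ^ (2 * (n - Suc k)) * q ^ (2 * k + 1) * q" by (metis power_add power_one_right)
      thus "1 + x * p ^ (n - Suc k) = (z / q ^ (2 * k + 1)) * (1 + q ^ (2 * k + 1) / z)"
        unfolding x_def p_def power_mult[symmetric] using q z by (simp add: field_simps)
    qed
    also have "(\<Prod>k<n. 1 + x * p ^ (n + k)) = (\<Prod>k<n. 1 + z * q ^ (2 * k + 1))"
      unfolding x_def p_def power_mult[symmetric] using q by (intro prod.cong refl) (simp add: power_add distrib_left)
    also have "(\<Prod>k<n. (z / q ^ (2 * k + 1)) * (1 + q ^ (2 * k + 1) / z)) = z ^ n / q ^ n\<^sup>2 * (\<Prod>k<n. 1 + q ^ (2 * k + 1) / z)"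
    proof -
      have "(\<Prod>k<n. z / q ^ (2 * k + 1)) = z ^ n / q ^ n\<^sup>2" for n
      proof (induction n)
        case (Suc n)
        have "(Suc n)\<^sup>2 = n\<^sup>2 + (2 * n + 1)" by (simp add: power2_eq_square)
        thus ?case using Suc by (simp add: power_add mult_ac)
      qed simp
      thus ?thesis by (simp only: prod.distrib)
    qed
    finally show ?thesis using q by (simp add: prod.distrib)
  qed
  have "(\<Sum>j\<le>2 * n. g j) = g n + (\<Sum>i<n. g (n + Suc i) + g (n - Suc i))"
  proof -
    have u: "{..2 * n} = {..<n} \<union> ({n} \<union> {Suc n..<Suc n + n})" by auto
    have "(\<Sum>j\<le>2 * n. g j) = (\<Sum>j<n. g j) + (\<Sum>j\<in>{n} \<union> {Suc n..<Suc n + n}. g j)"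
      unfolding u by (rule sum.union_disjoint) auto
    also have "(\<Sum>j\<in>{n} \<union> {Suc n..<Suc n + n}. g j) = g n + (\<Sum>j\<in>{Suc n..<Suc n + n}. g j)"
      by (subst sum.union_disjoint) auto
    also have "(\<Sum>j\<in>{Suc n..<Suc n + n}. g j) = (\<Sum>i<n. g (n + Suc i))"
      by (rule sum.reindex_bij_witness[of _ "\<lambda>k. n + Suc k" "\<lambda>k. k - Suc n"]) auto
    also have "(\<Sum>j<n. g j) = (\<Sum>i<n. g (n - Suc i))"
      by (rule sum.nat_diff_reindex[symmetric])
    finally show ?thesis by (simp add: sum.distrib)
  qed
  hence "z ^ n * (\<Prod>k<n. (1 + z * q ^ (2 * k + 1)) * (1 + q ^ (2 * k + 1) / z))
    = q ^ n\<^sup>2 * g n + (\<Sum>i<n. q ^ n\<^sup>2 * g (n + Suc i) + q ^ n\<^sup>2 * g (n - Suc i))"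
    unfolding lhs[symmetric] q_binomial_theorem[OF p] g_def[symmetric] by (simp add: sum_distrib_left distrib_left)
  also have "q ^ n\<^sup>2 * g n = z ^ n * qbinom p (2 * n) n"
    using pw[of n 0] unfolding g_def by (simp add: mult_ac)
  also have "(\<Sum>i<n. q ^ n\<^sup>2 * g (n + Suc i) + q ^ n\<^sup>2 * g (n - Suc i))
    = (\<Sum>i<n. z ^ n * (qbinom p (2 * n) (n + Suc i) * (q ^ (Suc i)\<^sup>2 * (z ^ Suc i + inverse z ^ Suc i))))"
  proof (intro sum.cong refl)
    fix i assume "i \<in> {..<n}"
    hence i: "Suc i \<le> n" by simp
    have "qbinom p (2 * n) (n - Suc i) = qbinom p (2 * n) (n + Suc i)"
      using i by (simp add: qbinom_def mult.commute)
    hence "q ^ n\<^sup>2 * g (n - Suc i) = qbinom p (2 * n) (n + Suc i) * (z ^ (n - Suc i) * q ^ (Suc i)\<^sup>2)"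
      using pw[of "n - Suc i" "Suc i"] i unfolding g_def by (simp add: mult_ac)
    also have "z ^ (n - Suc i) = z ^ n * inverse z ^ Suc i"
      using power_diff[OF z i] by (simp only: power_inverse divide_inverse)
    finally have 1: "q ^ n\<^sup>2 * g (n - Suc i) = z ^ n * (qbinom p (2 * n) (n + Suc i) * (q ^ (Suc i)\<^sup>2 * inverse z ^ Suc i))"
      by (simp only: mult_ac)
    have "q ^ n\<^sup>2 * g (n + Suc i) = qbinom p (2 * n) (n + Suc i) * (z ^ (n + Suc i) * q ^ (Suc i)\<^sup>2)"
      using pw[of "n + Suc i" "Suc i"] unfolding g_def by (simp add: mult_ac)
    also have "\<dots> = z ^ n * (qbinom p (2 * n) (n + Suc i) * (q ^ (Suc i)\<^sup>2 * z ^ Suc i))"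
      unfolding power_add[of z] by (simp only: mult_ac)
    finally have 2: "q ^ n\<^sup>2 * g (n + Suc i) = z ^ n * (qbinom p (2 * n) (n + Suc i) * (q ^ (Suc i)\<^sup>2 * z ^ Suc i))" .
    show "q ^ n\<^sup>2 * g (n + Suc i) + q ^ n\<^sup>2 * g (n - Suc i)
      = z ^ n * (qbinom p (2 * n) (n + Suc i) * (q ^ (Suc i)\<^sup>2 * (z ^ Suc i + inverse z ^ Suc i)))"
      unfolding 1 2 by (simp only: distrib_left)
  qed
  finally have "z ^ n * (\<Prod>k<n. (1 + z * q ^ (2 * k + 1)) * (1 + q ^ (2 * k + 1) / z)) = z ^ n *
     (qbinom p (2 * n) n + (\<Sum>i<n. qbinom p (2 * n) (n + Suc i) * (q ^ (Suc i)\<^sup>2 * (z ^ Suc i + inverse z ^ Suc i))))"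
    by (simp only: sum_distrib_left distrib_left)
  thus ?thesis using z unfolding p_def by simp
qed

text \<open>The finite product formula passes to the limit by Tannery's theorem. The value
  \<open>L\<close> of the product is an assumption, so that each specialisation supplies its own
  closed form. The range of z contains 1, -1 and the endpoint q, the three values used
  below.\<close>

lemma jacobi_triple_product:
  fixes q z :: complex
  assumes q: "norm q < 1" "q \<noteq> 0" and z: "norm q \<le> norm z" "norm q * norm z \<le> 1"
    and L: "(\<lambda>n. \<Prod>k<n. (1 + z * q ^ (2 * k + 1)) * (1 + q ^ (2 * k + 1) / z)) \<longlonglongrightarrow> L"
  shows "summable (\<lambda>i. norm (q ^ (Suc i)\<^sup>2 * z ^ Suc i))"
    and "summable (\<lambda>i. norm (q ^ (Suc i)\<^sup>2 * inverse z ^ Suc i))"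
    and "(\<lambda>i. q ^ (Suc i)\<^sup>2 * (z ^ Suc i + inverse z ^ Suc i)) sums (euler_prod (q\<^sup>2) * L - 1)"
proof -
  have z0: "z \<noteq> 0" using q z by auto
  define p where "p = q\<^sup>2"
  have p: "norm p < 1" using q by (simp add: p_def norm_power power_less_one_iff)
  have Ep: "euler_prod p \<noteq> 0" by (rule euler_prod_nonzero[OF p])
  have poch: "qpoch p \<longlonglongrightarrow> euler_prod p" using euler_prod_LIMSEQ[OF p] unfolding qpoch_def .
  \<comment> \<open>Since (i + 1)^2 = i(i + 1) + (i + 1), and both |qz| and |q/z| are at most 1, a
    factor |q|^(i(i + 1)) remains.\<close>
  have b1: "norm (q ^ (Suc i)\<^sup>2 * z ^ Suc i) \<le> norm q ^ i" and b2: "norm (q ^ (Suc i)\<^sup>2 * inverse z ^ Suc i) \<le> norm q ^ i" for i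
  proof -
    have "(Suc i)\<^sup>2 = i * Suc i + Suc i" by (simp add: power2_eq_square)
    hence e: "q ^ (Suc i)\<^sup>2 = q ^ (i * Suc i) * q ^ Suc i" by (simp only: power_add)
    have m: "norm (q ^ (i * Suc i)) \<le> norm q ^ i"
      unfolding norm_power using q by (intro power_decreasing) auto
    have "norm (q ^ Suc i * z ^ Suc i) \<le> 1"
      unfolding power_mult_distrib[symmetric] norm_power using z by (intro power_le_one) (auto simp: norm_mult)
    thus "norm (q ^ (Suc i)\<^sup>2 * z ^ Suc i) \<le> norm q ^ i"
      unfolding e mult.assoc norm_mult[of "q ^ (i * Suc i)"] by (intro order_trans[OF mult_mono[OF m]]) auto
    have "norm (q ^ Suc i * inverse z ^ Suc i) \<le> 1"
      unfolding power_mult_distrib[symmetric] norm_power using z z0 by (intro power_le_one) (auto simp: norm_mult norm_inverse norm_divide divide_simps)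
    thus "norm (q ^ (Suc i)\<^sup>2 * inverse z ^ Suc i) \<le> norm q ^ i"
      unfolding e mult.assoc norm_mult[of "q ^ (i * Suc i)"] by (intro order_trans[OF mult_mono[OF m]]) auto
  qed
  have sg: "summable (\<lambda>i. norm q ^ i)" using q by (intro summable_geometric) auto
  show "summable (\<lambda>i. norm (q ^ (Suc i)\<^sup>2 * z ^ Suc i))" "summable (\<lambda>i. norm (q ^ (Suc i)\<^sup>2 * inverse z ^ Suc i))"
    by (rule summable_comparison_test'[OF sg, of 0], use b1 b2 in simp)+
  obtain C where C: "\<And>n. norm (qpoch p n) \<le> C"
    using poch by (metis BseqE convergentI convergent_imp_Bseq)
  have "(\<lambda>n. inverse (qpoch p n)) \<longlonglongrightarrow> inverse (euler_prod p)" by (rule tendsto_inverse[OF poch Ep])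
  then obtain D where D: "\<And>n. norm (inverse (qpoch p n)) \<le> D"
    by (metis BseqE convergentI convergent_imp_Bseq)
  have C0: "C \<ge> 0" "D \<ge> 0" using C[of 0] D[of 0] norm_ge_zero order_trans by blast+
  have qb: "norm (qbinom p n j) \<le> C * D * D" for n j
  proof (cases "j \<le> n")
    case True
    have "norm (qbinom p n j) = norm (qpoch p n) * norm (inverse (qpoch p j)) * norm (inverse (qpoch p (n - j)))"
      using True by (simp add: qbinom_def norm_mult norm_divide norm_inverse divide_inverse)
    also have "\<dots> \<le> C * D * D" using C[of n] D[of j] D[of "n - j"] C0 by (intro mult_mono) auto
    finally show ?thesis .
  qed (use C0 in \<open>simp add: qbinom_def\<close>)
  have qlim: "(\<lambda>n. qbinom p (2 * n) (n + m)) \<longlonglongrightarrow> inverse (euler_prod p)" for m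
  proof -
    have s: "filterlim (\<lambda>n::nat. 2 * n) at_top at_top" "filterlim (\<lambda>n::nat. n + m) at_top at_top" "filterlim (\<lambda>n::nat. n - m) at_top at_top"
      by (auto intro!: filterlim_subseq filterlim_minus_const_nat_at_top simp: strict_mono_def)
    have "(\<lambda>n. qpoch p (2 * n) / (qpoch p (n + m) * qpoch p (n - m))) \<longlonglongrightarrow> euler_prod p / (euler_prod p * euler_prod p)"
      by (intro tendsto_divide tendsto_mult filterlim_compose[OF poch] s) (use Ep in auto)
    moreover have "eventually (\<lambda>n. qpoch p (2 * n) / (qpoch p (n + m) * qpoch p (n - m)) = qbinom p (2 * n) (n + m)) sequentially"
      using eventually_ge_at_top[of m] by eventually_elim (simp add: qbinom_def)
    ultimately have "(\<lambda>n. qbinom p (2 * n) (n + m)) \<longlonglongrightarrow> euler_prod p / (euler_prod p * euler_prod p)"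
      by (rule Lim_transform_eventually)
    thus ?thesis using Ep by (simp add: field_simps)
  qed
  define u where "u = (\<lambda>i. q ^ (Suc i)\<^sup>2 * (z ^ Suc i + inverse z ^ Suc i))"
  have un: "norm (u i) \<le> 2 * norm q ^ i" for i
    unfolding u_def distrib_left using norm_triangle_le[OF add_mono[OF b1[of i] b2[of i]]] by simp
  define a where "a = (\<lambda>i n. qbinom p (2 * n) (n + Suc i) * u i)"
  have tan: "summable (\<lambda>i. norm (inverse (euler_prod p) * u i)) \<and>
     (\<lambda>n. suminf (\<lambda>i. a i n)) \<longlonglongrightarrow> suminf (\<lambda>i. inverse (euler_prod p) * u i)"
  proof (rule conjunct2[OF tannerys_theorem])
    show "(\<lambda>n. a k n) \<longlonglongrightarrow> inverse (euler_prod p) * u k" for k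
      unfolding a_def by (intro tendsto_mult tendsto_const qlim)
    show "\<forall>\<^sub>F (k, n) in at_top \<times>\<^sub>F sequentially. norm (a k n) \<le> C * D * D * (2 * norm q ^ k)"
    proof (intro always_eventually allI, clarify)
      fix k n show "norm (a k n) \<le> C * D * D * (2 * norm q ^ k)"
        unfolding a_def norm_mult using qb un C0 by (intro mult_mono) auto
    qed
    show "summable (\<lambda>k. C * D * D * (2 * norm q ^ k))" by (intro summable_mult sg)
  qed auto
  have "suminf (\<lambda>i. a i n) = (\<Sum>i<n. a i n)" for n
    by (rule suminf_finite) (auto simp: a_def qbinom_def)
  hence fin: "(\<Prod>k<n. (1 + z * q ^ (2 * k + 1)) * (1 + q ^ (2 * k + 1) / z)) = qbinom p (2 * n) n + suminf (\<lambda>i. a i n)" for n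
    unfolding finite_triple_product[OF q z0] a_def u_def p_def by simp
  have "(\<lambda>n. qbinom p (2 * n) (n + 0) + suminf (\<lambda>i. a i n)) \<longlonglongrightarrow> inverse (euler_prod p) + suminf (\<lambda>i. inverse (euler_prod p) * u i)"
    by (intro tendsto_add qlim) (use tan in blast)
  hence L2: "L = inverse (euler_prod p) + suminf (\<lambda>i. inverse (euler_prod p) * u i)"
    using L unfolding fin by (simp add: LIMSEQ_unique)
  have su: "summable u"
    by (rule summable_norm_cancel, rule summable_comparison_test'[OF summable_mult[OF sg, of 2], of 0]) (use un in simp)
  have "L = inverse (euler_prod p) * (1 + suminf u)"
    unfolding L2 suminf_mult[OF su] by (simp add: algebra_simps)
  hence "suminf u = euler_prod p * L - 1" using Ep by (simp add: field_simps)
  thus "(\<lambda>i. q ^ (Suc i)\<^sup>2 * (z ^ Suc i + inverse z ^ Suc i)) sums (euler_prod (q\<^sup>2) * L - 1)"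
    using summable_sums[OF su] unfolding p_def u_def by simp
qed

section \<open>Theta functions\<close>

text \<open>Ramanujan's theta functions: the sum of q^(n^2) over all integers, the sum of
  q^(n(n+1)/2) over n \<ge> 0, and the first of these at -q. The product forms make holomorphy and
  absence of zeros in the unit disc immediate; the series are derived from them.\<close>

definition phi :: "complex \<Rightarrow> complex" where
  "phi q = euler_prod (q\<^sup>2) ^ 5 / (euler_prod q ^ 2 * euler_prod (q ^ 4) ^ 2)"
definition psi :: "complex \<Rightarrow> complex" where
  "psi q = euler_prod (q\<^sup>2) ^ 2 / euler_prod q"
definition phi_minus :: "complex \<Rightarrow> complex" where
  "phi_minus q = euler_prod q ^ 2 / euler_prod (q\<^sup>2)"

lemma norm_power_less_1: "norm (q::complex) < 1 \<Longrightarrow> n > 0 \<Longrightarrow> norm (q ^ n) < 1"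
  by (simp add: norm_power power_less_one_iff)

lemma euler_prod_power_nonzero: "norm q < 1 \<Longrightarrow> n > 0 \<Longrightarrow> euler_prod (q ^ n) \<noteq> 0"
  by (intro euler_prod_nonzero norm_power_less_1)

lemma psi_square: "norm q < 1 \<Longrightarrow> psi q ^ 2 = phi q * psi (q\<^sup>2)"
  using euler_prod_nonzero[of q] euler_prod_power_nonzero[of q 2] euler_prod_power_nonzero[of q 4]
  by (simp add: psi_def phi_def field_simps eval_nat_numeral)

lemma phi_minus_square: "norm q < 1 \<Longrightarrow> phi_minus (q\<^sup>2) ^ 2 = phi q * phi_minus q"
  using euler_prod_nonzero[of q] euler_prod_power_nonzero[of q 2] euler_prod_power_nonzero[of q 4]
  by (simp add: phi_minus_def phi_def field_simps eval_nat_numeral)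

section \<open>Infinite products over the odd exponents and with plus signs\<close>

lemma odd_product_LIMSEQ:
  assumes q: "norm q < 1"
  shows "(\<lambda>n. \<Prod>k<n. 1 - q ^ (2 * k + 1)) \<longlonglongrightarrow> euler_prod q / euler_prod (q\<^sup>2)"
proof -
  have nz: "(\<Prod>k<n. 1 - (q\<^sup>2) ^ Suc k) \<noteq> 0" for n
    using one_minus_power_nonzero[OF norm_power_less_1[OF q, of 2]] by (simp del: power_Suc)
  have split: "(\<Prod>k<2 * n. 1 - q ^ Suc k) = (\<Prod>k<n. 1 - q ^ (2 * k + 1)) * (\<Prod>k<n. 1 - (q\<^sup>2) ^ Suc k)" for n
  proof (induction n)
    case (Suc n)
    have "(q\<^sup>2) ^ Suc n = q ^ Suc (Suc (2 * n))" by (simp only: power_mult[symmetric]) simp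
    thus ?case using Suc by (simp add: mult_ac del: power_Suc)
  qed simp
  have "(\<lambda>n. (\<Prod>k<2 * n. 1 - q ^ Suc k) / (\<Prod>k<n. 1 - (q\<^sup>2) ^ Suc k)) \<longlonglongrightarrow> euler_prod q / euler_prod (q\<^sup>2)"
    using norm_power_less_1[OF q, of 2]
    by (intro tendsto_divide filterlim_compose[OF euler_prod_LIMSEQ[OF q]] euler_prod_LIMSEQ euler_prod_nonzero filterlim_subseq)
       (auto simp: strict_mono_def)
  moreover have "(\<Prod>k<2 * n. 1 - q ^ Suc k) / (\<Prod>k<n. 1 - (q\<^sup>2) ^ Suc k) = (\<Prod>k<n. 1 - q ^ (2 * k + 1))" for n
    unfolding split using nz[of n] by (simp del: power_Suc)
  ultimately show ?thesis by (simp only:)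
qed

lemma odd_plus_product_LIMSEQ:
  assumes q: "norm q < 1"
  shows "(\<lambda>n. \<Prod>k<n. 1 + q ^ (2 * k + 1)) \<longlonglongrightarrow> euler_prod (q\<^sup>2) ^ 2 / (euler_prod q * euler_prod (q ^ 4))"
proof -
  have q2: "norm (q\<^sup>2) < 1" using norm_power_less_1[OF q, of 2] by simp
  have nz: "1 - q ^ (2 * k + 1) \<noteq> 0" for k using one_minus_power_nonzero[OF q, of "2 * k + 1"] by simp
  have "(\<Prod>k<n. 1 + q ^ (2 * k + 1)) = (\<Prod>k<n. 1 - (q\<^sup>2) ^ (2 * k + 1)) / (\<Prod>k<n. 1 - q ^ (2 * k + 1))" for n
  proof -
    have "1 - (q\<^sup>2) ^ (2 * k + 1) = (1 + q ^ (2 * k + 1)) * (1 - q ^ (2 * k + 1))" for k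
    proof -
      have "(q\<^sup>2) ^ (2 * k + 1) = (q ^ (2 * k + 1))\<^sup>2" by (simp only: power_mult[symmetric] mult.commute)
      thus ?thesis by (simp add: algebra_simps power2_eq_square)
    qed
    thus ?thesis using nz by (simp add: prod.distrib)
  qed
  moreover have "(\<lambda>n. (\<Prod>k<n. 1 - (q\<^sup>2) ^ (2 * k + 1)) / (\<Prod>k<n. 1 - q ^ (2 * k + 1))) \<longlonglongrightarrow>
      (euler_prod (q\<^sup>2) / euler_prod ((q\<^sup>2)\<^sup>2)) / (euler_prod q / euler_prod (q\<^sup>2))"
    using euler_prod_nonzero[OF q] euler_prod_nonzero[OF q2]
    by (intro tendsto_divide odd_product_LIMSEQ q q2) auto
  ultimately show ?thesis by (simp add: power2_eq_square power4_eq_xxxx mult_ac)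
qed

lemma even_plus_product_LIMSEQ:
  assumes q: "norm q < 1"
  shows "(\<lambda>n. \<Prod>k<n. 1 + q ^ Suc k) \<longlonglongrightarrow> euler_prod (q\<^sup>2) / euler_prod q"
proof -
  have q2: "norm (q\<^sup>2) < 1" using norm_power_less_1[OF q, of 2] by simp
  have nz: "1 - q ^ Suc k \<noteq> 0" for k using one_minus_power_nonzero[OF q, of "Suc k"] by simp
  have "(\<Prod>k<n. 1 + q ^ Suc k) = (\<Prod>k<n. 1 - (q\<^sup>2) ^ Suc k) / (\<Prod>k<n. 1 - q ^ Suc k)" for n
  proof -
    have "1 - (q\<^sup>2) ^ Suc k = (1 + q ^ Suc k) * (1 - q ^ Suc k)" for k
    proof -
      have "(q\<^sup>2) ^ Suc k = (q ^ Suc k)\<^sup>2" by (simp only: power_mult[symmetric] mult.commute)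
      thus ?thesis by (simp add: algebra_simps power2_eq_square)
    qed
    thus ?thesis using nz by (simp add: prod.distrib del: power_Suc)
  qed
  moreover have "(\<lambda>n. (\<Prod>k<n. 1 - (q\<^sup>2) ^ Suc k) / (\<Prod>k<n. 1 - q ^ Suc k)) \<longlonglongrightarrow> euler_prod (q\<^sup>2) / euler_prod q"
    by (intro tendsto_divide euler_prod_LIMSEQ q q2 euler_prod_nonzero)
  ultimately show ?thesis by (simp only:)
qed

text \<open>Converts the one-sided series of the triple product into an unordered sum over the
  integers, the form in which double series can be re-indexed by bijections.\<close>

lemma has_sum_int_from_nat:
  fixes f :: "int \<Rightarrow> complex"
  assumes p: "summable (\<lambda>i. norm (f (int (Suc i))))" and m: "summable (\<lambda>i. norm (f (- int (Suc i))))"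
    and s: "(\<lambda>i. f (int (Suc i)) + f (- int (Suc i))) sums S"
  shows "(f has_sum (f 0 + S)) UNIV" and "(\<lambda>n. norm (f n)) summable_on UNIV"
proof -
  let ?P = "range (\<lambda>i. int (Suc i))" and ?M = "range (\<lambda>i. - int (Suc i))"
  have ij: "inj (\<lambda>i. int (Suc i))" "inj (\<lambda>i. - int (Suc i))" by (auto simp: inj_def)
  have U: "UNIV = {0} \<union> (?P \<union> ?M)"
  proof -
    have "n \<in> {0} \<union> (?P \<union> ?M)" for n :: int
    proof (cases n rule: linorder_cases[of _ 0])
      case less
      hence "n = - int (Suc (nat (- n - 1)))" by simp
      thus ?thesis by blast
    next
      case greater
      hence "n = int (Suc (nat (n - 1)))" by simp
      thus ?thesis by blast
    qed simp
    thus ?thesis by blast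
  qed
  have disj: "{0} \<inter> (?P \<union> ?M) = {}" "?P \<inter> ?M = {}" by auto
  obtain a b where ab: "(\<lambda>i. f (int (Suc i))) sums a" "(\<lambda>i. f (- int (Suc i))) sums b"
    using summable_norm_cancel[OF p] summable_norm_cancel[OF m] by (auto simp: summable_def)
  have S: "S = a + b" using sums_unique2[OF s sums_add[OF ab]] .
  have "(f has_sum a) ?P" "(f has_sum b) ?M"
    using norm_summable_imp_has_sum[OF p ab(1)] norm_summable_imp_has_sum[OF m ab(2)]
    by (simp_all only: has_sum_reindex[OF ij(1)] has_sum_reindex[OF ij(2)] comp_def)
  hence "(f has_sum (a + b)) (?P \<union> ?M)" by (intro has_sum_Un_disjoint disj)
  hence "(f has_sum (f 0 + (a + b))) ({0} \<union> (?P \<union> ?M))"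
    by (rule has_sum_Un_disjoint[OF _ _ disj(1), rotated]) (rule has_sum_finiteI, auto)
  thus "(f has_sum (f 0 + S)) UNIV" unfolding U[symmetric] S .
  have "(\<lambda>n. norm (f n)) summable_on ?P" "(\<lambda>n. norm (f n)) summable_on ?M"
    using summable_nonneg_imp_summable_on[OF p] summable_nonneg_imp_summable_on[OF m]
    by (simp_all only: summable_on_reindex[OF ij(1)] summable_on_reindex[OF ij(2)] comp_def norm_ge_zero)
  hence "(\<lambda>n. norm (f n)) summable_on ({0} \<union> (?P \<union> ?M))"
    by (intro summable_on_Un_disjoint disj) auto
  thus "(\<lambda>n. norm (f n)) summable_on UNIV" unfolding U[symmetric] .
qed

lemma phi_has_sum:
  assumes q: "norm q < 1" "q \<noteq> 0"
  shows "((\<lambda>n::int. q ^ nat (n\<^sup>2)) has_sum phi q) UNIV" "(\<lambda>n::int. norm (q ^ nat (n\<^sup>2))) summable_on UNIV"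
proof -
  let ?L = "(euler_prod (q\<^sup>2) ^ 2 / (euler_prod q * euler_prod (q ^ 4)))\<^sup>2"
  have "(\<lambda>n. (\<Prod>k<n. 1 + q ^ (2 * k + 1)) * (\<Prod>k<n. 1 + q ^ (2 * k + 1))) \<longlonglongrightarrow> ?L"
    unfolding power2_eq_square[of "_ / _"] by (intro tendsto_mult odd_plus_product_LIMSEQ q)
  hence L: "(\<lambda>n. \<Prod>k<n. (1 + 1 * q ^ (2 * k + 1)) * (1 + q ^ (2 * k + 1) / 1)) \<longlonglongrightarrow> ?L"
    by (simp add: prod.distrib)
  note J = jacobi_triple_product[OF q _ _ L]
  have nq: "norm q \<le> norm (1::complex)" "norm q * norm (1::complex) \<le> 1" using q by auto
  let ?f = "\<lambda>n::int. q ^ nat (n\<^sup>2)"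
  have e: "nat ((int (Suc i))\<^sup>2) = (Suc i)\<^sup>2" "nat ((- int (Suc i))\<^sup>2) = (Suc i)\<^sup>2" for i
    by (metis nat_int of_nat_power) (metis nat_int of_nat_power power2_minus)
  have "(?f has_sum (?f 0 + (euler_prod (q\<^sup>2) * ?L - 1))) UNIV \<and> (\<lambda>n. norm (?f n)) summable_on UNIV"
    by (intro conjI has_sum_int_from_nat; unfold e) (use J[OF nq] in \<open>simp_all add: mult_2_right\<close>)
  moreover have "?f 0 + (euler_prod (q\<^sup>2) * ?L - 1) = phi q"
    using euler_prod_nonzero[of q] q unfolding phi_def by (simp add: power_divide eval_nat_numeral field_simps)
  ultimately show "(?f has_sum phi q) UNIV" "(\<lambda>n::int. norm (?f n)) summable_on UNIV" by auto
qed

lemma phi_minus_has_sum: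
  assumes q: "norm q < 1" "q \<noteq> 0"
  shows "((\<lambda>n::int. (- q) ^ nat (n\<^sup>2)) has_sum phi_minus q) UNIV"
proof -
  let ?L = "(euler_prod q / euler_prod (q\<^sup>2))\<^sup>2"
  have "(\<lambda>n. (\<Prod>k<n. 1 - q ^ (2 * k + 1)) * (\<Prod>k<n. 1 - q ^ (2 * k + 1))) \<longlonglongrightarrow> ?L"
    unfolding power2_eq_square[of "_ / _"] by (intro tendsto_mult odd_product_LIMSEQ q)
  hence L: "(\<lambda>n. \<Prod>k<n. (1 + (-1) * q ^ (2 * k + 1)) * (1 + q ^ (2 * k + 1) / (-1))) \<longlonglongrightarrow> ?L"
    by (simp add: prod.distrib)
  note J = jacobi_triple_product[OF q _ _ L]
  have nq: "norm q \<le> norm (-1::complex)" "norm q * norm (-1::complex) \<le> 1" using q by auto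
  let ?f = "\<lambda>n::int. (- q) ^ nat (n\<^sup>2)"
  have e: "nat ((int (Suc i))\<^sup>2) = (Suc i)\<^sup>2" "nat ((- int (Suc i))\<^sup>2) = (Suc i)\<^sup>2" for i
    by (metis nat_int of_nat_power) (metis nat_int of_nat_power power2_minus)
  have par: "(- q) ^ (Suc i)\<^sup>2 = q ^ (Suc i)\<^sup>2 * (- 1) ^ Suc i" for i
  proof -
    have "(- q) ^ (Suc i)\<^sup>2 = (- 1) ^ (Suc i)\<^sup>2 * q ^ (Suc i)\<^sup>2" by (rule power_minus)
    also have "(- 1 :: complex) ^ (Suc i)\<^sup>2 = (- 1) ^ Suc i"
      by (cases "even i") (auto simp: power2_eq_square)
    finally show ?thesis by simp
  qed
  have "(?f has_sum (?f 0 + (euler_prod (q\<^sup>2) * ?L - 1))) UNIV"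
    by (intro has_sum_int_from_nat; unfold e par) (use J[OF nq] in \<open>simp_all add: distrib_left mult_ac\<close>)
  moreover have "?f 0 + (euler_prod (q\<^sup>2) * ?L - 1) = phi_minus q"
    using euler_prod_power_nonzero[of q 2] q unfolding phi_minus_def by (simp add: power_divide eval_nat_numeral field_simps)
  ultimately show ?thesis by auto
qed

text \<open>The bilateral series of the two sides agree term by term; the product at -q is never
  rearranged.\<close>

lemma phi_minus_eq: "phi_minus q = phi (- q)" if q: "norm q < 1"
proof (cases "q = 0")
  case False
  thus ?thesis using phi_minus_has_sum[OF q False] phi_has_sum(1)[of "- q"] q has_sum_unique by fastforce
qed (simp add: phi_minus_def phi_def)

text \<open>The endpoint z = q of the triple product. The factor 2 reflects that n and -1 - n have
  the same exponent; on the product side it is the factor 1 + q^0.\<close>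

lemma psi_has_sum:
  assumes q: "norm q < 1" "q \<noteq> 0"
  shows "((\<lambda>n::int. q ^ nat (n\<^sup>2 + n)) has_sum (2 * psi (q\<^sup>2))) UNIV" "(\<lambda>n::int. norm (q ^ nat (n\<^sup>2 + n))) summable_on UNIV"
proof -
  have q2: "norm (q\<^sup>2) < 1" using norm_power_less_1[OF q(1), of 2] by simp
  let ?l = "euler_prod ((q\<^sup>2)\<^sup>2) / euler_prod (q\<^sup>2)"
  let ?L = "2 * ?l\<^sup>2"
  have 1: "(\<lambda>n. \<Prod>k<n. 1 + (q\<^sup>2) ^ Suc k) \<longlonglongrightarrow> ?l" by (rule even_plus_product_LIMSEQ[OF q2])
  have "(\<lambda>n. 2 * (\<Prod>k<n. 1 + (q\<^sup>2) ^ Suc k)) \<longlonglongrightarrow> 2 * ?l" by (intro tendsto_mult 1 tendsto_const)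
  moreover have "2 * (\<Prod>k<n. 1 + (q\<^sup>2) ^ Suc k) = (\<Prod>k<Suc n. 1 + (q\<^sup>2) ^ k)" for n
    by (subst prod.lessThan_Suc_shift) simp
  ultimately have "(\<lambda>n. \<Prod>k<Suc n. 1 + (q\<^sup>2) ^ k) \<longlonglongrightarrow> 2 * ?l" by (simp only:)
  hence 2: "(\<lambda>n. \<Prod>k<n. 1 + (q\<^sup>2) ^ k) \<longlonglongrightarrow> 2 * ?l" by (rule LIMSEQ_imp_Suc)
  have "(1 + q * q ^ (2 * k + 1)) * (1 + q ^ (2 * k + 1) / q) = (1 + (q\<^sup>2) ^ Suc k) * (1 + (q\<^sup>2) ^ k)" for k
    using q by (simp add: power_mult power2_eq_square)
  hence L: "(\<lambda>n. \<Prod>k<n. (1 + q * q ^ (2 * k + 1)) * (1 + q ^ (2 * k + 1) / q)) \<longlonglongrightarrow> ?L"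
    using tendsto_mult[OF 1 2] by (simp only: prod.distrib) (simp add: power2_eq_square mult_ac)
  have nq: "norm q * norm q \<le> 1" using q by (simp add: mult_le_one)
  note J = jacobi_triple_product[OF q order_refl nq L]
  let ?f = "\<lambda>n::int. q ^ nat (n\<^sup>2 + n)"
  have e1: "?f (int (Suc i)) = q ^ (Suc i)\<^sup>2 * q ^ Suc i" for i
  proof -
    have "nat ((int (Suc i))\<^sup>2 + int (Suc i)) = (Suc i)\<^sup>2 + Suc i" by (metis nat_int of_nat_add of_nat_power)
    thus ?thesis by (simp only: power_add)
  qed
  have e2: "?f (- int (Suc i)) = q ^ (Suc i)\<^sup>2 * inverse q ^ Suc i" for i
  proof -
    have "nat ((- int (Suc i))\<^sup>2 + - int (Suc i)) = i * Suc i"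
    proof -
      have "(- int (Suc i))\<^sup>2 + - int (Suc i) = int (i * Suc i)" by (simp add: power2_eq_square algebra_simps)
      thus ?thesis by (simp only: nat_int)
    qed
    moreover have "(Suc i)\<^sup>2 = i * Suc i + Suc i" by (simp add: power2_eq_square)
    ultimately have "q ^ (Suc i)\<^sup>2 = ?f (- int (Suc i)) * q ^ Suc i" by (simp only: power_add)
    thus ?thesis using q by (simp add: field_simps)
  qed
  have "(?f has_sum (?f 0 + (euler_prod (q\<^sup>2) * ?L - 1))) UNIV \<and> (\<lambda>n. norm (?f n)) summable_on UNIV"
    by (intro conjI has_sum_int_from_nat; unfold e1 e2) (use J in \<open>simp_all only: distrib_left\<close>)
  moreover have "?f 0 + (euler_prod (q\<^sup>2) * ?L - 1) = 2 * psi (q\<^sup>2)"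
    using euler_prod_nonzero[OF q2] unfolding psi_def by (simp add: power_divide field_simps power2_eq_square)
  ultimately show "(?f has_sum (2 * psi (q\<^sup>2))) UNIV" "(\<lambda>n::int. norm (?f n)) summable_on UNIV" by (simp_all only:)
qed

lemma has_sum_Times:
  fixes f :: "'a \<Rightarrow> complex" and g :: "'b \<Rightarrow> complex"
  assumes f: "(f has_sum a) A" "(\<lambda>x. norm (f x)) summable_on A"
    and g: "(g has_sum b) B" "(\<lambda>x. norm (g x)) summable_on B"
  shows "((\<lambda>(x, y). f x * g y) has_sum (a * b)) (A \<times> B)"
proof (rule has_sum_SigmaI)
  show "((\<lambda>y. case (x, y) of (x, y) \<Rightarrow> f x * g y) has_sum (f x * b)) B" for x
    using has_sum_cmult_right[OF g(1), of "f x"] by simp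
  show "((\<lambda>x. f x * b) has_sum (a * b)) A" by (rule has_sum_cmult_left[OF f(1)])
  have "(\<lambda>p. norm (case p of (x, y) \<Rightarrow> f x * g y)) summable_on A \<times> B"
    unfolding Infinite_Sum.abs_summable_on_Sigma_iff
    using f(2) g(2) by (auto simp: norm_mult infsum_cmult_right' abs_mult intro!: summable_on_cmult_right summable_on_cmult_left)
  thus "(\<lambda>(x, y). f x * g y) summable_on A \<times> B" by (rule abs_summable_summable)
qed

text \<open>The pairs (m, n) are split by the parity of m + n and rotated. With (m, n) = (s + t, s -
  t) the form m^2 + n^2 becomes 2(s^2 + t^2); with (s + t + 1, s - t) it becomes 1 + 2(s^2 + s) +
  2(t^2 + t).\<close>

lemma phi_square_decomp:
  assumes q: "norm q < 1"
  shows "phi q ^ 2 = phi (q\<^sup>2) ^ 2 + 4 * q * psi (q ^ 4) ^ 2"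
proof (cases "q = 0")
  case False
  have q2: "norm (q\<^sup>2) < 1" "q\<^sup>2 \<noteq> 0" using norm_power_less_1[OF q, of 2] False by auto
  define h where "h = (\<lambda>(m::int, n::int). q ^ nat (m\<^sup>2) * q ^ nat (n\<^sup>2))"
  have h: "(h has_sum (phi q * phi q)) (UNIV \<times> UNIV)"
    using has_sum_Times[OF phi_has_sum[OF q False] phi_has_sum[OF q False]] unfolding h_def .
  let ?E = "{(m::int, n::int). even (m + n)}" and ?O = "{(m::int, n::int). odd (m + n)}"
  have "((\<lambda>(s, t). (q\<^sup>2) ^ nat (s\<^sup>2) * (q\<^sup>2) ^ nat (t\<^sup>2)) has_sum (phi (q\<^sup>2) * phi (q\<^sup>2))) (UNIV \<times> (UNIV :: int set))"
    by (rule has_sum_Times[OF phi_has_sum[OF q2] phi_has_sum[OF q2]])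
  moreover have "(h has_sum (phi (q\<^sup>2) * phi (q\<^sup>2))) ?E \<longleftrightarrow>
     ((\<lambda>(s, t). (q\<^sup>2) ^ nat (s\<^sup>2) * (q\<^sup>2) ^ nat (t\<^sup>2)) has_sum (phi (q\<^sup>2) * phi (q\<^sup>2))) (UNIV \<times> (UNIV :: int set))"
  proof (rule has_sum_reindex_bij_witness[of ?E "\<lambda>(s, t). (s + t, s - t)" "\<lambda>(m, n). ((m + n) div 2, (m - n) div 2)"])
    fix a assume "a \<in> ?E"
    then obtain m n where mn: "a = (m, n)" "even (m + n)" by auto
    then obtain s where s: "m + n = 2 * s" by (elim evenE)
    define t where "t = s - n"
    have m: "m = s + t" "n = s - t" using s by (auto simp: t_def)
    have "int (nat (m\<^sup>2) + nat (n\<^sup>2)) = int (2 * nat (s\<^sup>2) + 2 * nat (t\<^sup>2))"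
    proof -
      have "int (nat (m\<^sup>2) + nat (n\<^sup>2)) = m\<^sup>2 + n\<^sup>2" by simp
      also have "\<dots> = 2 * s\<^sup>2 + 2 * t\<^sup>2" by (simp add: m power2_eq_square algebra_simps)
      finally show ?thesis by simp
    qed
    hence "nat (m\<^sup>2) + nat (n\<^sup>2) = 2 * nat (s\<^sup>2) + 2 * nat (t\<^sup>2)" by (simp only: of_nat_eq_iff)
    hence "q ^ nat (m\<^sup>2) * q ^ nat (n\<^sup>2) = (q\<^sup>2) ^ nat (s\<^sup>2) * (q\<^sup>2) ^ nat (t\<^sup>2)"
      by (simp flip: power_add power_mult)
    thus "(case (case a of (m, n) \<Rightarrow> ((m + n) div 2, (m - n) div 2)) of (s, t) \<Rightarrow>
        (q\<^sup>2) ^ nat (s\<^sup>2) * (q\<^sup>2) ^ nat (t\<^sup>2)) = h a"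
      by (simp add: mn(1) m h_def)
    show "(case (case a of (m, n) \<Rightarrow> ((m + n) div 2, (m - n) div 2)) of (s, t) \<Rightarrow> (s + t, s - t)) = a"
      by (simp add: mn(1) m)
  qed auto
  ultimately have E: "(h has_sum (phi (q\<^sup>2) * phi (q\<^sup>2))) ?E" by blast
  have "((\<lambda>(s, t). (q\<^sup>2) ^ nat (s\<^sup>2 + s) * (q\<^sup>2) ^ nat (t\<^sup>2 + t)) has_sum (2 * psi ((q\<^sup>2)\<^sup>2) * (2 * psi ((q\<^sup>2)\<^sup>2)))) (UNIV \<times> (UNIV :: int set))"
    by (rule has_sum_Times[OF psi_has_sum[OF q2] psi_has_sum[OF q2]])
  from has_sum_cmult_right[OF this, of q]
  have "((\<lambda>(s, t). q * ((q\<^sup>2) ^ nat (s\<^sup>2 + s) * (q\<^sup>2) ^ nat (t\<^sup>2 + t))) has_sum (4 * q * psi (q ^ 4) ^ 2)) (UNIV \<times> (UNIV :: int set))"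
    by (simp add: case_prod_unfold power2_eq_square power4_eq_xxxx mult_ac)
  moreover have "(h has_sum (4 * q * psi (q ^ 4) ^ 2)) ?O \<longleftrightarrow>
     ((\<lambda>(s, t). q * ((q\<^sup>2) ^ nat (s\<^sup>2 + s) * (q\<^sup>2) ^ nat (t\<^sup>2 + t))) has_sum (4 * q * psi (q ^ 4) ^ 2)) (UNIV \<times> (UNIV :: int set))"
  proof (rule has_sum_reindex_bij_witness[of ?O "\<lambda>(s, t). (s + t + 1, s - t)" "\<lambda>(m, n). ((m + n - 1) div 2, (m - n - 1) div 2)"])
    fix a assume "a \<in> ?O"
    then obtain m n where mn: "a = (m, n)" "odd (m + n)" by auto
    then obtain s where s: "m + n = 2 * s + 1" by (elim oddE)
    define t where "t = s - n"
    have m: "m = s + t + 1" "n = s - t" using s by (auto simp: t_def)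
    have nn: "0 \<le> x\<^sup>2 + x" for x :: int
      using zero_le_mult_iff[of x "x + 1"] by (simp add: power2_eq_square distrib_left) presburger
    have "int (nat (m\<^sup>2) + nat (n\<^sup>2)) = int (1 + 2 * nat (s\<^sup>2 + s) + 2 * nat (t\<^sup>2 + t))"
    proof -
      have "int (nat (m\<^sup>2) + nat (n\<^sup>2)) = m\<^sup>2 + n\<^sup>2" by simp
      also have "\<dots> = 1 + 2 * (s\<^sup>2 + s) + 2 * (t\<^sup>2 + t)" by (simp add: m power2_eq_square algebra_simps)
      finally show ?thesis using nn[of s] nn[of t] by simp
    qed
    hence "nat (m\<^sup>2) + nat (n\<^sup>2) = 1 + 2 * nat (s\<^sup>2 + s) + 2 * nat (t\<^sup>2 + t)" by (simp only: of_nat_eq_iff)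
    hence "q ^ nat (m\<^sup>2) * q ^ nat (n\<^sup>2) = q * ((q\<^sup>2) ^ nat (s\<^sup>2 + s) * (q\<^sup>2) ^ nat (t\<^sup>2 + t))"
      by (simp add: power_add flip: power_add power_mult)
    thus "(case (case a of (m, n) \<Rightarrow> ((m + n - 1) div 2, (m - n - 1) div 2)) of (s, t) \<Rightarrow>
        q * ((q\<^sup>2) ^ nat (s\<^sup>2 + s) * (q\<^sup>2) ^ nat (t\<^sup>2 + t))) = h a"
      by (simp add: mn(1) m h_def)
    show "(case (case a of (m, n) \<Rightarrow> ((m + n - 1) div 2, (m - n - 1) div 2)) of (s, t) \<Rightarrow> (s + t + 1, s - t)) = a"
      by (simp add: mn(1) m)
  qed auto
  ultimately have O: "(h has_sum (4 * q * psi (q ^ 4) ^ 2)) ?O" by blast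
  have "(h has_sum (phi (q\<^sup>2) * phi (q\<^sup>2) + 4 * q * psi (q ^ 4) ^ 2)) (?E \<union> ?O)"
    by (rule has_sum_Un_disjoint[OF E O]) auto
  also have "?E \<union> ?O = UNIV \<times> UNIV" by auto
  finally show ?thesis using has_sum_unique[OF h] by (simp add: power2_eq_square)
qed simp

lemma phi_minus_square_decomp:
  assumes q: "norm q < 1"
  shows "phi_minus q ^ 2 = phi (q\<^sup>2) ^ 2 - 4 * q * psi (q ^ 4) ^ 2"
  using phi_square_decomp[of "- q"] q by (simp add: phi_minus_eq)

section \<open>Legendre's modular equation of degree 3\<close>

lemma holomorphic_on_power_arg:
  assumes "f holomorphic_on ball (0::complex) 1" "n > 0"
  shows "(\<lambda>q. f (q ^ n)) holomorphic_on ball 0 1"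
proof -
  have "(\<lambda>q::complex. q ^ n) ` ball 0 1 \<subseteq> ball 0 1" using assms(2) norm_power_less_1 by auto
  thus ?thesis using holomorphic_on_compose_gen[of "\<lambda>q. q ^ n" "ball 0 1" f "ball 0 1"] assms(1)
    by (simp add: comp_def holomorphic_intros)
qed

lemma
  shows phi_holomorphic: "phi holomorphic_on ball 0 1"
    and phi_minus_holomorphic: "phi_minus holomorphic_on ball 0 1"
    and psi_holomorphic: "psi holomorphic_on ball 0 1"
proof -
  note h = holomorphic_on_power_arg[OF euler_prod_holomorphic] euler_prod_holomorphic
  show "phi holomorphic_on ball 0 1" unfolding phi_def
    by (intro holomorphic_intros h) (auto simp: euler_prod_nonzero euler_prod_power_nonzero)
  show "phi_minus holomorphic_on ball 0 1" unfolding phi_minus_def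
    by (intro holomorphic_intros h) (auto simp: euler_prod_power_nonzero)
  show "psi holomorphic_on ball 0 1" unfolding psi_def
    by (intro holomorphic_intros h) (auto simp: euler_prod_nonzero)
qed

lemma phi_nonzero: "norm q < 1 \<Longrightarrow> phi q \<noteq> 0"
  and phi_minus_nonzero: "norm q < 1 \<Longrightarrow> phi_minus q \<noteq> 0"
  and psi_nonzero: "norm q < 1 \<Longrightarrow> psi q \<noteq> 0"
  by (simp_all add: phi_def phi_minus_def psi_def euler_prod_nonzero euler_prod_power_nonzero)

lemma theta_at_0 [simp]: "phi 0 = 1" "phi_minus 0 = 1" "psi 0 = 1"
  by (simp_all add: phi_def phi_minus_def psi_def)

lemma tendsto_power_arg:
  assumes "f holomorphic_on ball (0::complex) 1" "n > 0"
  shows "((\<lambda>q. f (q ^ n)) \<longlongrightarrow> f 0) (at 0)"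
proof -
  have "continuous_on (ball 0 1) (\<lambda>q. f (q ^ n))"
    by (intro holomorphic_on_imp_continuous_on holomorphic_on_power_arg assms)
  hence "isCont (\<lambda>q. f (q ^ n)) 0" by (simp add: continuous_on_eq_continuous_at)
  thus ?thesis using assms(2) by (simp add: isCont_def power_0_left)
qed

lemma theta_tendsto:
  assumes "n > 0"
  shows "((\<lambda>q. phi (q ^ n)) \<longlongrightarrow> 1) (at 0)" "((\<lambda>q. phi_minus (q ^ n)) \<longlongrightarrow> 1) (at 0)"
    "((\<lambda>q. psi (q ^ n)) \<longlongrightarrow> 1) (at 0)"
  using tendsto_power_arg[OF phi_holomorphic assms] tendsto_power_arg[OF phi_minus_holomorphic assms]
    tendsto_power_arg[OF psi_holomorphic assms] by simp_all

lemmas theta_tendsto' = theta_tendsto theta_tendsto[of 1, simplified]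

text \<open>Jacobi's identity for theta constants. The difference of fourth powers factors into 8q
  \<open>psi (q ^ 4) ^ 2\<close> and 2 \<open>phi (q\<^sup>2) ^ 2\<close>, both known from the
  duplication formulas.\<close>

lemma jacobi_quartic:
  assumes q: "norm q < 1"
  shows "phi q ^ 4 = phi_minus q ^ 4 + 16 * q * psi (q\<^sup>2) ^ 4"
proof -
  have "psi (q\<^sup>2) ^ 2 = phi (q\<^sup>2) * psi (q ^ 4)"
    using psi_square[OF norm_power_less_1[OF q, of 2]] by (simp flip: power_mult)
  hence e: "psi (q\<^sup>2) ^ 4 = (phi (q\<^sup>2) * psi (q ^ 4))\<^sup>2" by (metis mult_2 numeral_Bit0 power_add power2_eq_square)
  have "phi q ^ 4 - phi_minus q ^ 4 = (phi q ^ 2 - phi_minus q ^ 2) * (phi q ^ 2 + phi_minus q ^ 2)"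
    by (simp add: power2_eq_square power4_eq_xxxx algebra_simps)
  also have "\<dots> = 16 * q * psi (q\<^sup>2) ^ 4"
    unfolding phi_square_decomp[OF q] phi_minus_square_decomp[OF q] e by (simp add: algebra_simps power2_eq_square)
  finally show ?thesis by (simp add: algebra_simps)
qed

text \<open>The notation of the following algebra: \<open>a, b, s\<close> are the values of \<open>phi\<close>, \<open>phi_minus\<close> at \<open>Q\<close> and of
  \<open>psi\<close> at \<open>Q\<^sup>2\<close>; capitals are the values with \<open>Q\<close> replaced by \<open>Q\<^sup>3\<close>, and an index 2 replaces \<open>Q\<close> by \<open>Q\<^sup>2\<close>.\<close>

lemma duplication_relations:
  fixes Q :: complex
  assumes Q: "norm Q < 1"
  shows "phi Q ^ 2 = phi (Q\<^sup>2) ^ 2 + 4 * Q * psi (Q ^ 4) ^ 2"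
    "phi_minus Q ^ 2 = phi (Q\<^sup>2) ^ 2 - 4 * Q * psi (Q ^ 4) ^ 2"
    "psi (Q\<^sup>2) ^ 2 = phi (Q\<^sup>2) * psi (Q ^ 4)"
    "phi_minus (Q\<^sup>2) ^ 2 = phi Q * phi_minus Q"
    "phi (Q ^ 3) ^ 2 = phi (Q ^ 6) ^ 2 + 4 * Q ^ 3 * psi (Q ^ 12) ^ 2"
    "phi_minus (Q ^ 3) ^ 2 = phi (Q ^ 6) ^ 2 - 4 * Q ^ 3 * psi (Q ^ 12) ^ 2"
    "psi (Q ^ 6) ^ 2 = phi (Q ^ 6) * psi (Q ^ 12)"
    "phi_minus (Q ^ 6) ^ 2 = phi (Q ^ 3) * phi_minus (Q ^ 3)"
proof -
  have n: "norm (Q ^ 3) < 1" "norm (Q\<^sup>2) < 1" "norm (Q ^ 6) < 1" using norm_power_less_1[OF Q] by simp_all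
  show "phi Q ^ 2 = phi (Q\<^sup>2) ^ 2 + 4 * Q * psi (Q ^ 4) ^ 2" "phi_minus Q ^ 2 = phi (Q\<^sup>2) ^ 2 - 4 * Q * psi (Q ^ 4) ^ 2"
    "phi_minus (Q\<^sup>2) ^ 2 = phi Q * phi_minus Q"
    by (rule phi_square_decomp[OF Q] phi_minus_square_decomp[OF Q] phi_minus_square[OF Q])+
  show "psi (Q\<^sup>2) ^ 2 = phi (Q\<^sup>2) * psi (Q ^ 4)" "psi (Q ^ 6) ^ 2 = phi (Q ^ 6) * psi (Q ^ 12)"
    using psi_square[OF n(2)] psi_square[OF n(3)] by (simp_all flip: power_mult)
  show "phi (Q ^ 3) ^ 2 = phi (Q ^ 6) ^ 2 + 4 * Q ^ 3 * psi (Q ^ 12) ^ 2" 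
    "phi_minus (Q ^ 3) ^ 2 = phi (Q ^ 6) ^ 2 - 4 * Q ^ 3 * psi (Q ^ 12) ^ 2"
    "phi_minus (Q ^ 6) ^ 2 = phi (Q ^ 3) * phi_minus (Q ^ 3)"
    using phi_square_decomp[OF n(1)] phi_minus_square_decomp[OF n(1)] phi_minus_square[OF n(1)] by (simp_all flip: power_mult)
qed

section \<open>Iteration of the squaring map\<close>

lemma power_two_power_tendsto_0: "(\<lambda>n. (Q::complex) ^ (2 ^ n)) \<longlonglongrightarrow> 0" if "norm Q < 1"
  using filterlim_compose[OF LIMSEQ_power_zero[OF that] filterlim_subseq[of "\<lambda>n. 2 ^ n :: nat"]]
  by (simp add: strict_mono_def)

lemma power_two_power_norm_le: "norm ((Q::complex) ^ (2 ^ n)) \<le> norm Q" if "norm Q < 1"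
  using power_decreasing[of 1 "2 ^ n" "norm Q"] that by (simp add: norm_power)

text \<open>G is constant along Q, Q^2, Q^4, ..., an orbit that tends to 0 without reaching it; r
  \<le> 1 keeps the orbit inside the disc.\<close>

lemma square_invariant_const:
  fixes G :: "complex \<Rightarrow> complex"
  assumes lim: "(G \<longlongrightarrow> c) (at 0)" and inv: "\<And>Q. 0 < norm Q \<Longrightarrow> norm Q < r \<Longrightarrow> G Q = G (Q\<^sup>2)"
    and r: "r \<le> 1" and Q: "0 < norm Q" "norm Q < r"
  shows "G Q = c"
proof -
  have e: "G (Q ^ (2 ^ n)) = G Q" for n
  proof (induction n)
    case (Suc n)
    have "norm (Q ^ (2 ^ n)) < r" using power_two_power_norm_le[of Q n] Q r by linarith
    hence "G (Q ^ (2 ^ n)) = G ((Q ^ (2 ^ n))\<^sup>2)" using Q by (intro inv) auto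
    thus ?case using Suc by (simp add: power_mult[symmetric] mult.commute)
  qed simp
  have "filterlim (\<lambda>n. Q ^ (2 ^ n)) (at 0) sequentially"
    unfolding filterlim_at using power_two_power_tendsto_0[of Q] Q r by auto
  from filterlim_compose[OF lim this] have "(\<lambda>n. G Q) \<longlonglongrightarrow> c" unfolding e .
  thus ?thesis by (simp add: LIMSEQ_const_iff)
qed

text \<open>The defect \<open>Q \<lambda>(Q)\<close> satisfies \<open>|\<lambda>(Q)| \<le> (6/7) |\<lambda>(Q\<^sup>2)|\<close>
  near 0, hence vanishes.\<close>

lemma legendre_cubic:
  "\<exists>r>0. r \<le> 1 \<and> (\<forall>Q. norm Q < r \<longrightarrow>
     phi Q * phi (Q ^ 3) = phi_minus Q * phi_minus (Q ^ 3) + 4 * Q * psi (Q\<^sup>2) * psi (Q ^ 6))"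
proof -
  \<comment> \<open>\<open>H\<close> is the difference of the two phi products divided by Q, in a
    form with a visible limit, 4, at 0. The division by Q is essential: the conjugate factor, with
    +4Q in place of -4Q, vanishes at 0 too, and only after the division is it bounded away from
    0.\<close>
  define H where "H = (\<lambda>Q. 8 * psi (Q ^ 4) ^ 2 * phi (Q ^ 3) / (phi Q + phi_minus Q)
     + 8 * Q\<^sup>2 * phi_minus Q * psi (Q ^ 12) ^ 2 / (phi (Q ^ 3) + phi_minus (Q ^ 3)))"
  define l where "l = (\<lambda>Q. H Q - 4 * psi (Q\<^sup>2) * psi (Q ^ 6))"
  define k where "k = (\<lambda>Q. phi (Q\<^sup>2) * phi (Q ^ 6) - 4 * Q\<^sup>2 * psi (Q ^ 4) * psi (Q ^ 12) + phi_minus (Q\<^sup>2) * phi_minus (Q ^ 6))"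
  have "(H \<longlongrightarrow> 8 * 1 ^ 2 * 1 / (1 + 1) + 8 * 0\<^sup>2 * 1 * 1 ^ 2 / (1 + 1)) (at 0)"
    unfolding H_def by (intro tendsto_intros theta_tendsto') auto
  hence H: "(H \<longlongrightarrow> 4) (at 0)" by simp
  have "(l \<longlongrightarrow> 4 - 4 * 1 * 1) (at 0)" unfolding l_def by (intro tendsto_intros H theta_tendsto') auto
  hence l0: "(l \<longlongrightarrow> 0) (at 0)" by simp
  have "((\<lambda>Q. H Q + 4 * psi (Q\<^sup>2) * psi (Q ^ 6)) \<longlongrightarrow> 4 + 4 * 1 * 1) (at 0)" by (intro tendsto_intros H theta_tendsto') auto
  hence h0: "((\<lambda>Q. norm (H Q + 4 * psi (Q\<^sup>2) * psi (Q ^ 6))) \<longlongrightarrow> 8) (at 0)"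
    using tendsto_norm by fastforce
  have "(k \<longlongrightarrow> 1 * 1 - 4 * 0\<^sup>2 * 1 * 1 + 1 * 1) (at 0)" unfolding k_def by (intro tendsto_intros theta_tendsto') auto
  hence k0: "((\<lambda>Q. norm (k Q)) \<longlongrightarrow> 2) (at 0)" using tendsto_norm by fastforce
  have pp: "((\<lambda>Q. phi Q + phi_minus Q) \<longlongrightarrow> 1 + 1) (at 0)" "((\<lambda>Q. phi (Q ^ 3) + phi_minus (Q ^ 3)) \<longlongrightarrow> 1 + 1) (at 0)"
    by (intro tendsto_intros theta_tendsto'; simp)+
  have "\<forall>\<^sub>F Q in at 0. norm (l Q) < 1 \<and> norm (H Q + 4 * psi (Q\<^sup>2) * psi (Q ^ 6)) > 7 \<and> norm (k Q) < 3 \<and>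
     phi Q + phi_minus Q \<noteq> 0 \<and> phi (Q ^ 3) + phi_minus (Q ^ 3) \<noteq> 0"
    using tendsto_norm[OF l0] by (intro eventually_conj order_tendstoD[OF h0] order_tendstoD[OF k0] 
       tendsto_imp_eventually_ne[OF pp(1)] tendsto_imp_eventually_ne[OF pp(2)]) (auto dest: order_tendstoD(2)[where a = 1])
  then obtain d where d: "d > 0" "\<And>Q. Q \<noteq> 0 \<Longrightarrow> norm Q < d \<Longrightarrow> norm (l Q) < 1 \<and> norm (H Q + 4 * psi (Q\<^sup>2) * psi (Q ^ 6)) > 7 \<and> norm (k Q) < 3 \<and>
     phi Q + phi_minus Q \<noteq> 0 \<and> phi (Q ^ 3) + phi_minus (Q ^ 3) \<noteq> 0"
    unfolding eventually_at by (auto simp: dist_norm)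
  define r where "r = min d 1"
  have r: "r > 0" "r \<le> 1" "r \<le> d" using d by (auto simp: r_def)
  have leg: "phi Q * phi (Q ^ 3) - phi_minus Q * phi_minus (Q ^ 3) = Q * H Q" if Q: "norm Q < r" "Q \<noteq> 0" for Q
  proof -
    have "norm Q < 1" using Q r by simp
    note D = duplication_relations[OF this]
    have "phi Q + phi_minus Q \<noteq> 0" "phi (Q ^ 3) + phi_minus (Q ^ 3) \<noteq> 0" using d(2)[of Q] Q r by auto
    moreover have "(phi Q - phi_minus Q) * (phi Q + phi_minus Q) = 8 * Q * psi (Q ^ 4) ^ 2" using D(1,2) by algebra
    moreover have "(phi (Q ^ 3) - phi_minus (Q ^ 3)) * (phi (Q ^ 3) + phi_minus (Q ^ 3)) = 8 * Q ^ 3 * psi (Q ^ 12) ^ 2"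
      using D(5,6) by algebra
    ultimately have e: "phi Q - phi_minus Q = 8 * Q * psi (Q ^ 4) ^ 2 / (phi Q + phi_minus Q)"
       "phi (Q ^ 3) - phi_minus (Q ^ 3) = 8 * Q ^ 3 * psi (Q ^ 12) ^ 2 / (phi (Q ^ 3) + phi_minus (Q ^ 3))"
      by (simp_all add: nonzero_eq_divide_eq)
    have "phi Q * phi (Q ^ 3) - phi_minus Q * phi_minus (Q ^ 3) =
        (phi Q - phi_minus Q) * phi (Q ^ 3) + phi_minus Q * (phi (Q ^ 3) - phi_minus (Q ^ 3))" by algebra
    also have "\<dots> = Q * H Q" unfolding e H_def by (simp add: power2_eq_square power3_eq_cube distrib_left mult_ac)
    finally show ?thesis .
  qed
  have step: "norm (l Q) \<le> 6 / 7 * norm (l (Q\<^sup>2))" if Q: "norm Q < r" "Q \<noteq> 0" for Q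
  proof -
    have Q1: "norm Q < 1" using Q r by simp
    note D = duplication_relations[OF Q1]
    have n2: "norm (Q\<^sup>2) < r" using Q r power_two_power_norm_le[OF Q1, of 1] by simp
    have a1: "phi Q * phi (Q ^ 3) - phi_minus Q * phi_minus (Q ^ 3) - 4 * Q * psi (Q\<^sup>2) * psi (Q ^ 6) = Q * l Q"
      using leg[OF Q] unfolding l_def by (simp add: algebra_simps)
    have a2: "phi (Q\<^sup>2) * phi (Q ^ 6) - phi_minus (Q\<^sup>2) * phi_minus (Q ^ 6) - 4 * Q\<^sup>2 * psi (Q ^ 4) * psi (Q ^ 12) = Q\<^sup>2 * l (Q\<^sup>2)"
      using leg[OF n2] Q unfolding l_def by (simp add: algebra_simps flip: power_mult)
    define a b s A B S a2 b2 s2 A2 B2 S2 where defs: "a = phi Q" "b = phi_minus Q" "s = psi (Q\<^sup>2)"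
      "A = phi (Q ^ 3)" "B = phi_minus (Q ^ 3)" "S = psi (Q ^ 6)"
      "a2 = phi (Q\<^sup>2)" "b2 = phi_minus (Q\<^sup>2)" "s2 = psi (Q ^ 4)"
      "A2 = phi (Q ^ 6)" "B2 = phi_minus (Q ^ 6)" "S2 = psi (Q ^ 12)"
    \<comment> \<open>The duplication formulas turn a difference of squares at Q into twice a
      difference of squares at Q^2. Factoring both sides relates the defect at Q to the defect at
      Q^2.\<close>
    have "(a * A - b * B)\<^sup>2 - (4 * Q * s * S)\<^sup>2 = a\<^sup>2 * A\<^sup>2 + b\<^sup>2 * B\<^sup>2 - 2 * (a * b) * (A * B) - 16 * Q\<^sup>2 * s\<^sup>2 * S\<^sup>2" by algebra
    also have "\<dots> = 2 * ((a2 * A2 - 4 * Q\<^sup>2 * s2 * S2)\<^sup>2 - (b2 * B2)\<^sup>2)"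
      unfolding D[folded defs] power_mult_distrib[of b2 B2] by algebra
    finally have "(a * A - b * B - 4 * Q * s * S) * (a * A - b * B + 4 * Q * s * S)
        = 2 * (a2 * A2 - b2 * B2 - 4 * Q\<^sup>2 * s2 * S2) * (a2 * A2 - 4 * Q\<^sup>2 * s2 * S2 + b2 * B2)" by algebra
    moreover have "a * A - b * B + 4 * Q * s * S = Q * (H Q + 4 * s * S)"
      using leg[OF Q] unfolding defs by (simp add: algebra_simps)
    ultimately have "(Q * l Q) * (Q * (H Q + 4 * psi (Q\<^sup>2) * psi (Q ^ 6))) = 2 * (Q\<^sup>2 * l (Q\<^sup>2)) * k Q"
      using a1 a2 unfolding k_def defs by simp
    hence "Q\<^sup>2 * (l Q * (H Q + 4 * psi (Q\<^sup>2) * psi (Q ^ 6))) = Q\<^sup>2 * (2 * l (Q\<^sup>2) * k Q)" by (simp add: power2_eq_square mult_ac)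
    hence "l Q * (H Q + 4 * psi (Q\<^sup>2) * psi (Q ^ 6)) = 2 * l (Q\<^sup>2) * k Q" using Q by simp
    hence "norm (l Q) * norm (H Q + 4 * psi (Q\<^sup>2) * psi (Q ^ 6)) = 2 * norm (l (Q\<^sup>2)) * norm (k Q)"
      by (metis norm_mult norm_numeral)
    \<comment> \<open>The two cofactors tend to 8 and 2, so the limiting ratio is 2 * 2 / 8. The
      bounds 7 and 3 leave some room and still give 2 * 3 / 7 < 1.\<close>
    moreover have "norm (l Q) * 7 \<le> norm (l Q) * norm (H Q + 4 * psi (Q\<^sup>2) * psi (Q ^ 6))"
      using d(2)[of Q] Q r by (intro mult_left_mono) auto
    moreover have "2 * norm (l (Q\<^sup>2)) * norm (k Q) \<le> 2 * norm (l (Q\<^sup>2)) * 3"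
      using d(2)[of Q] Q r by (intro mult_left_mono) auto
    ultimately show ?thesis by linarith
  qed
  have "l Q = 0" if Q: "norm Q < r" "Q \<noteq> 0" for Q
  proof -
    have Q1: "norm Q < 1" using Q r by simp
    have nr: "norm (Q ^ (2 ^ n)) < r" for n using power_two_power_norm_le[OF Q1, of n] Q by simp
    have "norm (l Q) \<le> (6 / 7) ^ n * norm (l (Q ^ (2 ^ n)))" for n
    proof (induction n)
      case (Suc n)
      have "norm (l (Q ^ (2 ^ n))) \<le> 6 / 7 * norm (l ((Q ^ (2 ^ n))\<^sup>2))" by (rule step[OF nr]) (use Q in simp)
      also have "(Q ^ (2 ^ n))\<^sup>2 = Q ^ (2 ^ Suc n)" by (simp add: power_mult[symmetric] mult.commute)
      finally have "(6 / 7) ^ n * norm (l (Q ^ (2 ^ n))) \<le> (6 / 7) ^ n * (6 / 7 * norm (l (Q ^ (2 ^ Suc n))))"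
        by (intro mult_left_mono) auto
      with Suc have "norm (l Q) \<le> (6 / 7) ^ n * (6 / 7 * norm (l (Q ^ (2 ^ Suc n))))" by (rule order_trans)
      thus ?case by (simp only: power_Suc2 mult.assoc)
    qed simp
    moreover have "(6 / 7) ^ n * norm (l (Q ^ (2 ^ n))) \<le> (6 / 7) ^ n * 1" for n
      using d(2)[of "Q ^ (2 ^ n)"] nr[of n] r Q by (intro mult_left_mono) auto
    ultimately have "norm (l Q) \<le> (6 / 7) ^ n * 1" for n by (rule order_trans)
    hence le: "norm (l Q) \<le> (6 / 7) ^ n" for n by simp
    have "(\<lambda>n. (6 / 7 :: real) ^ n) \<longlonglongrightarrow> 0" by (rule LIMSEQ_power_zero) simp
    from LIMSEQ_le_const[OF this, of "norm (l Q)"] le show ?thesis by auto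
  qed
  hence "phi Q * phi (Q ^ 3) = phi_minus Q * phi_minus (Q ^ 3) + 4 * Q * psi (Q\<^sup>2) * psi (Q ^ 6)" if "norm Q < r" for Q
    using leg[of Q] that unfolding l_def by (cases "Q = 0") (auto simp: algebra_simps)
  thus ?thesis using r by blast
qed

section \<open>Relations of level 6\<close>

text \<open>The quotient of the two sides is invariant under \<open>Q \<mapsto> Q\<^sup>2\<close> and tends to 1 at 0.\<close>

lemma cubic_multiplier_relation:
  "\<exists>r>0. r \<le> 1 \<and> (\<forall>Q. 0 < norm Q \<and> norm Q < r \<longrightarrow>
     phi Q * phi_minus Q * phi_minus (Q ^ 3) * psi (Q\<^sup>2) =
       phi (Q ^ 3) ^ 3 * psi (Q\<^sup>2) - 4 * Q\<^sup>2 * phi Q * psi (Q ^ 6) ^ 3)"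
proof -
  obtain r0 where r0: "r0 > 0" "r0 \<le> 1" and leg: "\<And>Q. norm Q < r0 \<Longrightarrow>
     phi Q * phi (Q ^ 3) = phi_minus Q * phi_minus (Q ^ 3) + 4 * Q * psi (Q\<^sup>2) * psi (Q ^ 6)"
    using legendre_cubic by blast
  \<comment> \<open>Divided by \<open>phi Q * psi (Q\<^sup>2)\<close>, the claim has the shape of a
    cubic theta identity: \<open>phi (Q ^ 3) ^ 3 / phi Q\<close> minus 4Q^2 times
    \<open>psi (Q ^ 6) ^ 3 / psi (Q\<^sup>2)\<close> equals
    \<open>phi_minus Q * phi_minus (Q ^ 3)\<close>.\<close>
  define D where "D = (\<lambda>Q. phi (Q ^ 3) ^ 3 * psi (Q\<^sup>2) - 4 * Q\<^sup>2 * phi Q * psi (Q ^ 6) ^ 3)"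
  define \<rho> where "\<rho> = (\<lambda>Q. phi Q * phi_minus Q * phi_minus (Q ^ 3) * psi (Q\<^sup>2) / D Q)"
  have "(D \<longlongrightarrow> 1 ^ 3 * 1 - 4 * 0\<^sup>2 * 1 * 1 ^ 3) (at 0)" unfolding D_def by (intro tendsto_intros theta_tendsto') auto
  hence D: "(D \<longlongrightarrow> 1) (at 0)" by simp
  have "(\<rho> \<longlongrightarrow> 1 * 1 * 1 * 1 / 1) (at 0)" unfolding \<rho>_def by (intro tendsto_intros theta_tendsto' D) auto
  hence lim: "(\<rho> \<longlongrightarrow> 1) (at 0)" by simp
  have "\<forall>\<^sub>F Q in at 0. D Q \<noteq> 0" by (rule tendsto_imp_eventually_ne[OF D]) simp
  then obtain d where d: "d > 0" "\<And>Q. Q \<noteq> 0 \<Longrightarrow> norm Q < d \<Longrightarrow> D Q \<noteq> 0"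
    unfolding eventually_at by (auto simp: dist_norm)
  define r where "r = min d r0"
  have r: "r > 0" "r \<le> 1" "r \<le> r0" "r \<le> d" using d r0 by (auto simp: r_def)
  have inv: "\<rho> Q = \<rho> (Q\<^sup>2)" if Q: "0 < norm Q" "norm Q < r" for Q
  proof -
    have Q1: "norm Q < 1" using Q r by simp
    have n2: "norm (Q\<^sup>2) < r" using Q r power_two_power_norm_le[OF Q1, of 1] by simp
    have pw: "(Q\<^sup>2) ^ 3 = Q ^ 6" "(Q\<^sup>2)\<^sup>2 = Q ^ 4" "(Q\<^sup>2) ^ 6 = Q ^ 12" by (simp_all flip: power_mult)
    have L1: "phi Q * phi (Q ^ 3) = phi_minus Q * phi_minus (Q ^ 3) + 4 * Q * psi (Q\<^sup>2) * psi (Q ^ 6)"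
      using leg[of Q] Q r by simp
    have L2: "phi (Q\<^sup>2) * phi (Q ^ 6) = phi_minus (Q\<^sup>2) * phi_minus (Q ^ 6) + 4 * Q\<^sup>2 * psi (Q ^ 4) * psi (Q ^ 12)"
      using leg[of "Q\<^sup>2"] n2 r unfolding pw by simp
    define a b s A B S a2 b2 s2 A2 B2 S2 where defs: "a = phi Q" "b = phi_minus Q" "s = psi (Q\<^sup>2)"
      "A = phi (Q ^ 3)" "B = phi_minus (Q ^ 3)" "S = psi (Q ^ 6)"
      "a2 = phi (Q\<^sup>2)" "b2 = phi_minus (Q\<^sup>2)" "s2 = psi (Q ^ 4)"
      "A2 = phi (Q ^ 6)" "B2 = phi_minus (Q ^ 6)" "S2 = psi (Q ^ 12)"
    note R = duplication_relations[OF Q1, folded defs]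
    have L1': "a * A = b * B + 4 * Q * s * S" and L2': "b2 * B2 = a2 * A2 - 4 * Q\<^sup>2 * s2 * S2"
      using L1 L2 unfolding defs by simp_all
    have D1: "D Q = A ^ 3 * s - 4 * Q\<^sup>2 * a * S ^ 3" unfolding D_def defs ..
    have D2: "D (Q\<^sup>2) = A2 ^ 3 * s2 - 4 * Q ^ 4 * a2 * S2 ^ 3" unfolding D_def defs pw ..
    \<comment> \<open>Legendre's equation enters twice: at Q it replaces 4QsS by aA - bB, and at Q^2
      it supplies the value of the product b2 B2.\<close>
    have key: "A * s * D Q = D (Q\<^sup>2) * (b2 * B2)"
    proof -
      have "A * s * D Q = (A\<^sup>2)\<^sup>2 * s\<^sup>2 - Q * S\<^sup>2 * (a * A * (4 * Q * s * S))"
        unfolding D1 by algebra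
      also have "4 * Q * s * S = a * A - b * B" using L1' by simp
      also have "a * A * (a * A - b * B) = a\<^sup>2 * A\<^sup>2 - (a * b) * (A * B)" by algebra
      also have "\<dots> = a\<^sup>2 * A\<^sup>2 - (b2 * B2)\<^sup>2" using R(4,8) by (simp add: power_mult_distrib)
      finally show ?thesis unfolding D2 L2' R(1,3,5,7) by algebra
    qed
    have nz: "a * b * A * B * s * b2 * B2 \<noteq> 0"
      unfolding defs using Q1 by (simp add: phi_nonzero phi_minus_nonzero psi_nonzero norm_power_less_1)
    have Dnz: "D Q \<noteq> 0" "D (Q\<^sup>2) \<noteq> 0" using d(2)[of Q] d(2)[of "Q\<^sup>2"] Q n2 r by auto
    have "(a * b * B * s * D (Q\<^sup>2)) * (b2 * B2) = (a * b * B * s) * (A * s * D Q)" unfolding key by algebra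
    also have "\<dots> = (a * b) * (A * B) * s\<^sup>2 * D Q" by algebra
    also have "\<dots> = (a2 * b2 * B2 * s2 * D Q) * (b2 * B2)" unfolding R(4)[symmetric] R(8)[symmetric] R(3) by algebra
    finally have "a * b * B * s * D (Q\<^sup>2) = a2 * b2 * B2 * s2 * D Q" using nz by simp
    thus ?thesis unfolding \<rho>_def pw defs[symmetric] using Dnz by (simp add: frac_eq_eq)
  qed
  have "\<rho> Q = 1" if "0 < norm Q" "norm Q < r" for Q
    by (rule square_invariant_const[OF lim inv r(2) that])
  hence "phi Q * phi_minus Q * phi_minus (Q ^ 3) * psi (Q\<^sup>2) = D Q" if "0 < norm Q" "norm Q < r" for Q
    using that d(2)[of Q] r unfolding \<rho>_def by auto
  thus ?thesis using r unfolding D_def by blast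
qed

text \<open>w is a Hauptmodul for \<Gamma>_0(6), N carries the weight 2, and v is the square root of
  w(Q^2) that is singled out by the theta quotient.\<close>

definition w_fun :: "complex \<Rightarrow> complex" where "w_fun Q = Q * psi (Q ^ 3) ^ 4 / psi Q ^ 4"
definition N_fun :: "complex \<Rightarrow> complex" where "N_fun Q = psi Q ^ 6 / psi (Q ^ 3) ^ 2"
definition v_fun :: "complex \<Rightarrow> complex" where "v_fun Q = Q * psi (Q ^ 6) ^ 2 / psi (Q\<^sup>2) ^ 2"
text \<open>The logarithmic derivative of E(Q^n), E the Euler product, contains the factor n. Hence
  the coefficients -1, 2, -3, 6 of P in 4Z lead to the exponents -6, 6, -6, 6 at levels 1, 2, 3,
  6.\<close>

definition u_fun :: "complex \<Rightarrow> complex" where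
  "u_fun Q = Q * (euler_prod (Q\<^sup>2) * euler_prod (Q ^ 6) / (euler_prod Q * euler_prod (Q ^ 3))) ^ 6"

lemma v_fun_tendsto: "(v_fun \<longlongrightarrow> 0) (at 0)"
proof -
  have "(v_fun \<longlongrightarrow> 0 * 1 ^ 2 / 1 ^ 2) (at 0)" unfolding v_fun_def by (intro tendsto_intros theta_tendsto') auto
  thus ?thesis by simp
qed

lemma w_fun_square: "w_fun (Q\<^sup>2) = v_fun Q ^ 2"
  unfolding w_fun_def v_fun_def by (simp add: power_mult_distrib power_divide flip: power_mult)

text \<open>All four statements follow once the ratio of \<open>phi Q\<close> to
  \<open>phi (Q ^ 3)\<close> is known as a function of v. It is found from Legendre's equation, the
  cubic relation just proved and Jacobi's quartic identity at Q and Q^3.\<close>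

lemma level_six_relations:
  "\<exists>r>0. r \<le> 1 \<and> (\<forall>Q. 0 < norm Q \<and> norm Q < r \<longrightarrow>
     w_fun Q = R_map (v_fun Q) \<and> N_fun Q = (1 + 3 * v_fun Q)\<^sup>2 * N_fun (Q\<^sup>2) \<and>
     u_fun Q * ((1 - w_fun Q) * (1 - 9 * w_fun Q)) = w_fun Q \<and>
     Q * (euler_prod Q * euler_prod (Q\<^sup>2) * euler_prod (Q ^ 3) * euler_prod (Q ^ 6))\<^sup>2 = (N_fun Q)\<^sup>2 * p_cubic (w_fun Q))"
proof -
  obtain r0 where r0: "r0 > 0" "r0 \<le> 1" and leg: "\<And>Q. norm Q < r0 \<Longrightarrow>
     phi Q * phi (Q ^ 3) = phi_minus Q * phi_minus (Q ^ 3) + 4 * Q * psi (Q\<^sup>2) * psi (Q ^ 6)"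
    using legendre_cubic by blast
  obtain r1 where r1: "r1 > 0" "r1 \<le> 1" and rho: "\<And>Q. 0 < norm Q \<Longrightarrow> norm Q < r1 \<Longrightarrow>
     phi Q * phi_minus Q * phi_minus (Q ^ 3) * psi (Q\<^sup>2) =
       phi (Q ^ 3) ^ 3 * psi (Q\<^sup>2) - 4 * Q\<^sup>2 * phi Q * psi (Q ^ 6) ^ 3"
    using cubic_multiplier_relation by blast
  have t1: "((\<lambda>Q. psi (Q\<^sup>2) ^ 2 - Q * psi (Q ^ 6) ^ 2) \<longlongrightarrow> 1 ^ 2 - 0 * 1 ^ 2) (at 0)"
    and t2: "((\<lambda>Q. psi (Q\<^sup>2) ^ 2 + 3 * Q * psi (Q ^ 6) ^ 2) \<longlongrightarrow> 1 ^ 2 + 3 * 0 * 1 ^ 2) (at 0)"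
    and t3: "((\<lambda>Q. phi (Q ^ 3) ^ 2 * psi (Q\<^sup>2) ^ 2 - Q * phi Q ^ 2 * psi (Q ^ 6) ^ 2) \<longlongrightarrow> 1 ^ 2 * 1 ^ 2 - 0 * 1 ^ 2 * 1 ^ 2) (at 0)"
    by (intro tendsto_intros theta_tendsto'; simp)+
  have "\<forall>\<^sub>F Q in at 0. psi (Q\<^sup>2) ^ 2 - Q * psi (Q ^ 6) ^ 2 \<noteq> 0 \<and> psi (Q\<^sup>2) ^ 2 + 3 * Q * psi (Q ^ 6) ^ 2 \<noteq> 0 \<and>
     phi (Q ^ 3) ^ 2 * psi (Q\<^sup>2) ^ 2 - Q * phi Q ^ 2 * psi (Q ^ 6) ^ 2 \<noteq> 0"
    by (intro eventually_conj tendsto_imp_eventually_ne[OF t1] tendsto_imp_eventually_ne[OF t2] tendsto_imp_eventually_ne[OF t3]) auto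
  then obtain d where d: "d > 0" "\<And>Q. Q \<noteq> 0 \<Longrightarrow> norm Q < d \<Longrightarrow> psi (Q\<^sup>2) ^ 2 - Q * psi (Q ^ 6) ^ 2 \<noteq> 0 \<and> psi (Q\<^sup>2) ^ 2 + 3 * Q * psi (Q ^ 6) ^ 2 \<noteq> 0 \<and>
     phi (Q ^ 3) ^ 2 * psi (Q\<^sup>2) ^ 2 - Q * phi Q ^ 2 * psi (Q ^ 6) ^ 2 \<noteq> 0"
    unfolding eventually_at by (auto simp: dist_norm)
  define r where "r = min d (min r0 r1)"
  have r: "r > 0" "r \<le> 1" "r \<le> r0" "r \<le> d" "r \<le> r1" using d r0 r1 by (auto simp: r_def)
  have "w_fun Q = R_map (v_fun Q) \<and> N_fun Q = (1 + 3 * v_fun Q)\<^sup>2 * N_fun (Q\<^sup>2) \<and>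
     u_fun Q * ((1 - w_fun Q) * (1 - 9 * w_fun Q)) = w_fun Q \<and>
     Q * (euler_prod Q * euler_prod (Q\<^sup>2) * euler_prod (Q ^ 3) * euler_prod (Q ^ 6))\<^sup>2 = (N_fun Q)\<^sup>2 * p_cubic (w_fun Q)"
    if Q: "0 < norm Q" "norm Q < r" for Q
  proof -
    have Q1: "norm Q < 1" using Q r by simp
    have Q3: "norm (Q ^ 3) < 1" using norm_power_less_1[OF Q1, of 3] by simp
    define a b s A B S where defs: "a = phi Q" "b = phi_minus Q" "s = psi (Q\<^sup>2)"
      "A = phi (Q ^ 3)" "B = phi_minus (Q ^ 3)" "S = psi (Q ^ 6)"
    have nz: "a \<noteq> 0" "b \<noteq> 0" "s \<noteq> 0" "A \<noteq> 0" "B \<noteq> 0" "S \<noteq> 0" "Q \<noteq> 0"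
      unfolding defs using Q1 Q by (auto simp: phi_nonzero phi_minus_nonzero psi_nonzero norm_power_less_1)
    have L: "a * A = b * B + 4 * Q * s * S" using leg[of Q] Q r unfolding defs by simp
    have rh: "a * b * B * s = A ^ 3 * s - 4 * Q\<^sup>2 * a * S ^ 3" using rho[of Q] Q r unfolding defs by simp
    have p1: "psi Q ^ 2 = a * s" using psi_square[OF Q1] unfolding defs .
    have p3: "psi (Q ^ 3) ^ 2 = A * S" using psi_square[OF Q3] unfolding defs by (simp flip: power_mult)
    have j1: "a ^ 4 = b ^ 4 + 16 * Q * s ^ 4" using jacobi_quartic[OF Q1] unfolding defs .
    have j3: "A ^ 4 = B ^ 4 + 16 * Q ^ 3 * S ^ 4" using jacobi_quartic[OF Q3] unfolding defs by (simp flip: power_mult)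
    define M where "M = s\<^sup>2 - Q * S\<^sup>2"
    define W where "W = A\<^sup>2 * s\<^sup>2 - Q * a\<^sup>2 * S\<^sup>2"
    have MW: "M \<noteq> 0" "s\<^sup>2 + 3 * Q * S\<^sup>2 \<noteq> 0" "W \<noteq> 0" using d(2)[of Q] Q r unfolding M_def W_def defs by auto
    have bB: "b * B = a * A - 4 * Q * s * S" using L by simp
    \<comment> \<open>The fourth power of Legendre's equation, with b^4 and B^4 eliminated by
      Jacobi's quartic identity.\<close>
    have quart: "a * A * s * S * (b * B)\<^sup>2 = W\<^sup>2"
    proof -
      have "(a * A - 4 * Q * s * S) ^ 4 = b ^ 4 * B ^ 4" unfolding bB[symmetric] by (rule power_mult_distrib)
      also have "\<dots> = (a ^ 4 - 16 * Q * s ^ 4) * (A ^ 4 - 16 * Q ^ 3 * S ^ 4)" using j1 j3 by simp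
      finally have "(16 * Q) * (a * A * s * S * (a * A - 4 * Q * s * S)\<^sup>2) = (16 * Q) * W\<^sup>2"
        unfolding W_def by algebra
      thus ?thesis unfolding bB using nz by simp
    qed
    \<comment> \<open>The cubic relation with bB eliminated by Legendre's equation.\<close>
    have i0: "A * s * (a\<^sup>2 - A\<^sup>2) = 4 * Q * a * S * M"
      using rh L unfolding M_def by algebra
    have i1: "(b * B) * (a * M) = A * W"
      unfolding bB W_def M_def using i0[unfolded M_def] by algebra
    \<comment> \<open>No root has to be chosen: \<open>i1\<close> is linear in bB, so its square can
      be inserted into \<open>quart\<close> and W^2 cancelled.\<close>
    have i2: "A ^ 3 * s * S = a * M\<^sup>2"
    proof -
      have "(a * A * s * S * (b * B)\<^sup>2) * (a * M)\<^sup>2 = W\<^sup>2 * (a * M)\<^sup>2" unfolding quart ..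
      hence "a * A * s * S * (A * W)\<^sup>2 = W\<^sup>2 * (a * M)\<^sup>2" unfolding i1[symmetric] by algebra
      hence "(W\<^sup>2 * a) * (A ^ 3 * s * S) = (W\<^sup>2 * a) * (a * M\<^sup>2)" by algebra
      thus ?thesis using MW nz by simp
    qed
    have I: "(a\<^sup>2 - A\<^sup>2) * M = 4 * Q * A\<^sup>2 * S\<^sup>2"
    proof -
      have "(A * s) * ((a\<^sup>2 - A\<^sup>2) * M) = 4 * Q * S * (a * M\<^sup>2)" using i0 by algebra
      also have "\<dots> = (A * s) * (4 * Q * A\<^sup>2 * S\<^sup>2)" unfolding i2[symmetric] by algebra
      finally show ?thesis using nz by simp
    qed
    \<comment> \<open>In terms of v this is (a/A)^2 = (1 + 3v)/(1 - v), the parametrisation on which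
      the remaining relations rest.\<close>
    have I': "a\<^sup>2 * M = A\<^sup>2 * (s\<^sup>2 + 3 * Q * S\<^sup>2)" using I unfolding M_def by algebra
    have w: "w_fun Q = Q * A\<^sup>2 * S\<^sup>2 / (a\<^sup>2 * s\<^sup>2)"
    proof -
      have "psi Q ^ 4 = (a * s)\<^sup>2" "psi (Q ^ 3) ^ 4 = (A * S)\<^sup>2" unfolding p1[symmetric] p3[symmetric] by (simp_all flip: power_mult)
      thus ?thesis unfolding w_fun_def by (simp add: power_mult_distrib)
    qed
    have v: "v_fun Q = Q * S\<^sup>2 / s\<^sup>2" unfolding v_fun_def defs ..
    have N: "N_fun Q = a ^ 3 * s ^ 3 / (A * S)"
    proof -
      have "psi Q ^ 6 = (a * s) ^ 3" unfolding p1[symmetric] by (simp flip: power_mult)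
      thus ?thesis unfolding N_fun_def p3 by (simp add: power_mult_distrib)
    qed
    have N2: "N_fun (Q\<^sup>2) = s ^ 6 / S\<^sup>2" unfolding N_fun_def defs by (simp flip: power_mult)
    have v1: "1 + 3 * v_fun Q = (s\<^sup>2 + 3 * Q * S\<^sup>2) / s\<^sup>2" "1 - v_fun Q = M / s\<^sup>2"
      unfolding v M_def using nz by (simp_all add: field_simps)
    have g1: "w_fun Q = R_map (v_fun Q)"
    proof -
      have "R_map (v_fun Q) = Q * S\<^sup>2 * M / (s\<^sup>2 * (s\<^sup>2 + 3 * Q * S\<^sup>2))"
      proof -
        have gen: "x / t * (m / t) / (k / t) = x * m / (t * k)" if "t \<noteq> 0" for x m k t :: complex
          using that by simp
        show ?thesis unfolding R_map_def v1 unfolding v by (rule gen) (use nz in simp)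
      qed
      also have "\<dots> = Q * A\<^sup>2 * S\<^sup>2 / (a\<^sup>2 * s\<^sup>2)"
      proof -
        have "(Q * S\<^sup>2 * M) * (a\<^sup>2 * s\<^sup>2) = (Q * A\<^sup>2 * S\<^sup>2) * (s\<^sup>2 * (s\<^sup>2 + 3 * Q * S\<^sup>2))"
          using I' by algebra
        thus ?thesis using nz MW by (simp add: frac_eq_eq)
      qed
      finally show ?thesis unfolding w by simp
    qed
    have g2: "N_fun Q = (1 + 3 * v_fun Q)\<^sup>2 * N_fun (Q\<^sup>2)"
    proof -
      have "(s\<^sup>2 + 3 * Q * S\<^sup>2)\<^sup>2 * A ^ 4 = a ^ 4 * M\<^sup>2" using I' by algebra
      also have "\<dots> = a ^ 3 * (A ^ 3 * s * S)" unfolding i2 by algebra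
      finally have "A ^ 3 * (A * (s\<^sup>2 + 3 * Q * S\<^sup>2)\<^sup>2) = A ^ 3 * (a ^ 3 * s * S)" by algebra
      hence e: "A * (s\<^sup>2 + 3 * Q * S\<^sup>2)\<^sup>2 = a ^ 3 * s * S" using nz by simp
      have "(1 + 3 * v_fun Q)\<^sup>2 * N_fun (Q\<^sup>2) = (s\<^sup>2 + 3 * Q * S\<^sup>2)\<^sup>2 * s\<^sup>2 / S\<^sup>2"
        unfolding v1 N2 using nz by (simp add: power_divide field_simps eval_nat_numeral)
      moreover have "(a ^ 3 * s ^ 3) * S\<^sup>2 = ((s\<^sup>2 + 3 * Q * S\<^sup>2)\<^sup>2 * s\<^sup>2) * (A * S)" using e by algebra
      ultimately show ?thesis unfolding N using nz by (simp add: frac_eq_eq)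
    qed
    have eb: "b = euler_prod Q ^ 2 / euler_prod (Q\<^sup>2)" "B = euler_prod (Q ^ 3) ^ 2 / euler_prod (Q ^ 6)"
      unfolding defs phi_minus_def by (simp_all flip: power_mult)
    have es: "a * s = (euler_prod (Q\<^sup>2) ^ 2 / euler_prod Q)\<^sup>2" "A * S = (euler_prod (Q ^ 6) ^ 2 / euler_prod (Q ^ 3))\<^sup>2"
      unfolding p1[symmetric] p3[symmetric] psi_def by (simp_all flip: power_mult)
    have enz: "euler_prod Q \<noteq> 0" "euler_prod (Q\<^sup>2) \<noteq> 0" "euler_prod (Q ^ 3) \<noteq> 0" "euler_prod (Q ^ 6) \<noteq> 0"
      using Q1 by (simp_all add: euler_prod_nonzero euler_prod_power_nonzero)
    have u: "u_fun Q = Q * ((a * s) * (A * S)) / (b * B)\<^sup>2"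
      unfolding u_fun_def es eb using enz by (simp add: power_divide power_mult_distrib flip: power_mult) (simp add: field_simps eval_nat_numeral)
    have W2: "(a\<^sup>2 * s\<^sup>2 - Q * A\<^sup>2 * S\<^sup>2) * (a\<^sup>2 * s\<^sup>2 - 9 * Q * A\<^sup>2 * S\<^sup>2) = W\<^sup>2"
    proof -
      \<comment> \<open>Multiplication by M turns both factors into squares, the counterpart of 1 -
        R = (1 + v)^2/(1 + 3v) and 1 - 9R = (1 - 3v)^2/(1 + 3v).\<close>
      have e1: "M * (a\<^sup>2 * s\<^sup>2 - Q * A\<^sup>2 * S\<^sup>2) = A\<^sup>2 * (s\<^sup>2 + Q * S\<^sup>2)\<^sup>2"
        using I' unfolding M_def by algebra
      have e2: "M * (a\<^sup>2 * s\<^sup>2 - 9 * Q * A\<^sup>2 * S\<^sup>2) = A\<^sup>2 * (s\<^sup>2 - 3 * Q * S\<^sup>2)\<^sup>2"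
        using I' unfolding M_def by algebra
      have e3: "M * W = A\<^sup>2 * ((s\<^sup>2 + Q * S\<^sup>2) * (s\<^sup>2 - 3 * Q * S\<^sup>2))"
        using I' unfolding M_def W_def by algebra
      have "M\<^sup>2 * ((a\<^sup>2 * s\<^sup>2 - Q * A\<^sup>2 * S\<^sup>2) * (a\<^sup>2 * s\<^sup>2 - 9 * Q * A\<^sup>2 * S\<^sup>2)) 
          = (M * (a\<^sup>2 * s\<^sup>2 - Q * A\<^sup>2 * S\<^sup>2)) * (M * (a\<^sup>2 * s\<^sup>2 - 9 * Q * A\<^sup>2 * S\<^sup>2))" by algebra
      also have "\<dots> = (M * W)\<^sup>2" unfolding e1 e2 e3 by algebra
      also have "\<dots> = M\<^sup>2 * W\<^sup>2" by (rule power_mult_distrib)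
      finally show ?thesis using MW by simp
    qed
    have ww: "(1 - w_fun Q) * (1 - 9 * w_fun Q) = W\<^sup>2 / (a\<^sup>2 * s\<^sup>2)\<^sup>2"
    proof -
      have "1 - w_fun Q = (a\<^sup>2 * s\<^sup>2 - Q * A\<^sup>2 * S\<^sup>2) / (a\<^sup>2 * s\<^sup>2)" "1 - 9 * w_fun Q = (a\<^sup>2 * s\<^sup>2 - 9 * Q * A\<^sup>2 * S\<^sup>2) / (a\<^sup>2 * s\<^sup>2)"
        unfolding w using nz by (simp_all add: field_simps)
      thus ?thesis unfolding W2[symmetric] by (simp add: power2_eq_square)
    qed
    have g3: "u_fun Q * ((1 - w_fun Q) * (1 - 9 * w_fun Q)) = w_fun Q"
    proof -
      have "u_fun Q * ((1 - w_fun Q) * (1 - 9 * w_fun Q)) = Q * ((a * s) * (A * S)) / (b * B)\<^sup>2 * ((a * A * s * S * (b * B)\<^sup>2) / (a\<^sup>2 * s\<^sup>2)\<^sup>2)"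
        unfolding ww u quart ..
      also have "\<dots> = w_fun Q" unfolding w using nz by (simp add: field_simps power2_eq_square)
      finally show ?thesis .
    qed
    have g4: "Q * (euler_prod Q * euler_prod (Q\<^sup>2) * euler_prod (Q ^ 3) * euler_prod (Q ^ 6))\<^sup>2 = (N_fun Q)\<^sup>2 * p_cubic (w_fun Q)"
    proof -
      have "(euler_prod Q * euler_prod (Q\<^sup>2) * euler_prod (Q ^ 3) * euler_prod (Q ^ 6))\<^sup>2 = (a * s) * (A * S) * (b * B)\<^sup>2"
        unfolding es eb using enz by (simp add: power_divide power_mult_distrib flip: power_mult) (simp add: field_simps eval_nat_numeral)
      also have "\<dots> = W\<^sup>2" using quart by (simp add: mult_ac)
      finally have 1: "(euler_prod Q * euler_prod (Q\<^sup>2) * euler_prod (Q ^ 3) * euler_prod (Q ^ 6))\<^sup>2 = W\<^sup>2" .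
      have "(N_fun Q)\<^sup>2 * p_cubic (w_fun Q) = (N_fun Q)\<^sup>2 * w_fun Q * ((1 - w_fun Q) * (1 - 9 * w_fun Q))"
        unfolding p_cubic_def by (simp add: mult_ac)
      also have "\<dots> = Q * W\<^sup>2" unfolding ww unfolding N w using nz by (simp add: field_simps eval_nat_numeral)
      finally show ?thesis unfolding 1 by simp
    qed
    show ?thesis using g1 g2 g3 g4 by blast
  qed
  thus ?thesis using r(1,2) by blast
qed

section \<open>The Eisenstein series\<close>

definition euler_logderiv :: "complex \<Rightarrow> complex" where
  "euler_logderiv q = q * deriv euler_prod q / euler_prod q"

definition Z_fun :: "complex \<Rightarrow> complex" where
  "Z_fun Q = 1 / 4 * (6 * ramanujan_P (Q ^ 6) - 3 * ramanujan_P (Q ^ 3) + 2 * ramanujan_P (Q\<^sup>2) - ramanujan_P Q)"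

lemma ramanujan_P_eq: "ramanujan_P q = 1 + 24 * euler_logderiv q" if "norm q < 1"
proof -
  have "(\<Sum>j. of_nat (Suc j) * q ^ Suc j / (1 - q ^ Suc j)) = - euler_logderiv q"
    using euler_prod_logderiv[OF that] unfolding euler_logderiv_def by (rule sums_unique[symmetric])
  thus ?thesis unfolding ramanujan_P_def by simp
qed

lemma euler_logderiv_holomorphic: "euler_logderiv holomorphic_on ball 0 1"
  unfolding euler_logderiv_def
  by (intro holomorphic_intros holomorphic_deriv euler_prod_holomorphic) (auto simp: euler_prod_nonzero)

lemma Z_fun_eq:
  assumes "norm Q < 1"
  shows "Z_fun Q = 1 + 6 * (6 * euler_logderiv (Q ^ 6) - 3 * euler_logderiv (Q ^ 3) + 2 * euler_logderiv (Q\<^sup>2) - euler_logderiv Q)"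
  unfolding Z_fun_def using assms by (simp add: ramanujan_P_eq norm_power_less_1 algebra_simps)

lemma Z_fun_tendsto: "(Z_fun \<longlongrightarrow> 1) (at 0)"
proof -
  note L = tendsto_power_arg[OF euler_logderiv_holomorphic]
  have L0: "euler_logderiv 0 = 0" by (simp add: euler_logderiv_def)
  have "((\<lambda>Q. 1 + 6 * (6 * euler_logderiv (Q ^ 6) - 3 * euler_logderiv (Q ^ 3) + 2 * euler_logderiv (Q\<^sup>2) - euler_logderiv (Q ^ 1)))
     \<longlongrightarrow> 1 + 6 * (6 * euler_logderiv 0 - 3 * euler_logderiv 0 + 2 * euler_logderiv 0 - euler_logderiv 0)) (at 0)"
    by (intro tendsto_intros L) auto
  moreover have "\<forall>\<^sub>F Q in at 0. 1 + 6 * (6 * euler_logderiv (Q ^ 6) - 3 * euler_logderiv (Q ^ 3) + 2 * euler_logderiv (Q\<^sup>2) - euler_logderiv (Q ^ 1)) = Z_fun Q"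
    unfolding eventually_at by (intro exI[of _ 1]) (auto simp: Z_fun_eq)
  ultimately show ?thesis unfolding L0 by (simp add: Lim_transform_eventually)
qed

lemma euler_prod_power_deriv:
  assumes Q: "norm Q < 1" and n: "n > 0"
  obtains D where "((\<lambda>Q. euler_prod (Q ^ n)) has_field_derivative D) (at Q)"
    "Q * D = of_nat n * euler_logderiv (Q ^ n) * euler_prod (Q ^ n)"
proof
  have "Q ^ n \<in> ball 0 1" using norm_power_less_1[OF Q n] by simp
  hence d: "(euler_prod has_field_derivative deriv euler_prod (Q ^ n)) (at (Q ^ n))"
    by (intro holomorphic_derivI[OF euler_prod_holomorphic open_ball])
  have p: "((\<lambda>Q. Q ^ n) has_field_derivative of_nat n * Q ^ (n - 1)) (at Q)"
    using DERIV_power[OF DERIV_ident, of n Q] by simp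
  show "((\<lambda>Q. euler_prod (Q ^ n)) has_field_derivative deriv euler_prod (Q ^ n) * (of_nat n * Q ^ (n - 1))) (at Q)"
    by (rule DERIV_chain2[OF d p])
  have "Q * Q ^ (n - 1) = Q ^ n" using n by (simp flip: power_Suc)
  thus "Q * (deriv euler_prod (Q ^ n) * (of_nat n * Q ^ (n - 1))) = of_nat n * euler_logderiv (Q ^ n) * euler_prod (Q ^ n)"
    unfolding euler_logderiv_def using euler_prod_power_nonzero[OF Q n] by (simp add: mult_ac)
qed

lemma u_fun_deriv:
  assumes Q: "norm Q < 1"
  obtains D where "(u_fun has_field_derivative D) (at Q)" "Q * D = u_fun Q * Z_fun Q"
proof -
  obtain D1 where D1: "((\<lambda>Q. euler_prod Q) has_field_derivative D1) (at Q)" "Q * D1 = euler_logderiv Q * euler_prod Q"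
    using euler_prod_power_deriv[OF Q, of 1] by auto
  obtain D2 where D2: "((\<lambda>Q. euler_prod (Q\<^sup>2)) has_field_derivative D2) (at Q)" "Q * D2 = 2 * euler_logderiv (Q\<^sup>2) * euler_prod (Q\<^sup>2)"
    using euler_prod_power_deriv[OF Q, of 2] by auto
  obtain D3 where D3: "((\<lambda>Q. euler_prod (Q ^ 3)) has_field_derivative D3) (at Q)" "Q * D3 = 3 * euler_logderiv (Q ^ 3) * euler_prod (Q ^ 3)"
    using euler_prod_power_deriv[OF Q, of 3] by auto
  obtain D6 where D6: "((\<lambda>Q. euler_prod (Q ^ 6)) has_field_derivative D6) (at Q)" "Q * D6 = 6 * euler_logderiv (Q ^ 6) * euler_prod (Q ^ 6)"
    using euler_prod_power_deriv[OF Q, of 6] by auto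
  define e1 e2 e3 e6 where e: "e1 = euler_prod Q" "e2 = euler_prod (Q\<^sup>2)" "e3 = euler_prod (Q ^ 3)" "e6 = euler_prod (Q ^ 6)"
  have nz: "e1 \<noteq> 0" "e3 \<noteq> 0" unfolding e using Q by (simp_all add: euler_prod_nonzero euler_prod_power_nonzero)
  define F where "F = (\<lambda>Q. euler_prod (Q\<^sup>2) * euler_prod (Q ^ 6) / (euler_prod Q * euler_prod (Q ^ 3)))"
  define F' where "F' = ((D2 * e6 + e2 * D6) * (e1 * e3) - (e2 * e6) * (D1 * e3 + e1 * D3)) / ((e1 * e3) * (e1 * e3))"
  define Y where "Y = 6 * euler_logderiv (Q ^ 6) - 3 * euler_logderiv (Q ^ 3) + 2 * euler_logderiv (Q\<^sup>2) - euler_logderiv Q"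
  have dF: "(F has_field_derivative F') (at Q)"
    unfolding F_def F'_def e using nz[unfolded e]
    by (auto intro!: derivative_eq_intros D1 D2 D3 D6 simp: mult.commute)
  have QF: "Q * F' = F Q * Y"
  proof -
    have "Q * ((D2 * e6 + e2 * D6) * (e1 * e3) - (e2 * e6) * (D1 * e3 + e1 * D3)) = 
       ((Q * D2) * e6 + e2 * (Q * D6)) * (e1 * e3) - (e2 * e6) * ((Q * D1) * e3 + e1 * (Q * D3))" by algebra
    also have "\<dots> = (e2 * e6) * Y * (e1 * e3)"
      unfolding D1(2) D2(2) D3(2) D6(2) e[symmetric] Y_def by algebra
    finally show ?thesis unfolding F'_def F_def e[symmetric] using nz by simp
  qed
  have u: "u_fun = (\<lambda>Q. Q * F Q ^ 6)" by (simp add: fun_eq_iff u_fun_def F_def)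
  have "(u_fun has_field_derivative F Q ^ 6 + Q * (6 * (F' * F Q ^ 5))) (at Q)"
    unfolding u by (auto intro!: derivative_eq_intros dF)
  moreover have "Q * (F Q ^ 6 + Q * (6 * (F' * F Q ^ 5))) = u_fun Q * Z_fun Q"
  proof -
    have "Q * (F Q ^ 6 + Q * (6 * (F' * F Q ^ 5))) = Q * F Q ^ 6 + 6 * Q * F Q ^ 5 * (Q * F')" by algebra
    also have "\<dots> = Q * F Q ^ 6 * (1 + 6 * Y)" unfolding QF by algebra
    finally show ?thesis unfolding u Z_fun_eq[OF Q] Y_def .
  qed
  ultimately show ?thesis by (rule that)
qed

section \<open>Regularity and limits at 0\<close>

lemma w_fun_holomorphic: "w_fun holomorphic_on ball 0 1"
  and v_fun_holomorphic: "v_fun holomorphic_on ball 0 1"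
  unfolding w_fun_def v_fun_def
  by (intro holomorphic_intros holomorphic_on_power_arg[OF psi_holomorphic] psi_holomorphic;
      simp add: psi_nonzero norm_power_less_1)+

lemma w_fun_tendsto: "(w_fun \<longlongrightarrow> 0) (at 0)"
proof -
  have "(w_fun \<longlongrightarrow> 0 * 1 ^ 4 / 1 ^ 4) (at 0)" unfolding w_fun_def by (intro tendsto_intros theta_tendsto') auto
  thus ?thesis by simp
qed

lemma N_fun_tendsto: "(N_fun \<longlongrightarrow> 1) (at 0)"
proof -
  have "(N_fun \<longlongrightarrow> 1 ^ 6 / 1 ^ 2) (at 0)" unfolding N_fun_def by (intro tendsto_intros theta_tendsto') auto
  thus ?thesis by simp
qed

lemma N_fun_nonzero: "norm Q < 1 \<Longrightarrow> N_fun Q \<noteq> 0"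
  unfolding N_fun_def by (simp add: psi_nonzero norm_power_less_1)

text \<open>Differentiating the relations between u, w and v shows how Z changes under Q \<mapsto>
  Q^2. Apart from the factor 1 - 9w^2 the multiplier is (1 + 3v)^2, the same as for N.\<close>

lemma Z_fun_eq_N_fun:
  "\<exists>r>0. r \<le> 1 \<and> (\<forall>Q. 0 < norm Q \<and> norm Q < r \<longrightarrow> Z_fun Q = N_fun Q * (1 - 9 * (w_fun Q)\<^sup>2))"
proof -
  obtain r0 where r0: "r0 > 0" "r0 \<le> 1" and rel: "\<And>Q. 0 < norm Q \<Longrightarrow> norm Q < r0 \<Longrightarrow>
     w_fun Q = R_map (v_fun Q) \<and> N_fun Q = (1 + 3 * v_fun Q)\<^sup>2 * N_fun (Q\<^sup>2) \<and>
     u_fun Q * ((1 - w_fun Q) * (1 - 9 * w_fun Q)) = w_fun Q"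
    using level_six_relations by blast
  have t: "((\<lambda>Q. 1 - 3 * v_fun Q) \<longlongrightarrow> 1 - 3 * 0) (at 0)" "((\<lambda>Q. 1 + 3 * v_fun Q) \<longlongrightarrow> 1 + 3 * 0) (at 0)"
    "((\<lambda>Q. 1 - (v_fun Q)\<^sup>2) \<longlongrightarrow> 1 - 0\<^sup>2) (at 0)" "((\<lambda>Q. 1 - 9 * (v_fun Q) ^ 4) \<longlongrightarrow> 1 - 9 * 0 ^ 4) (at 0)"
    "((\<lambda>Q. 1 - 9 * (w_fun Q)\<^sup>2) \<longlongrightarrow> 1 - 9 * 0\<^sup>2) (at 0)" "((\<lambda>Q. (1 - w_fun Q) * (1 - 9 * w_fun Q)) \<longlongrightarrow> (1 - 0) * (1 - 9 * 0)) (at 0)"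
    by (intro tendsto_intros v_fun_tendsto w_fun_tendsto)+
  have "\<forall>\<^sub>F Q in at 0. 1 - 3 * v_fun Q \<noteq> 0 \<and> 1 + 3 * v_fun Q \<noteq> 0 \<and> 1 - (v_fun Q)\<^sup>2 \<noteq> 0 \<and> 1 - 9 * (v_fun Q) ^ 4 \<noteq> 0
      \<and> 1 - 9 * (w_fun Q)\<^sup>2 \<noteq> 0 \<and> (1 - w_fun Q) * (1 - 9 * w_fun Q) \<noteq> 0"
    by (intro eventually_conj tendsto_imp_eventually_ne[OF t(1)] tendsto_imp_eventually_ne[OF t(2)]
       tendsto_imp_eventually_ne[OF t(3)] tendsto_imp_eventually_ne[OF t(4)] tendsto_imp_eventually_ne[OF t(5)] tendsto_imp_eventually_ne[OF t(6)]) auto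
  then obtain d where d: "d > 0" and dn: "\<And>Q. Q \<noteq> 0 \<Longrightarrow> norm Q < d \<Longrightarrow> 
      1 - 3 * v_fun Q \<noteq> 0 \<and> 1 + 3 * v_fun Q \<noteq> 0 \<and> 1 - (v_fun Q)\<^sup>2 \<noteq> 0 \<and> 1 - 9 * (v_fun Q) ^ 4 \<noteq> 0
      \<and> 1 - 9 * (w_fun Q)\<^sup>2 \<noteq> 0 \<and> (1 - w_fun Q) * (1 - 9 * w_fun Q) \<noteq> 0"
    unfolding eventually_at by (auto simp: dist_norm)
  define r where "r = min d r0"
  have r: "r > 0" "r \<le> 1" "r \<le> r0" "r \<le> d" using d r0 by (auto simp: r_def)
  define U where "U = ball (0::complex) r - {0}"
  have U: "open U" by (simp add: U_def open_delete)
  \<comment> \<open>Differentiation of u(1 - w)(1 - 9w) = w. The numerator (1 - w)(1 - 9w) + w(1 -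
    9w) + 9w(1 - w) collapses to 1 - 9w^2.\<close>
  have alpha: "p_cubic (w_fun Q) * Z_fun Q = Q * deriv w_fun Q * (1 - 9 * (w_fun Q)\<^sup>2)" if Q: "0 < norm Q" "norm Q < r" for Q
  proof -
    have Q1: "norm Q < 1" using Q r by simp
    obtain D where D: "(u_fun has_field_derivative D) (at Q)" "Q * D = u_fun Q * Z_fun Q" using u_fun_deriv[OF Q1] .
    have dw: "(w_fun has_field_derivative deriv w_fun Q) (at Q)"
      by (rule holomorphic_derivI[OF w_fun_holomorphic open_ball]) (use Q1 in simp)
    define w u w' where "w = w_fun Q" "u = u_fun Q" "w' = deriv w_fun Q"
    have "((\<lambda>Q. u_fun Q * ((1 - w_fun Q) * (1 - 9 * w_fun Q))) has_field_derivative
       D * ((1 - w) * (1 - 9 * w)) + u * (18 * w - 10) * w') (at Q)"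
      unfolding w_u_w'_def by (auto intro!: derivative_eq_intros D dw simp: algebra_simps)
    moreover have "u_fun x * ((1 - w_fun x) * (1 - 9 * w_fun x)) = w_fun x" if "x \<in> U" for x
    proof -
      have "0 < norm x" "norm x < r0" using that r by (auto simp: U_def)
      from rel[OF this] show ?thesis by blast
    qed
    ultimately have "(w_fun has_field_derivative D * ((1 - w) * (1 - 9 * w)) + u * (18 * w - 10) * w') (at Q)"
      by (elim has_field_derivative_transform_within_open[OF _ U]) (use Q in \<open>auto simp: U_def\<close>)
    hence e: "D * ((1 - w) * (1 - 9 * w)) + u * (18 * w - 10) * w' = w'"
      using dw DERIV_unique unfolding w_u_w'_def by blast
    have uw: "u * ((1 - w) * (1 - 9 * w)) = w"
      using rel[OF Q(1) less_le_trans[OF Q(2) r(3)]] unfolding w_u_w'_def by blast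
    have c: "(1 - w) * (1 - 9 * w) \<noteq> 0" using dn[of Q] Q r unfolding w_u_w'_def by auto
    have QD: "Q * D = u * Z_fun Q" using D(2) unfolding w_u_w'_def .
    have "((1 - w) * (1 - 9 * w)) * (Q * w' * (1 - 9 * w\<^sup>2)) = ((1 - w) * (1 - 9 * w)) * (p_cubic w * Z_fun Q)"
    proof -
      have "((1 - w) * (1 - 9 * w)) * (Q * D * ((1 - w) * (1 - 9 * w))) = 
         Q * w' * (((1 - w) * (1 - 9 * w)) - (u * ((1 - w) * (1 - 9 * w))) * (18 * w - 10))"
      proof -
        have "D * ((1 - w) * (1 - 9 * w)) = w' * (1 - u * (18 * w - 10))"
          using e by (simp add: algebra_simps)
        moreover have "c * (Q * D * c) = Q * w' * (c - (u * c) * (18 * w - 10))"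
          if "D * c = w' * (1 - u * (18 * w - 10))" for c
        proof -
          have "c * (Q * D * c) = Q * c * (D * c)" by (simp only: mult_ac)
          thus ?thesis unfolding that by (simp add: algebra_simps)
        qed
        ultimately show ?thesis by blast
      qed
      also have "\<dots> = Q * w' * (1 - 9 * w\<^sup>2)" unfolding uw by algebra
      finally have "Q * w' * (1 - 9 * w\<^sup>2) = (u * ((1 - w) * (1 - 9 * w))) * ((1 - w) * (1 - 9 * w)) * Z_fun Q"
        unfolding QD by algebra
      thus ?thesis unfolding uw p_cubic_def by algebra
    qed
    thus ?thesis using c unfolding w_u_w'_def by simp
  qed
  define G where "G = (\<lambda>Q. Z_fun Q / (N_fun Q * (1 - 9 * (w_fun Q)\<^sup>2)))"
  have "(G \<longlongrightarrow> 1 / (1 * (1 - 9 * 0\<^sup>2))) (at 0)"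
    unfolding G_def by (intro tendsto_intros Z_fun_tendsto N_fun_tendsto w_fun_tendsto) auto
  hence lim: "(G \<longlongrightarrow> 1) (at 0)" by simp
  have inv: "G Q = G (Q\<^sup>2)" if Q: "0 < norm Q" "norm Q < r" for Q
  proof -
    have Q1: "norm Q < 1" using Q r by simp
    have Q0: "Q \<noteq> 0" using Q by auto
    have n2: "norm (Q\<^sup>2) < r" "0 < norm (Q\<^sup>2)" using Q r power_two_power_norm_le[OF Q1, of 1] by auto
    have n21: "norm (Q\<^sup>2) < 1" using n2 r by simp
    have dw: "(w_fun has_field_derivative deriv w_fun Q) (at Q)"
      by (rule holomorphic_derivI[OF w_fun_holomorphic open_ball]) (use Q1 in simp)
    have dw2: "(w_fun has_field_derivative deriv w_fun (Q\<^sup>2)) (at (Q\<^sup>2))"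
      by (rule holomorphic_derivI[OF w_fun_holomorphic open_ball]) (use n21 in simp)
    have dv: "(v_fun has_field_derivative deriv v_fun Q) (at Q)"
      by (rule holomorphic_derivI[OF v_fun_holomorphic open_ball]) (use Q1 in simp)
    define v w v' w' where "v = v_fun Q" "w = w_fun Q" "v' = deriv v_fun Q" "w' = deriv w_fun Q"
    note vd = v_w_v'_w'_def
    have nz: "1 - 3 * v \<noteq> 0" "1 + 3 * v \<noteq> 0" "1 - v\<^sup>2 \<noteq> 0" "1 - 9 * v ^ 4 \<noteq> 0" "1 - 9 * w\<^sup>2 \<noteq> 0"
      using dn[of Q] Q r unfolding vd by auto
    have v0: "v \<noteq> 0" unfolding vd v_fun_def using Q0 Q1 by (simp add: psi_nonzero norm_power_less_1)
    \<comment> \<open>\<open>beta\<close> and \<open>gamma\<close> are the chain rule for w = R(v),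
      cleared of denominators, and for w(Q^2) = v^2. With \<open>alpha\<close> at Q and at Q^2 they
      allow the derivative of v to be eliminated.\<close>
    have beta: "w' * (1 + 3 * v)\<^sup>2 = (1 - 3 * v) * (1 + v) * v'"
    proof -
      have "((\<lambda>Q. w_fun Q * (1 + 3 * v_fun Q)) has_field_derivative w' * (1 + 3 * v) + 3 * w * v') (at Q)"
        unfolding vd by (auto intro!: derivative_eq_intros dw dv)
      moreover have "w_fun x * (1 + 3 * v_fun x) = v_fun x * (1 - v_fun x)" if "x \<in> U" for x
        using rel[of x] dn[of x] that r unfolding U_def R_map_def by auto
      ultimately have "((\<lambda>Q. v_fun Q * (1 - v_fun Q)) has_field_derivative w' * (1 + 3 * v) + 3 * w * v') (at Q)"
        by (elim has_field_derivative_transform_within_open[OF _ U]) (use Q in \<open>auto simp: U_def\<close>)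
      moreover have "((\<lambda>Q. v_fun Q * (1 - v_fun Q)) has_field_derivative v' * (1 - v) - v * v') (at Q)"
        unfolding vd by (auto intro!: derivative_eq_intros dv)
      ultimately have "w' * (1 + 3 * v) + 3 * w * v' = v' * (1 - v) - v * v'" using DERIV_unique by blast
      moreover have "w * (1 + 3 * v) = v * (1 - v)"
        using rel[of Q] nz(2) Q r unfolding vd R_map_def by simp
      ultimately show ?thesis by algebra
    qed
    have gamma: "Q\<^sup>2 * deriv w_fun (Q\<^sup>2) = Q * v * v'"
    proof -
      have "((\<lambda>Q. w_fun (Q\<^sup>2)) has_field_derivative deriv w_fun (Q\<^sup>2) * (2 * Q)) (at Q)"
        by (rule DERIV_chain2[of w_fun _ "\<lambda>Q. Q\<^sup>2", OF dw2]) (auto intro!: derivative_eq_intros)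
      hence "((\<lambda>Q. (v_fun Q)\<^sup>2) has_field_derivative deriv w_fun (Q\<^sup>2) * (2 * Q)) (at Q)"
        unfolding w_fun_square .
      moreover have "((\<lambda>Q. (v_fun Q)\<^sup>2) has_field_derivative 2 * v * v') (at Q)"
        unfolding vd by (auto intro!: derivative_eq_intros dv)
      ultimately have "deriv w_fun (Q\<^sup>2) * (2 * Q) = 2 * v * v'" using DERIV_unique by blast
      thus ?thesis by (simp add: power2_eq_square mult.commute)
    qed
    have a1: "p_cubic w * Z_fun Q = Q * w' * (1 - 9 * w\<^sup>2)" using alpha[OF Q] unfolding vd .
    have "p_cubic (v\<^sup>2) * Z_fun (Q\<^sup>2) = (Q * v * v') * (1 - 9 * (v\<^sup>2)\<^sup>2)"
      using alpha[OF n2(2,1)] unfolding gamma w_fun_square unfolding vd .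
    hence "v * (v * ((1 - v\<^sup>2) * (1 - 9 * v\<^sup>2)) * Z_fun (Q\<^sup>2)) = v * (Q * v' * (1 - 9 * v ^ 4))"
      unfolding p_cubic_def by algebra
    hence a2: "v * ((1 - v\<^sup>2) * (1 - 9 * v\<^sup>2)) * Z_fun (Q\<^sup>2) = Q * v' * (1 - 9 * v ^ 4)" using v0 by simp
    have pw: "p_cubic w * (1 + 3 * v) ^ 3 = v * (1 - v) * (1 + v)\<^sup>2 * (1 - 3 * v)\<^sup>2"
    proof -
      have "w * (1 + 3 * v) = v * (1 - v)" using rel[of Q] nz(2) Q r unfolding vd R_map_def by simp
      thus ?thesis unfolding p_cubic_def by algebra
    qed
    define k where "k = v * (1 - v\<^sup>2) * (1 - 3 * v)"
    have k0: "k * ((1 + v) * (1 - 3 * v)) \<noteq> 0"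
    proof -
      have "1 - v\<^sup>2 = (1 - v) * (1 + v)" by algebra
      thus ?thesis unfolding k_def using nz v0 by auto
    qed
    have "(k * ((1 + v) * (1 - 3 * v))) * (Z_fun Q * (1 - 9 * v ^ 4)) = p_cubic w * (1 + 3 * v) ^ 3 * Z_fun Q * (1 - 9 * v ^ 4)"
      unfolding pw k_def by algebra
    also have "\<dots> = (1 + 3 * v) * (1 - 9 * w\<^sup>2) * (Q * (w' * (1 + 3 * v)\<^sup>2)) * (1 - 9 * v ^ 4)" using a1 by algebra
    also have "\<dots> = (1 + 3 * v) * (1 - 9 * w\<^sup>2) * (1 - 3 * v) * (1 + v) * (Q * v' * (1 - 9 * v ^ 4))" unfolding beta by algebra
    also have "\<dots> = (k * ((1 + v) * (1 - 3 * v))) * ((1 + 3 * v)\<^sup>2 * (1 - 9 * w\<^sup>2) * Z_fun (Q\<^sup>2))"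
      unfolding a2[symmetric] k_def by algebra
    finally have m: "Z_fun Q * (1 - 9 * v ^ 4) = (1 + 3 * v)\<^sup>2 * (1 - 9 * w\<^sup>2) * Z_fun (Q\<^sup>2)" using k0 by simp
    have N: "N_fun Q = (1 + 3 * v)\<^sup>2 * N_fun (Q\<^sup>2)" using rel[of Q] Q r unfolding vd by simp
    have w2: "1 - 9 * (w_fun (Q\<^sup>2))\<^sup>2 = 1 - 9 * v ^ 4" unfolding w_fun_square vd by (simp flip: power_mult)
    have N2: "N_fun (Q\<^sup>2) \<noteq> 0" by (rule N_fun_nonzero[OF n21])
    have "Z_fun Q * (N_fun (Q\<^sup>2) * (1 - 9 * v ^ 4)) = Z_fun (Q\<^sup>2) * (N_fun Q * (1 - 9 * w\<^sup>2))"
      unfolding N using m by algebra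
    moreover have "N_fun (Q\<^sup>2) * (1 - 9 * v ^ 4) \<noteq> 0" "N_fun Q * (1 - 9 * w\<^sup>2) \<noteq> 0"
      using nz N2 N_fun_nonzero[OF Q1] by auto
    ultimately show ?thesis unfolding G_def w2 unfolding vd by (simp add: frac_eq_eq)
  qed
  have "Z_fun Q = N_fun Q * (1 - 9 * (w_fun Q)\<^sup>2)" if Q: "0 < norm Q" "norm Q < r" for Q
  proof -
    have "G Q = 1" by (rule square_invariant_const[OF lim inv r(2) Q])
    moreover have "N_fun Q * (1 - 9 * (w_fun Q)\<^sup>2) \<noteq> 0" using dn[of Q] N_fun_nonzero[of Q] Q r by auto
    ultimately show ?thesis unfolding G_def by simp
  qed
  thus ?thesis using r by blast
qed

lemma T_fun_w_fun:
  "\<exists>r>0. r \<le> 1 \<and> (\<forall>Q. 0 < norm Q \<and> norm Q < r \<longrightarrow> T_fun (w_fun Q) = N_fun Q)"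
proof -
  obtain r0 where r0: "r0 > 0" "r0 \<le> 1" and rel: "\<And>Q. 0 < norm Q \<Longrightarrow> norm Q < r0 \<Longrightarrow>
     w_fun Q = R_map (v_fun Q) \<and> N_fun Q = (1 + 3 * v_fun Q)\<^sup>2 * N_fun (Q\<^sup>2)"
    using level_six_relations by blast
  obtain r1 where r1: "r1 > 0" and fe: "\<And>v. norm v < r1 \<Longrightarrow> T_fun (R_map v) = (1 + 3 * v)\<^sup>2 * T_fun (v\<^sup>2)"
    using T_fun_functional_equation by blast
  have "\<forall>\<^sub>F Q in at 0. norm (v_fun Q) < r1"
    using order_tendstoD(2)[OF tendsto_norm[OF v_fun_tendsto], of r1] r1 by simp
  moreover have "((\<lambda>Q. 1 + 3 * v_fun Q) \<longlongrightarrow> 1 + 3 * 0) (at 0)" by (intro tendsto_intros v_fun_tendsto)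
  hence "\<forall>\<^sub>F Q in at 0. 1 + 3 * v_fun Q \<noteq> 0" by (rule tendsto_imp_eventually_ne) simp
  ultimately have "\<forall>\<^sub>F Q in at 0. norm (v_fun Q) < r1 \<and> 1 + 3 * v_fun Q \<noteq> 0" by (rule eventually_conj)
  then obtain d where d: "d > 0" "\<And>Q. Q \<noteq> 0 \<Longrightarrow> norm Q < d \<Longrightarrow> norm (v_fun Q) < r1 \<and> 1 + 3 * v_fun Q \<noteq> 0"
    unfolding eventually_at by (auto simp: dist_norm)
  define r where "r = min d r0"
  have r: "r > 0" "r \<le> 1" "r \<le> r0" "r \<le> d" using d r0 by (auto simp: r_def)
  define G where "G = (\<lambda>Q. T_fun (w_fun Q) / N_fun Q)"
  have "(T_fun \<longlongrightarrow> 1) (nhds 0)" using sym_square_imp_tendsto[OF sym_square_T_fun] by simp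
  hence "((\<lambda>Q. T_fun (w_fun Q)) \<longlongrightarrow> 1) (at 0)" by (rule filterlim_compose) (rule w_fun_tendsto)
  hence "(G \<longlongrightarrow> 1 / 1) (at 0)" unfolding G_def by (intro tendsto_divide N_fun_tendsto) auto
  hence lim: "(G \<longlongrightarrow> 1) (at 0)" by simp
  have inv: "G Q = G (Q\<^sup>2)" if Q: "0 < norm Q" "norm Q < r" for Q
  proof -
    have "Q \<noteq> 0" using Q by auto
    hence n: "norm (v_fun Q) < r1" "1 + 3 * v_fun Q \<noteq> 0" using d(2)[of Q] Q r by auto
    have "w_fun Q = R_map (v_fun Q)" and N: "N_fun Q = (1 + 3 * v_fun Q)\<^sup>2 * N_fun (Q\<^sup>2)" using rel[of Q] Q r by auto
    hence "T_fun (w_fun Q) = (1 + 3 * v_fun Q)\<^sup>2 * T_fun (w_fun (Q\<^sup>2))" using fe[OF n(1)] by (simp add: w_fun_square)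
    thus ?thesis unfolding G_def N using n(2) by simp
  qed
  have "T_fun (w_fun Q) = N_fun Q" if Q: "0 < norm Q" "norm Q < r" for Q
    using square_invariant_const[OF lim inv r(2) Q] N_fun_nonzero[of Q] Q r unfolding G_def by simp
  thus ?thesis using r by blast
qed

text \<open>At y = p(w)/(1 - 9w^2)^2, B(y) = (1 - 9w^2) T(w) = (1 - 9w^2) N = Z, while y = N^2
  p(w)/Z^2. The bound on Z - 1 is carried along because x must later be shown to be small.\<close>

lemma level_six_series:
  "\<exists>r>0. r \<le> 1 \<and> (\<forall>Q. 0 < norm Q \<and> norm Q < r \<longrightarrow> norm (Z_fun Q - 1) < 1 / 2 \<and>
     B_theta 0 (Q * (euler_prod Q * euler_prod (Q\<^sup>2) * euler_prod (Q ^ 3) * euler_prod (Q ^ 6))\<^sup>2 / (Z_fun Q)\<^sup>2) = Z_fun Q)"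
proof -
  obtain r0 where r0: "r0 > 0" "r0 \<le> 1" and rel: "\<And>Q. 0 < norm Q \<Longrightarrow> norm Q < r0 \<Longrightarrow>
     Q * (euler_prod Q * euler_prod (Q\<^sup>2) * euler_prod (Q ^ 3) * euler_prod (Q ^ 6))\<^sup>2 = (N_fun Q)\<^sup>2 * p_cubic (w_fun Q)"
    using level_six_relations by blast
  obtain r1 where r1: "r1 > 0" and Z: "\<And>Q. 0 < norm Q \<Longrightarrow> norm Q < r1 \<Longrightarrow> Z_fun Q = N_fun Q * (1 - 9 * (w_fun Q)\<^sup>2)"
    using Z_fun_eq_N_fun by blast
  obtain r2 where r2: "r2 > 0" and T: "\<And>Q. 0 < norm Q \<Longrightarrow> norm Q < r2 \<Longrightarrow> T_fun (w_fun Q) = N_fun Q"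
    using T_fun_w_fun by blast
  have "\<forall>\<^sub>F Q in at 0. dist (Z_fun Q) 1 < 1 / 2" using Z_fun_tendsto by (rule tendstoD) simp
  then obtain d where d: "d > 0" "\<And>Q. Q \<noteq> 0 \<Longrightarrow> norm Q < d \<Longrightarrow> norm (Z_fun Q - 1) < 1 / 2"
    unfolding eventually_at by (auto simp: dist_norm)
  define r where "r = min d (min r0 (min r1 r2))"
  have r: "r > 0" "r \<le> 1" "r \<le> r0" "r \<le> d" "r \<le> r1" "r \<le> r2" using d r0 r1 r2 by (auto simp: r_def)
  have "norm (Z_fun Q - 1) < 1 / 2 \<and>
     B_theta 0 (Q * (euler_prod Q * euler_prod (Q\<^sup>2) * euler_prod (Q ^ 3) * euler_prod (Q ^ 6))\<^sup>2 / (Z_fun Q)\<^sup>2) = Z_fun Q"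
    if Q: "0 < norm Q" "norm Q < r" for Q
  proof
    have Q0: "Q \<noteq> 0" using Q by auto
    show n: "norm (Z_fun Q - 1) < 1 / 2" using d(2)[OF Q0] Q r by simp
    have Zn: "Z_fun Q = N_fun Q * (1 - 9 * (w_fun Q)\<^sup>2)" using Z[of Q] Q r by simp
    have "Z_fun Q \<noteq> 0" using n by auto
    hence nz: "N_fun Q \<noteq> 0" "1 - 9 * (w_fun Q)\<^sup>2 \<noteq> 0" unfolding Zn by auto
    have "Q * (euler_prod Q * euler_prod (Q\<^sup>2) * euler_prod (Q ^ 3) * euler_prod (Q ^ 6))\<^sup>2 / (Z_fun Q)\<^sup>2 = y_of (w_fun Q)"
      using rel[of Q] Q r nz unfolding Zn y_of_def by (simp add: power_mult_distrib)
    moreover have "B_theta 0 (y_of (w_fun Q)) = Z_fun Q"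
      using T[of Q] Q r nz unfolding T_fun_def Zn by (simp add: nonzero_divide_eq_eq)
    ultimately show "B_theta 0 (Q * (euler_prod Q * euler_prod (Q\<^sup>2) * euler_prod (Q ^ 3) * euler_prod (Q ^ 6))\<^sup>2 / (Z_fun Q)\<^sup>2) = Z_fun Q" by simp
  qed
  thus ?thesis using r by blast
qed

section \<open>Return to the variable \<tau>\<close>

lemma eta_product_eq:
  "eta_product \<tau> = qpar \<tau> * (euler_prod ((qpar \<tau>)\<^sup>2) * euler_prod (qpar \<tau> ^ 4) * euler_prod (qpar \<tau> ^ 6) * euler_prod (qpar \<tau> ^ 12))"
proof -
  have q: "qpar (of_nat k * \<tau>) = qpar \<tau> ^ k" for k
    unfolding qpar_def exp_of_nat_mult[symmetric] by (simp add: mult_ac)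
  have e: "dedekind_eta (of_nat k * \<tau>) = exp (2 * of_real pi * \<i> * (of_nat k * \<tau>) / 24) * euler_prod (qpar \<tau> ^ k)" for k
    unfolding dedekind_eta_def q euler_prod_def ..
  \<comment> \<open>Since 2 + 4 + 6 + 12 = 24, the fractional powers combine to q itself and no
    branch remains.\<close>
  have "exp (2 * of_real pi * \<i> * (2 * \<tau>) / 24) * exp (2 * of_real pi * \<i> * (4 * \<tau>) / 24) *
      exp (2 * of_real pi * \<i> * (6 * \<tau>) / 24) * exp (2 * of_real pi * \<i> * (12 * \<tau>) / 24) = qpar \<tau>"
    unfolding qpar_def exp_add[symmetric] by (rule arg_cong[of _ _ exp]) (simp add: field_simps)
  thus ?thesis unfolding eta_product_def using e[of 2] e[of 4] e[of 6] e[of 12] by (simp add: mult_ac)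
qed

theorem theorem3p1:
  "\<exists>r>0. \<forall>\<tau>. Im \<tau> > 0 \<and> norm (qpar \<tau>) < r \<longrightarrow>
     z_fun \<tau> \<noteq> 0 \<and> (\<lambda>n. of_nat (t_coeff n) * x_fun \<tau> ^ n) sums z_fun \<tau>"
proof -
  obtain r0 where r0: "r0 > 0" "r0 \<le> 1" and ser: "\<And>Q. 0 < norm Q \<Longrightarrow> norm Q < r0 \<Longrightarrow> norm (Z_fun Q - 1) < 1 / 2 \<and>
     B_theta 0 (Q * (euler_prod Q * euler_prod (Q\<^sup>2) * euler_prod (Q ^ 3) * euler_prod (Q ^ 6))\<^sup>2 / (Z_fun Q)\<^sup>2) = Z_fun Q"
    using level_six_series by blast
  define E where "E = (\<lambda>q. q * (euler_prod (q\<^sup>2) * euler_prod (q ^ 4) * euler_prod (q ^ 6) * euler_prod (q ^ 12)))"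
  have "(E \<longlongrightarrow> 0 * (euler_prod 0 * euler_prod 0 * euler_prod 0 * euler_prod 0)) (at 0)"
    unfolding E_def by (intro tendsto_intros tendsto_power_arg[OF euler_prod_holomorphic]) auto
  hence "\<forall>\<^sub>F q in at 0. dist (E q) 0 < 1 / 40" by (intro tendstoD) auto
  then obtain d where d: "d > 0" "\<And>q. q \<noteq> 0 \<Longrightarrow> norm q < d \<Longrightarrow> norm (E q) < 1 / 40"
    unfolding eventually_at by (auto simp: dist_norm)
  have "z_fun \<tau> \<noteq> 0 \<and> (\<lambda>n. of_nat (t_coeff n) * x_fun \<tau> ^ n) sums z_fun \<tau>"
    if q: "norm (qpar \<tau>) < min d r0" for \<tau>
  proof -
    define q e Q Z z x where "q = qpar \<tau>" "e = eta_product \<tau>" "Q = q\<^sup>2" "Z = Z_fun Q" "z = z_fun \<tau>" "x = x_fun \<tau>"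
    note defs = q_e_Q_Z_z_x_def
    \<comment> \<open>An exponential has no zeros, so statements on the punctured disc
      apply.\<close>
    have q0: "q \<noteq> 0" unfolding defs qpar_def by simp
    have q1: "norm q < 1" "norm q < r0" "norm q < d" using q r0 unfolding defs by auto
    have eE: "e = E q" unfolding defs E_def by (rule eta_product_eq)
    have ne: "norm e < 1 / 40" unfolding eE by (rule d(2)[OF q0 q1(3)])
    have "norm Q < r0" using power_two_power_norm_le[OF q1(1), of 1] q1 unfolding defs by simp
    moreover have "0 < norm Q" using q0 unfolding defs by simp
    ultimately have Zn: "norm (Z - 1) < 1 / 2"
      and B: "B_theta 0 (Q * (euler_prod Q * euler_prod (Q\<^sup>2) * euler_prod (Q ^ 3) * euler_prod (Q ^ 6))\<^sup>2 / Z\<^sup>2) = Z"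
      using ser[of Q] unfolding defs(4) by auto
    have e2: "e\<^sup>2 = Q * (euler_prod Q * euler_prod (Q\<^sup>2) * euler_prod (Q ^ 3) * euler_prod (Q ^ 6))\<^sup>2"
      unfolding eE E_def defs(3) by (simp add: power_mult_distrib flip: power_mult)
    have Z0: "Z \<noteq> 0" using Zn by auto
    have z: "z = Z + 2 * e"
      unfolding defs z_fun_def Z_fun_def Let_def by (simp flip: power_mult)
    have nZ: "norm Z > 1 / 2" using norm_triangle_ineq3[of Z 1] Zn by simp
    hence nz: "norm z > 9 / 20"
      using norm_triangle_ineq2[of Z "- 2 * e"] ne unfolding z by (simp add: norm_mult)
    hence z0: "z \<noteq> 0" by auto
    have x: "x = e / z" unfolding defs x_fun_def ..
    \<comment> \<open>From |e| < 1/40 and |Z| > 1/2 follow |z| > 9/20 and |x| < 1/18, well inside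
      the disc of radius 1/10 for the series of t.\<close>
    have nx: "norm x < 1 / 10"
    proof -
      have "norm x = norm e / norm z" unfolding x by (rule norm_divide)
      also have "\<dots> \<le> (1 / 40) / (9 / 20)" using ne nz by (intro frac_le) auto
      also have "\<dots> < 1 / 10" by simp
      finally show ?thesis .
    qed
    \<comment> \<open>The summand 2e of z makes 1 - 2x = Z/z, so that x/(1 - 2x) = e/Z and its
      square is the argument at which B equals Z.\<close>
    have x1: "1 - 2 * x = Z / z" unfolding x using z0 z by (simp add: field_simps)
    have "x / (1 - 2 * x) = e / Z" unfolding x1 unfolding x using z0 Z0 by simp
    hence X: "(x / (1 - 2 * x))\<^sup>2 = Q * (euler_prod Q * euler_prod (Q\<^sup>2) * euler_prod (Q ^ 3) * euler_prod (Q ^ 6))\<^sup>2 / Z\<^sup>2"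
      by (simp add: power_divide e2)
    have "(\<Sum>j. of_nat (b_coeff j) * ((x / (1 - 2 * x))\<^sup>2) ^ j) = Z"
      using B unfolding X[symmetric] B_theta_def by simp
    with t_coeff_sums[OF nx] have "(\<lambda>n. of_nat (t_coeff n) * x ^ n) sums (1 / (Z / z) * Z)" unfolding x1 by simp
    hence "(\<lambda>n. of_nat (t_coeff n) * x ^ n) sums z" using Z0 by simp
    thus ?thesis using z0 unfolding defs by simp
  qed
  thus ?thesis using d(1) r0(1) by (intro exI[of _ "min d r0"]) auto
qed

end
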